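(* Let $X$ be a hyperelliptic curve of genus $g$ over a field $F$ of characteristic $\neq2$, with affine model $y^2=f(x)$, $\deg f=2g+1$. Assume $1\le\ell\le g$, in which case the complete linear series defined by $\mathcal{O}_X(2\ell\infty_X)$ has basis $\lambda=(1,x,x^2,\dots,x^\ell)$. Then the zero locus of the Hasse Wronskian $w(\lambda)$ is $\binom{\ell+1}{2}$ times the ramification divisor $R_\pi$. Moreover, near any inflection point $p\ne\infty_X$ in $R_\pi$, $$w(\lambda)=\left(\frac{Dx}{dt}\right)^{\binom{\ell+1}{2}}$$ where $t$ is a local Nisnevich uniformizer at $p$.
   Context: $X$ is smooth and projective, $\pi:X\to\mathbb{P}^1$ is $(x,y)\mapsto x$, $\infty_X=\pi^{-1}(\infty)$, and $R_\pi$ is the (reduced) ramification divisor of $\pi$, consisting of $\infty_X$ and the points $(\gamma,0)$ with $f(\gamma)=0$. If $t$ is a regular function on an open $U\subset X$ with $dt$ nowhere vanishing, the Hasse derivatives $\frac{D^k}{dt}:\mathcal{O}_U\to\mathcal{O}_U$ are the unique $F$-linear maps with $D^0=\mathrm{id}$, $\frac{D^k(\phi\psi)}{dt}=\sum_{i=0}^k\frac{D^i\phi}{dt}\frac{D^{k-i}\psi}{dt}$ and $\frac{D^kt^n}{dt}=\binom nkt^{n-k}$; $\frac{D}{dt}=\frac{D^1}{dt}$. Hasse Wronskian: let $L=\mathcal{O}_X(2\ell\infty_X)$, $r+1=h^0(L)=\ell+1$. For a local generator $s$ of $L$ and a local étale coordinate $t$ on $U$, $w(\lambda)$ is represented by $\det\left(\frac{D^i(\lambda_j/s)}{dt}\right)_{0\le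 i,j\le r}\in\mathcal{O}_U$; these local expressions glue to a global section $w(\lambda)$ of $\det J^{r+1}(L)\cong L^{\otimes(r+1)}\otimes K_X^{\otimes\binom{r+1}2}$, where $J^{r+1}(L)$ is the bundle of order-$r$ principal parts. On $X\setminus\{\infty_X\}$ the generator used is $s=1$; near $\infty_X$ it is $s=x^\ell$. Inflection points are the zeros of $w(\lambda)$. A local Nisnevich uniformizer $t$ at $p\neq\infty_X$ is an $F$-linear combination $t=ax+by$ that is étale near $p$, viewed as a map $U\to\mathbb{A}^1_F$ from a neighborhood of $p$, and that induces an isomorphism of residue fields $k(t(p))\cong k(p)$. The displayed equality is between $\det(\frac{D^i\lambda_j}{dt})$ and the right-hand side, in the trivialization given by $s=1$ and $dt$. *)

theory Defs
  imports "HOL-Algebra.Ideal" "Jordan_Normal_Form.Determinant"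
begin

text \<open>
  Schemes are not available, so the smooth projective curve $X$ is described through its function
  field $K$, a type of class \<^class>\<open>field\<close>.  $X$ is glued from the two affine curves
  $y^2 = f(x)$ and $v^2 = u^{2g+2} f(1/u)$, with $u = 1/x$ and $v = y/x^{g+1}$; both coordinate
  rings, all local rings and all rings of regular functions are subrings of $K$.  Functions on open
  sets, and their restrictions to smaller ones, are therefore simply elements of $K$.
\<close>

section \<open>Hyperelliptic curves\<close>

record (overloaded) ('a, 'k) hyp_curve =
  emb :: "'a \<Rightarrow> 'k"        (* constants: the embedding of F into K *)
  defpol :: "'a poly"      (* f *)
  genus :: nat             (* g *)
  xfun :: 'k
  yfun :: 'k

definition polyval :: "('a::field, 'k::field) hyp_curve \<Rightarrow> 'a poly \<Rightarrow> 'k \<Rightarrow> 'k" where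
  "polyval X q z = poly (map_poly (emb X) q) z"

text \<open>The coordinate ring $F[z,w]$ of a double cover $w^2 = h(z)$ of the line.\<close>

definition double_cover_ring :: "('a::field, 'k::field) hyp_curve \<Rightarrow> 'k \<Rightarrow> 'k \<Rightarrow> 'k set" where
  "double_cover_ring X z w = {polyval X q z + polyval X r z * w | q r. True}"

definition affine_ring :: "('a::field, 'k::field) hyp_curve \<Rightarrow> 'k set" where
  "affine_ring X = double_cover_ring X (xfun X) (yfun X)"

definition u_fun :: "('a::field, 'k::field) hyp_curve \<Rightarrow> 'k" where
  "u_fun X = 1 / xfun X"

definition v_fun :: "('a::field, 'k::field) hyp_curve \<Rightarrow> 'k" where
  "v_fun X = yfun X / xfun X ^ (genus X + 1)"

definition infinity_ring :: "('a::field, 'k::field) hyp_curve \<Rightarrow> 'k set" where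
  "infinity_ring X = double_cover_ring X (u_fun X) (v_fun X)"

text \<open>
  As the characteristic is not 2, the Jacobian criterion says that the affine model $y^2 = f(x)$ is
  smooth if and only if $f$ is separable; the second chart is then smooth along $u = 0$ because
  $u^{2g+2} f(1/u)$ has a simple zero there.  The last three conditions say that $K$ is the fraction
  field of $F[x,y]/(y^2 - f(x))$.
\<close>

definition hyperelliptic_curve :: "('a::field, 'k::field) hyp_curve \<Rightarrow> bool" where
  "hyperelliptic_curve X \<longleftrightarrow>
     (2::'a) \<noteq> 0 \<and>
     degree (defpol X) = 2 * genus X + 1 \<and>
     coprime (defpol X) (pderiv (defpol X)) \<and>
     field_hom (emb X) \<and>
     (\<forall>q. polyval X q (xfun X) = 0 \<longrightarrow> q = 0) \<and>
     yfun X ^ 2 = polyval X (defpol X) (xfun X) \<and>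
     (\<forall>\<phi>. \<exists>a\<in>affine_ring X. \<exists>b\<in>affine_ring X. b \<noteq> 0 \<and> \<phi> = a / b)"

section \<open>Closed points and local rings\<close>

text \<open>
  \<open>Infinity\<close> is the point $u = v = 0$ of the second chart, the only point of $X$ outside the
  affine model.  $F$ need not be algebraically closed, so closed points are maximal ideals and not
  pairs of coordinates.
\<close>

datatype 'k closed_point = Affine "'k set" | Infinity

definition subring_record :: "'k::field set \<Rightarrow> 'k ring" where
  "subring_record A = \<lparr>carrier = A, monoid.mult = (*), one = 1, zero = 0, add = (+)\<rparr>"

definition closed_points :: "('a::field, 'k::field) hyp_curve \<Rightarrow> 'k closed_point set" where
  "closed_points X =
     insert Infinity {Affine P | P. maximalideal P (subring_record (affine_ring X))}"

fun chart_ring :: "('a::field, 'k::field) hyp_curve \<Rightarrow> 'k closed_point \<Rightarrow> 'k set" where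
  "chart_ring X (Affine P) = affine_ring X"
| "chart_ring X Infinity = infinity_ring X"

fun point_ideal :: "('a::field, 'k::field) hyp_curve \<Rightarrow> 'k closed_point \<Rightarrow> 'k set" where
  "point_ideal X (Affine P) = P"
| "point_ideal X Infinity =
     {u_fun X * a + v_fun X * b | a b. a \<in> infinity_ring X \<and> b \<in> infinity_ring X}"

definition local_ring :: "('a::field, 'k::field) hyp_curve \<Rightarrow> 'k closed_point \<Rightarrow> 'k set" where
  "local_ring X p = {a / b | a b. a \<in> chart_ring X p \<and> b \<in> chart_ring X p - point_ideal X p}"

definition max_ideal :: "('a::field, 'k::field) hyp_curve \<Rightarrow> 'k closed_point \<Rightarrow> 'k set" where
  "max_ideal X p = {a / b | a b. a \<in> point_ideal X p \<and> b \<in> chart_ring X p - point_ideal X p}"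

text \<open>
  The order of vanishing (negative at poles), for the discrete valuation ring
  \<^term>\<open>local_ring X p\<close>; it is meaningful only for a nonzero function.
\<close>

definition ord_at :: "('a::field, 'k::field) hyp_curve \<Rightarrow> 'k closed_point \<Rightarrow> 'k \<Rightarrow> int" where
  "ord_at X p \<phi> = (THE n. \<exists>\<pi> e. max_ideal X p = {\<pi> * a | a. a \<in> local_ring X p} \<and>
      e \<in> local_ring X p - max_ideal X p \<and> \<phi> = e * \<pi> powi n)"

definition open_subset :: "('a::field, 'k::field) hyp_curve \<Rightarrow> 'k closed_point set \<Rightarrow> bool" where
  "open_subset X U \<longleftrightarrow> U \<subseteq> closed_points X \<and> U \<noteq> {} \<and> finite (closed_points X - U)"

definition regular_functions ::
    "('a::field, 'k::field) hyp_curve \<Rightarrow> 'k closed_point set \<Rightarrow> 'k set" where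
  "regular_functions X U = {\<phi>. \<forall>p\<in>U. \<phi> \<in> local_ring X p}"

section \<open>Differentials, etale coordinates and Hasse derivatives\<close>

text \<open>
  Tangent vectors at $p$ are the $F$-derivations $O_{X,p} \to k(p)$.  Values in
  $k(p) = O_{X,p}/m_p$ are given by representatives, so the identities hold modulo $m_p$.
\<close>

definition tangent_vector ::
    "('a::field, 'k::field) hyp_curve \<Rightarrow> 'k closed_point \<Rightarrow> ('k \<Rightarrow> 'k) \<Rightarrow> bool" where
  "tangent_vector X p v \<longleftrightarrow>
     (\<forall>\<phi>\<in>local_ring X p. v \<phi> \<in> local_ring X p) \<and>
     (\<forall>\<phi>\<in>local_ring X p. \<forall>\<psi>\<in>local_ring X p.
        v (\<phi> + \<psi>) - (v \<phi> + v \<psi>) \<in> max_ideal X p \<and>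
        v (\<phi> * \<psi>) - (\<phi> * v \<psi> + \<psi> * v \<phi>) \<in> max_ideal X p) \<and>
     (\<forall>c. v (emb X c) \<in> max_ideal X p)"

text \<open>
  $dt$ vanishes at $p$ when its value in the fibre $\Omega_{X/F} \otimes k(p)$, the space of
  linear forms on tangent vectors at $p$, is zero.
\<close>

definition differential_vanishes_at ::
    "('a::field, 'k::field) hyp_curve \<Rightarrow> 'k \<Rightarrow> 'k closed_point \<Rightarrow> bool" where
  "differential_vanishes_at X t p \<longleftrightarrow> (\<forall>v. tangent_vector X p v \<longrightarrow> v t \<in> max_ideal X p)"

text \<open>
  As $X$ is smooth of dimension one, a regular function $t$ on $U$ is etale as a map from $U$ to the
  affine line if and only if $dt$ vanishes nowhere on $U$.
\<close>

definition etale_coordinate ::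
    "('a::field, 'k::field) hyp_curve \<Rightarrow> 'k closed_point set \<Rightarrow> 'k \<Rightarrow> bool" where
  "etale_coordinate X U t \<longleftrightarrow>
     t \<in> regular_functions X U \<and> (\<forall>p\<in>U. \<not> differential_vanishes_at X t p)"

text \<open>The value $0$ outside $O_U$ only serves to make the family unique as a total function.\<close>

definition is_hasse_family ::
    "('a::field, 'k::field) hyp_curve \<Rightarrow> 'k closed_point set \<Rightarrow> 'k \<Rightarrow> (nat \<Rightarrow> 'k \<Rightarrow> 'k) \<Rightarrow> bool" where
  "is_hasse_family X U t D \<longleftrightarrow>
     (\<forall>k. \<forall>\<phi>\<in>regular_functions X U. D k \<phi> \<in> regular_functions X U) \<and>
     (\<forall>k. \<forall>\<phi>\<in>regular_functions X U. \<forall>\<psi>\<in>regular_functions X U.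
        D k (\<phi> + \<psi>) = D k \<phi> + D k \<psi>) \<and>
     (\<forall>k c. \<forall>\<phi>\<in>regular_functions X U. D k (emb X c * \<phi>) = emb X c * D k \<phi>) \<and>
     (\<forall>\<phi>\<in>regular_functions X U. D 0 \<phi> = \<phi>) \<and>
     (\<forall>k. \<forall>\<phi>\<in>regular_functions X U. \<forall>\<psi>\<in>regular_functions X U.
        D k (\<phi> * \<psi>) = (\<Sum>i=0..k. D i \<phi> * D (k - i) \<psi>)) \<and>
     (\<forall>k n. D k (t ^ n) = of_nat (n choose k) * t ^ (n - k)) \<and>
     (\<forall>k \<phi>. \<phi> \<notin> regular_functions X U \<longrightarrow> D k \<phi> = 0)"

definition hasse ::
    "('a::field, 'k::field) hyp_curve \<Rightarrow> 'k closed_point set \<Rightarrow> 'k \<Rightarrow> nat \<Rightarrow> 'k \<Rightarrow> 'k" where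
  "hasse X U t = (THE D. is_hasse_family X U t D)"

section \<open>Line bundles and their sections\<close>

type_synonym 'k divisor = "'k closed_point \<Rightarrow> int"

definition bundle_stalk ::
    "('a::field, 'k::field) hyp_curve \<Rightarrow> 'k divisor \<Rightarrow> 'k closed_point \<Rightarrow> 'k set" where
  "bundle_stalk X E p = {\<phi>. \<phi> \<noteq> 0 \<longrightarrow> ord_at X p \<phi> \<ge> - E p}"

definition global_sections :: "('a::field, 'k::field) hyp_curve \<Rightarrow> 'k divisor \<Rightarrow> 'k set" where
  "global_sections X E = {\<phi>. \<forall>p\<in>closed_points X. \<phi> \<in> bundle_stalk X E p}"

definition local_generator ::
    "('a::field, 'k::field) hyp_curve \<Rightarrow> 'k divisor \<Rightarrow> 'k closed_point set \<Rightarrow> 'k \<Rightarrow> bool" where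
  "local_generator X E U s \<longleftrightarrow> (\<forall>p\<in>U. bundle_stalk X E p = {s * a | a. a \<in> local_ring X p})"

text \<open>
  A frame $(U,s,t)$ trivialises every bundle $L^{\otimes m} \otimes K_X^{\otimes n}$, $L = O_X(E)$,
  over $U$ by $s^m (dt)^n$.  Sections of this bundle are families of local expressions
  $\sigma\,U\,s\,t$, one in each frame, that satisfy the transition law
  $\sigma\; s^m (dt)^n = \sigma'\; s'^m (dt')^n$.
\<close>

definition frame ::
    "('a::field, 'k::field) hyp_curve \<Rightarrow> 'k divisor \<Rightarrow> 'k closed_point set \<Rightarrow> 'k \<Rightarrow> 'k \<Rightarrow> bool" where
  "frame X E U s t \<longleftrightarrow> open_subset X U \<and> local_generator X E U s \<and> etale_coordinate X U t"

type_synonym 'k local_expressions = "'k closed_point set \<Rightarrow> 'k \<Rightarrow> 'k \<Rightarrow> 'k"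

definition is_global_section ::
    "('a::field, 'k::field) hyp_curve \<Rightarrow> 'k divisor \<Rightarrow> nat \<Rightarrow> nat \<Rightarrow> 'k local_expressions \<Rightarrow> bool" where
  "is_global_section X E m n \<sigma> \<longleftrightarrow>
     (\<forall>U s t. frame X E U s t \<longrightarrow> \<sigma> U s t \<in> regular_functions X U) \<and>
     (\<forall>U s t U' s' t'. frame X E U s t \<and> frame X E U' s' t' \<longrightarrow>
        \<sigma> U' s' t' = \<sigma> U s t * (s / s') ^ m * hasse X (U \<inter> U') t' 1 t ^ n)"

definition section_zeros ::
    "('a::field, 'k::field) hyp_curve \<Rightarrow> 'k divisor \<Rightarrow> 'k local_expressions \<Rightarrow> 'k closed_point set" where
  "section_zeros X E \<sigma> =
     {p \<in> closed_points X. \<exists>U s t. frame X E U s t \<and> p \<in> U \<and> \<sigma> U s t \<in> max_ideal X p}"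

text \<open>The zero locus with multiplicities; \<open>Z\<close> only matters at closed points.\<close>

definition has_zero_divisor ::
    "('a::field, 'k::field) hyp_curve \<Rightarrow> 'k divisor \<Rightarrow> 'k local_expressions \<Rightarrow> 'k divisor \<Rightarrow> bool" where
  "has_zero_divisor X E \<sigma> Z \<longleftrightarrow>
     (\<forall>p\<in>closed_points X.
        (\<exists>U s t. frame X E U s t \<and> p \<in> U) \<and>
        (\<forall>U s t. frame X E U s t \<and> p \<in> U \<longrightarrow> \<sigma> U s t \<noteq> 0 \<and> ord_at X p (\<sigma> U s t) = Z p))"

section \<open>The Hasse Wronskian\<close>

text \<open>The divisor $2\ell\infty_X$.\<close>

fun infinity_divisor :: "nat \<Rightarrow> 'k divisor" where
  "infinity_divisor l (Affine P) = 0"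
| "infinity_divisor l Infinity = 2 * int l"

definition monomial_basis :: "('a::field, 'k::field) hyp_curve \<Rightarrow> nat \<Rightarrow> 'k list" where
  "monomial_basis X l = map (\<lambda>j. xfun X ^ j) [0..<Suc l]"

definition hasse_wronskian ::
    "('a::field, 'k::field) hyp_curve \<Rightarrow> 'k list \<Rightarrow> 'k local_expressions" where
  "hasse_wronskian X fs U s t =
     det (mat (length fs) (length fs) (\<lambda>(i, j). hasse X U t i (fs ! j / s)))"

definition is_basis_of ::
    "('a::field, 'k::field) hyp_curve \<Rightarrow> 'k list \<Rightarrow> 'k set \<Rightarrow> bool" where
  "is_basis_of X fs V \<longleftrightarrow>
     distinct fs \<and>
     \<not> Modules.module.dependent (\<lambda>c \<phi>. emb X c * \<phi>) (set fs) \<and>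
     Modules.module.span (\<lambda>c \<phi>. emb X c * \<phi>) (set fs) = V"

section \<open>Ramification and Nisnevich uniformizers\<close>

text \<open>
  The map $\pi = x$ to the projective line is ramified at $p$ when it is not etale there; near
  \<open>Infinity\<close> the coordinate $1/x$ on the projective line has to be used.
\<close>

fun base_coordinate :: "('a::field, 'k::field) hyp_curve \<Rightarrow> 'k closed_point \<Rightarrow> 'k" where
  "base_coordinate X (Affine P) = xfun X"
| "base_coordinate X Infinity = 1 / xfun X"

definition ramification_points :: "('a::field, 'k::field) hyp_curve \<Rightarrow> 'k closed_point set" where
  "ramification_points X =
     {p \<in> closed_points X. differential_vanishes_at X (base_coordinate X p) p}"

definition ramification_divisor :: "('a::field, 'k::field) hyp_curve \<Rightarrow> 'k divisor" where
  "ramification_divisor X p = (if p \<in> ramification_points X then 1 else 0)"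

text \<open>
  The residue field $k(t(p))$ is the quotient of $F[T]$ by the kernel of $T \mapsto t(p) \in k(p)$, so
  that $k(t(p)) \to k(p)$ is an isomorphism if and only if every element of $k(p)$ is a polynomial
  in $t(p)$.
\<close>

definition nisnevich_uniformizer ::
    "('a::field, 'k::field) hyp_curve \<Rightarrow> 'k closed_point \<Rightarrow> 'k \<Rightarrow> bool" where
  "nisnevich_uniformizer X p t \<longleftrightarrow>
     (\<exists>a b. t = emb X a * xfun X + emb X b * yfun X) \<and>
     (\<exists>U. open_subset X U \<and> p \<in> U \<and> etale_coordinate X U t) \<and>
     (\<forall>\<phi>\<in>local_ring X p. \<exists>q. \<phi> - polyval X q t \<in> max_ideal X p)"

end

theory Submission
  imports Defs "HOL-Computational_Algebra.Formal_Power_Series" "Subresultants.More_Homomorphisms"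
begin

text \<open>
  A higher derivation of the function field \<open>K\<close> is the same as a ring homomorphism
  \<open>\<theta> : K \<rightarrow> K[[T]]\<close> with constant coefficient the identity.  Since \<open>K\<close> is generated by \<open>x\<close> and
  \<open>y = sqrt (f x)\<close>, such a \<open>\<theta>\<close> is determined by \<open>\<theta> x\<close>, which can be prescribed arbitrarily, so the
  Hasse derivatives for a coordinate \<open>t\<close> are obtained from those for \<open>x\<close> by a substitution in \<open>T\<close>;
  Hensel's lemma shows that they preserve the local rings at which \<open>dt\<close> does not vanish.  With
  \<open>E = \<theta> x - x\<close>, the matrix of coefficients of \<open>\<theta> (x\<^sup>j / s) = \<theta> (1 / s) (x + E)\<^sup>j\<close> is a product of
  triangular matrices, so the Wronskian is \<open>s\<close> to the power \<open>- (l + 1)\<close> times the power of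
  \<open>Dx/dt\<close> with exponent \<open>1 + \<dots> + l\<close>.
  Its order at a point is then read off from the relation \<open>2 y dy = f' dx\<close>, and from the analogous one
  between \<open>u\<close> and \<open>v\<close> at infinity.
\<close>

no_notation vec_index (infixl \<open>$\<close> 100)
unbundle fps_syntax

section \<open>Power series over subrings of a field\<close>

text \<open>In positive characteristic the iterates of \<open>dx\<close> do not determine the Hasse
  derivatives, so all orders are handled at once, as coefficients of one homomorphism. The family
  \<open>hasse X U t\<close> is prescribed only on the regular functions, and its coordinate only
  through the powers of \<open>t\<close>. That this pins it down rests on two facts:
  \<open>K\<close> is the fraction field of the ring of regular functions, and
  \<open>\<theta> t = t + T\<close> forces \<open>\<theta> x - x\<close> to be the compositional
  inverse of \<open>taylor_at x t - t\<close>. Residue fields may be larger than \<open>F\<close>,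
  so two functions are attached to a point: an etale coordinate (\<open>x\<close>, \<open>y\<close>
  or \<open>v\<close>), which need not vanish there, and a uniformizer, which is \<open>y\<close> or
  \<open>v\<close> at ramification points and can be taken as a polynomial in \<open>x\<close>
  elsewhere. With N = (l+1 choose 2), the multiplicity N at infinity is a balance: the generator
  \<open>s\<close>, of order -2l, contributes 2l(l+1) = 4N, and \<open>dv/dx\<close>, of order 3,
  takes away 3N.\<close>

locale field_subring =
  fixes R :: "'k::field set"
  assumes one_mem: "1 \<in> R"
    and diff_mem: "a \<in> R \<Longrightarrow> b \<in> R \<Longrightarrow> a - b \<in> R"
    and mult_mem: "a \<in> R \<Longrightarrow> b \<in> R \<Longrightarrow> a * b \<in> R"
begin

lemma zero_mem: "0 \<in> R"
  using diff_mem[OF one_mem one_mem] by simp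

lemma uminus_mem: "a \<in> R \<Longrightarrow> - a \<in> R"
  using diff_mem[OF zero_mem] by fastforce

lemma add_mem: "a \<in> R \<Longrightarrow> b \<in> R \<Longrightarrow> a + b \<in> R"
  using diff_mem[of a "- b"] uminus_mem by simp

lemma power_mem: "a \<in> R \<Longrightarrow> a ^ n \<in> R"
  by (induction n) (simp_all add: one_mem mult_mem)

lemma sum_mem: "(\<And>i. i \<in> I \<Longrightarrow> h i \<in> R) \<Longrightarrow> sum h I \<in> R"
  by (induction I rule: infinite_finite_induct) (auto intro: zero_mem add_mem)

lemma prod_mem: "(\<And>i. i \<in> I \<Longrightarrow> h i \<in> R) \<Longrightarrow> prod h I \<in> R"
  by (induction I rule: infinite_finite_induct) (auto intro: one_mem mult_mem)

lemma of_nat_mem: "of_nat n \<in> R"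
  by (induction n) (simp_all add: zero_mem one_mem add_mem)

text \<open>Makes the Wronskian regular: the Leibniz expansion stays inside \<open>R\<close>, signs
  included.\<close>

lemma det_mem:
  assumes "\<And>i j. i < n \<Longrightarrow> j < n \<Longrightarrow> h i j \<in> R"
  shows "det (mat n n (\<lambda>(i, j). h i j)) \<in> R"
proof -
  have "signof p \<in> R" for p
    by (auto simp: sign_def intro: one_mem uminus_mem)
  moreover have "p i < n" if "p permutes {0..<n}" "i < n" for p i
    using permutes_in_image[OF that(1), of i] that(2) by auto
  ultimately show ?thesis
    by (auto simp: det_def intro!: sum_mem mult_mem prod_mem assms)
qed

end

text \<open>This is \<open>R[[T]]\<close> inside \<open>K[[T]]\<close>. For a Taylor series,
  membership says that all Hasse derivatives lie in \<open>R\<close> at once.\<close>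

definition fps_over :: "'k::field set \<Rightarrow> 'k fps set" where
  "fps_over R = {A. \<forall>n. A $ n \<in> R}"

context field_subring
begin

lemma fps_over_nth: "A \<in> fps_over R \<Longrightarrow> A $ n \<in> R"
  by (simp add: fps_over_def)

lemma fps_over_const: "a \<in> R \<Longrightarrow> fps_const a \<in> fps_over R"
  by (simp add: fps_over_def zero_mem)

lemma fps_over_X: "fps_X \<in> fps_over R"
  by (simp add: fps_over_def fps_X_def zero_mem one_mem)

lemma fps_over_add: "A \<in> fps_over R \<Longrightarrow> B \<in> fps_over R \<Longrightarrow> A + B \<in> fps_over R"
  by (simp add: fps_over_def add_mem)

lemma fps_over_diff: "A \<in> fps_over R \<Longrightarrow> B \<in> fps_over R \<Longrightarrow> A - B \<in> fps_over R"
  by (simp add: fps_over_def diff_mem)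

lemma fps_over_mult: "A \<in> fps_over R \<Longrightarrow> B \<in> fps_over R \<Longrightarrow> A * B \<in> fps_over R"
  by (auto simp: fps_over_def fps_mult_nth intro: sum_mem mult_mem)

lemma fps_over_power: "A \<in> fps_over R \<Longrightarrow> A ^ n \<in> fps_over R"
  by (induction n) (use fps_over_const[OF one_mem] in \<open>auto intro: fps_over_mult\<close>)

text \<open>The constant coefficient is a unit of \<open>R\<close>, so the coefficients of the
  inverse can be solved for one after the other.\<close>

lemma fps_over_inverse:
  assumes "A \<in> fps_over R" and "inverse (A $ 0) \<in> R" and "A $ 0 \<noteq> 0"
  shows "inverse A \<in> fps_over R"
proof -
  have "inverse A $ n \<in> R" for n
  proof (induction n rule: less_induct)
    case (less n)
    show ?case
    proof (cases "n = 0")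
      case False
      have "0 = (inverse A * A) $ n"
        using assms(3) False by (simp add: inverse_mult_eq_1)
      also have "\<dots> = inverse A $ n * A $ 0 + (\<Sum>i<n. inverse A $ i * A $ (n - i))"
        by (simp add: fps_mult_nth atLeast0AtMost lessThan_Suc_atMost[symmetric] add.commute)
      finally have "inverse A $ n = - (\<Sum>i<n. inverse A $ i * A $ (n - i)) * inverse (A $ 0)"
        using assms(3) by (simp add: field_simps eq_neg_iff_add_eq_0)
      also have "\<dots> \<in> R"
        using less assms by (intro mult_mem uminus_mem sum_mem) (auto simp: fps_over_def)
      finally show ?thesis .
    qed (use assms in simp)
  qed
  then show ?thesis by (simp add: fps_over_def)
qed

lemma fps_over_compose:
  assumes "A \<in> fps_over R" and "B \<in> fps_over R"
  shows "A oo B \<in> fps_over R"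
  using assms fps_over_power[OF assms(2)]
  by (auto simp: fps_over_def fps_compose_nth intro!: sum_mem mult_mem)

lemma fps_over_cutoff: "(\<And>i. i < n \<Longrightarrow> A $ i \<in> R) \<Longrightarrow> fps_cutoff n A \<in> fps_over R"
  by (simp add: fps_over_def zero_mem)

end

section \<open>Polynomials evaluated at power series\<close>

definition fps_eval :: "'k::field poly \<Rightarrow> 'k fps \<Rightarrow> 'k fps" where
  "fps_eval q A = poly (map_poly fps_const q) A"

lemma fps_eval_0 [simp]: "fps_eval 0 A = 0"
  by (simp add: fps_eval_def)

lemma fps_eval_1 [simp]: "fps_eval 1 A = 1"
  by (simp add: fps_eval_def)

lemma fps_eval_pCons [simp]: "fps_eval (pCons a q) A = fps_const a + A * fps_eval q A"
  by (simp add: fps_eval_def Polynomial.map_poly_pCons)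

lemma fps_eval_add: "fps_eval (p + q) A = fps_eval p A + fps_eval q A"
proof -
  have "map_poly fps_const (p + q) = map_poly fps_const p + map_poly fps_const q"
    by (intro poly_eqI) (simp add: coeff_map_poly)
  then show ?thesis by (simp add: fps_eval_def)
qed

lemma fps_eval_monom: "fps_eval (monom 1 n) A = A ^ n"
  by (simp add: fps_eval_def map_poly_monom poly_monom)

lemma fps_eval_nth_0 [simp]: "fps_eval q A $ 0 = poly q (A $ 0)"
  by (induction q) auto

lemma fps_eval_const: "fps_eval q (fps_const a) = fps_const (poly q a)"
  by (induction q) auto

lemma (in field_subring) fps_over_eval:
  assumes "\<And>i. coeff q i \<in> R" and "A \<in> fps_over R"
  shows "fps_eval q A \<in> fps_over R"
  using assms(1)
proof (induction q)
  case 0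
  then show ?case using fps_over_const[OF zero_mem] by simp
next
  case (pCons a q)
  have "coeff q i \<in> R" for i
    using pCons.prems[of "Suc i"] by simp
  moreover have "a \<in> R"
    using pCons.prems[of 0] by simp
  ultimately show ?case
    using pCons.IH by (auto intro!: fps_over_add fps_over_mult fps_over_const assms(2))
qed

text \<open>Horner recursion builds the second-order remainder \<open>G\<close> directly; no
  factorials are divided by, so this holds in every characteristic.\<close>

lemma fps_eval_taylor:
  "\<exists>G. fps_eval q (A + B) = fps_eval q A + fps_eval (pderiv q) A * B + B\<^sup>2 * G"
proof (induction q)
  case 0
  then show ?case by (intro exI[of _ 0]) simp
next
  case (pCons a q)
  then obtain G where G: "fps_eval q (A + B) = fps_eval q A + fps_eval (pderiv q) A * B + B\<^sup>2 * G"
    by blast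
  show ?case
    by (rule exI[of _ "fps_eval (pderiv q) A + (A + B) * G"])
      (simp add: G pderiv_pCons fps_eval_add algebra_simps power2_eq_square)
qed

text \<open>The Newton step: a perturbation of order \<open>n > 0\<close> has a square of order
  \<open>2n > n\<close>, so the \<open>n\<close>-th coefficient sees only the linear term.\<close>

lemma fps_eval_nth_step:
  assumes "0 < n"
  shows "fps_eval q (A + fps_X ^ n * C) $ n = fps_eval q A $ n + poly (pderiv q) (A $ 0) * C $ 0"
proof -
  obtain G where G: "fps_eval q (A + fps_X ^ n * C) =
      fps_eval q A + fps_eval (pderiv q) A * (fps_X ^ n * C) + (fps_X ^ n * C)\<^sup>2 * G"
    using fps_eval_taylor by blast
  have "fps_eval (pderiv q) A * (fps_X ^ n * C) = fps_X ^ n * (fps_eval (pderiv q) A * C)"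
    by (simp add: algebra_simps)
  then have 1: "(fps_eval (pderiv q) A * (fps_X ^ n * C)) $ n = poly (pderiv q) (A $ 0) * C $ 0"
    by (simp only: fps_X_power_mult_nth) simp
  have "(fps_X ^ n * C)\<^sup>2 * G = fps_X ^ (n + n) * (C\<^sup>2 * G)"
    by (simp add: algebra_simps power2_eq_square power_add)
  then have 2: "((fps_X ^ n * C)\<^sup>2 * G) $ n = 0"
    using assms by (simp only: fps_X_power_mult_nth) simp
  show ?thesis by (simp add: G 1 2)
qed

lemma fps_eval_nth_1: "fps_eval q A $ 1 = poly (pderiv q) (A $ 0) * A $ 1"
proof -
  have "A = fps_const (A $ 0) + fps_X ^ 1 * fps_shift 1 A"
    by (simp add: fps_eq_iff)
  then have "fps_eval q A $ 1 = fps_eval q (fps_const (A $ 0) + fps_X ^ 1 * fps_shift 1 A) $ 1"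
    by simp
  also have "\<dots> = poly (pderiv q) (A $ 0) * A $ 1"
    by (subst fps_eval_nth_step) (simp_all add: fps_eval_const)
  finally show ?thesis .
qed

lemma fps_cutoff_decomp: "A = fps_cutoff n A + fps_X ^ n * fps_shift n A"
  by (simp add: fps_eq_iff fps_X_power_mult_nth)

section \<open>Integrality of implicitly defined power series\<close>

context field_subring
begin

text \<open>Hensel's lemma as a statement on integrality: \<open>A\<close> is already given over the
  field. Once the lower coefficients lie in \<open>R\<close>, the \<open>n\<close>-th one is
  obtained by dividing by the unit \<open>q'(A $ 0)\<close>.\<close>

lemma hensel_integral:
  assumes coeffs: "\<And>i. coeff q i \<in> R" and A0: "A $ 0 \<in> R"
    and unit: "poly (pderiv q) (A $ 0) \<noteq> 0" "inverse (poly (pderiv q) (A $ 0)) \<in> R"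
    and int: "fps_eval q A \<in> fps_over R"
  shows "A \<in> fps_over R"
proof -
  have "A $ n \<in> R" for n
  proof (induction n rule: less_induct)
    case (less n)
    show ?case
    proof (cases "n = 0")
      case False
      define B where "B = fps_cutoff n A"
      have B: "B \<in> fps_over R"
        unfolding B_def using less by (intro fps_over_cutoff)
      have "fps_eval q A $ n = fps_eval q B $ n + poly (pderiv q) (A $ 0) * A $ n"
        using False fps_eval_nth_step[of n q B "fps_shift n A"]
        by (subst fps_cutoff_decomp[of A n]) (simp add: B_def)
      then have "A $ n = (fps_eval q A $ n - fps_eval q B $ n) * inverse (poly (pderiv q) (A $ 0))"
        using unit(1) by (simp add: field_simps)
      also have "\<dots> \<in> R"
        by (intro mult_mem diff_mem unit(2) fps_over_nth int fps_over_eval coeffs B)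
      finally show ?thesis .
    qed (use A0 in simp)
  qed
  then show ?thesis by (simp add: fps_over_def)
qed

text \<open>Since \<open>A $ 1\<close> is a unit of \<open>R\<close>, comparing coefficients in
  \<open>A oo S = T\<close> expresses each \<open>S $ n\<close> over \<open>R\<close> through the
  earlier ones.\<close>

lemma compose_inverse_integral:
  assumes A: "A \<in> fps_over R" "A $ 1 \<noteq> 0" "inverse (A $ 1) \<in> R"
    and S: "S $ 0 = 0" and eq: "A oo S = fps_X"
  shows "S \<in> fps_over R"
proof -
  have "S $ n \<in> R" for n
  proof (induction n rule: less_induct)
    case (less n)
    show ?case
    proof (cases "n = 0")
      case False
      define B where "B = fps_cutoff n S"
      have B: "B \<in> fps_over R"
        unfolding B_def using less by (intro fps_over_cutoff)
      have B0: "B $ 0 = 0"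
        using S by (simp add: B_def)
      \<comment> \<open>Among the powers of \<open>S\<close> only the first feels the new
        coefficient: \<open>B\<close> has no constant term, and the derivative of \<open>T^i\<close>
        at 0 vanishes unless \<open>i = 1\<close>.\<close>
      have pow: "(S ^ i) $ n = (B ^ i) $ n + (if i = 1 then S $ n else 0)" for i
      proof -
        have "(S ^ i) $ n = fps_eval (monom 1 i) (B + fps_X ^ n * fps_shift n S) $ n"
          unfolding B_def fps_cutoff_decomp[symmetric] by (simp add: fps_eval_monom)
        also have "\<dots> = (B ^ i) $ n + poly (pderiv (monom 1 i)) 0 * S $ n"
          using False by (subst fps_eval_nth_step) (simp_all add: fps_eval_monom B0)
        also have "poly (pderiv (monom 1 i)) 0 = (if i = 1 then 1 else (0::'k))"
          by (cases i) (auto simp: pderiv_monom poly_monom power_0_left)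
        finally show ?thesis by simp
      qed
      have "fps_X $ n = (A oo S) $ n"
        by (simp add: eq)
      also have "\<dots> = (A oo B) $ n + (\<Sum>i=0..n. if i = 1 then A $ 1 * S $ n else 0)"
        unfolding fps_compose_nth sum.distrib[symmetric]
        by (intro sum.cong) (auto simp: pow algebra_simps)
      also have "(\<Sum>i=0..n. if i = 1 then A $ 1 * S $ n else 0) = A $ 1 * S $ n"
        using False by (simp add: sum.delta)
      finally have "S $ n = (fps_X $ n - (A oo B) $ n) * inverse (A $ 1)"
        using A(2) by (simp add: field_simps)
      also have "\<dots> \<in> R"
        by (intro mult_mem diff_mem A(3) fps_over_nth fps_over_X fps_over_compose A(1) B)
      finally show ?thesis .
    qed (use S zero_mem in simp)
  qed
  then show ?thesis by (simp add: fps_over_def)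
qed

end

text \<open>Termination of the recursion below needs to know that the calls under the sum have
  indices in its range.\<close>

declare sum.cong [fundef_cong]

text \<open>The \<open>n\<close>-th coefficient of \<open>B^2 = A\<close> with
  \<open>B $ 0 = b\<close> reads \<open>2 b B_n\<close> plus the products \<open>B_i B_(n-i)\<close>
  for \<open>0 < i < n\<close>; this is that equation solved for \<open>B_n\<close>.\<close>

fun fps_sqrt_coeff :: "'k::field fps \<Rightarrow> 'k \<Rightarrow> nat \<Rightarrow> 'k" where
  "fps_sqrt_coeff A b n =
     (if n = 0 then b
      else (A $ n - (\<Sum>i\<in>{1..<n}. fps_sqrt_coeff A b i * fps_sqrt_coeff A b (n - i))) / (2 * b))"

declare fps_sqrt_coeff.simps [simp del]

lemma fps_sqrt_exists:
  fixes A :: "'k::field fps"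
  assumes "b\<^sup>2 = A $ 0" and "b \<noteq> 0" and "(2::'k) \<noteq> 0"
  shows "\<exists>B. B $ 0 = b \<and> B\<^sup>2 = A"
proof (intro exI conjI)
  define B where "B = Abs_fps (fps_sqrt_coeff A b)"
  have B0: "B $ 0 = b"
    by (simp add: B_def fps_sqrt_coeff.simps)
  show "Abs_fps (fps_sqrt_coeff A b) $ 0 = b"
    using B0 by (simp add: B_def)
  have "(B * B) $ n = A $ n" for n
  proof (cases n)
    case 0
    then show ?thesis using assms B0 by (simp add: power2_eq_square)
  next
    case (Suc m)
    have "(B * B) $ n = (\<Sum>i\<in>insert 0 (insert n {1..<n}). B $ i * B $ (n - i))"
      unfolding fps_mult_nth using Suc by (intro sum.cong) auto
    also have "\<dots> = 2 * b * B $ n + (\<Sum>i\<in>{1..<n}. B $ i * B $ (n - i))"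
      using Suc B0 by simp
    also have "B $ n = (A $ n - (\<Sum>i\<in>{1..<n}. B $ i * B $ (n - i))) / (2 * b)"
      unfolding B_def fps_nth_Abs_fps using Suc by (subst fps_sqrt_coeff.simps) simp
    finally show ?thesis
      using assms by simp
  qed
  then show "(Abs_fps (fps_sqrt_coeff A b))\<^sup>2 = A"
    by (simp add: fps_eq_iff power2_eq_square B_def)
qed

text \<open>The sign of a square root is fixed by its nonzero constant coefficient. This forces the
  value of a Taylor homomorphism at \<open>y\<close> once its value at \<open>x\<close> is
  known.\<close>

lemma fps_sqrt_unique:
  fixes A B :: "'k::field fps"
  assumes "A\<^sup>2 = B\<^sup>2" and "A $ 0 = B $ 0" and "A $ 0 \<noteq> 0" and "(2::'k) \<noteq> 0"
  shows "A = B"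
proof -
  have "A = B \<or> A = - B"
    using assms(1) by (simp add: power2_eq_iff)
  moreover have "A \<noteq> - B"
  proof
    assume "A = - B"
    then have "A $ 0 = - (B $ 0)" by simp
    then have "2 * A $ 0 = 0"
      using assms(2) by (simp add: eq_neg_iff_add_eq_0)
    then show False using assms by simp
  qed
  ultimately show ?thesis by blast
qed

section \<open>Localizations and discrete valuation rings\<close>

text \<open>Only primality is asked of \<open>P\<close>: for affine points it follows from
  maximality, at infinity it is read off from constant coefficients.\<close>

locale prime_localization = field_subring R
  for R :: "'k::field set" +
  fixes P :: "'k set"
  assumes sub: "P \<subseteq> R"
    and zero_P: "0 \<in> P"
    and add_P: "a \<in> P \<Longrightarrow> b \<in> P \<Longrightarrow> a + b \<in> P"
    and mult_P: "a \<in> R \<Longrightarrow> b \<in> P \<Longrightarrow> a * b \<in> P"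
    and one_P: "1 \<notin> P"
    and prime_P: "a \<in> R \<Longrightarrow> b \<in> R \<Longrightarrow> a * b \<in> P \<Longrightarrow> a \<in> P \<or> b \<in> P"
begin

definition loc :: "'k set" where
  "loc = {a / b | a b. a \<in> R \<and> b \<in> R - P}"

definition loc_max :: "'k set" where
  "loc_max = {a / b | a b. a \<in> P \<and> b \<in> R - P}"

lemma nonzero: "b \<in> R - P \<Longrightarrow> b \<noteq> 0"
  using zero_P by blast

lemma mult_compl: "a \<in> R - P \<Longrightarrow> b \<in> R - P \<Longrightarrow> a * b \<in> R - P"
  using mult_mem prime_P by blast

lemma diff_P: "a \<in> P \<Longrightarrow> b \<in> P \<Longrightarrow> a - b \<in> P"
  using add_P[of a "(- 1) * b"] mult_P[of "- 1" b] uminus_mem[OF one_mem] by simp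

lemma loc_subring: "field_subring loc"
proof
  show "1 \<in> loc"
    unfolding loc_def using one_mem one_P by (intro CollectI exI[of _ 1]) auto
  fix \<phi> \<psi> assume "\<phi> \<in> loc" "\<psi> \<in> loc"
  then obtain a b c d where *: "\<phi> = a / b" "a \<in> R" "b \<in> R - P" "\<psi> = c / d" "c \<in> R" "d \<in> R - P"
    by (auto simp: loc_def)
  have "\<phi> - \<psi> = (a * d - c * b) / (b * d)" "\<phi> * \<psi> = (a * c) / (b * d)"
    using * nonzero by (auto simp: diff_frac_eq)
  then show "\<phi> - \<psi> \<in> loc" "\<phi> * \<psi> \<in> loc"
    unfolding loc_def using * mult_compl[of b d]
    by (blast intro: diff_mem mult_mem)+
qed

lemma R_loc: "a \<in> R \<Longrightarrow> a \<in> loc"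
  unfolding loc_def using one_mem one_P by (intro CollectI exI[of _ a] exI[of _ 1]) auto

lemma P_loc_max: "a \<in> P \<Longrightarrow> a \<in> loc_max"
  unfolding loc_max_def using one_mem one_P by (intro CollectI exI[of _ a] exI[of _ 1]) auto

lemma loc_max_sub: "loc_max \<subseteq> loc"
  unfolding loc_max_def loc_def using sub by blast

lemma loc_max_add: "\<phi> \<in> loc_max \<Longrightarrow> \<psi> \<in> loc_max \<Longrightarrow> \<phi> + \<psi> \<in> loc_max"
proof -
  assume "\<phi> \<in> loc_max" "\<psi> \<in> loc_max"
  then obtain a b c d where *: "\<phi> = a / b" "a \<in> P" "b \<in> R - P" "\<psi> = c / d" "c \<in> P" "d \<in> R - P"
    by (auto simp: loc_max_def)
  have "\<phi> + \<psi> = (d * a + b * c) / (b * d)"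
    using * nonzero by (auto simp: add_frac_eq mult.commute)
  moreover have "d * a + b * c \<in> P"
    using * by (auto intro: add_P mult_P)
  ultimately show ?thesis
    unfolding loc_max_def using mult_compl[of b d] * by blast
qed

lemma loc_max_mult: "\<phi> \<in> loc \<Longrightarrow> \<psi> \<in> loc_max \<Longrightarrow> \<phi> * \<psi> \<in> loc_max"
proof -
  assume "\<phi> \<in> loc" "\<psi> \<in> loc_max"
  then obtain a b c d where *: "\<phi> = a / b" "a \<in> R" "b \<in> R - P" "\<psi> = c / d" "c \<in> P" "d \<in> R - P"
    by (auto simp: loc_def loc_max_def)
  have "\<phi> * \<psi> = (a * c) / (b * d)"
    using * by simp
  moreover have "a * c \<in> P"
    using * by (auto intro: mult_P)
  ultimately show ?thesis
    unfolding loc_max_def using mult_compl[of b d] * by blast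
qed

lemma loc_max_iff: "a \<in> R \<Longrightarrow> a \<in> loc_max \<longleftrightarrow> a \<in> P"
proof
  assume a: "a \<in> R" "a \<in> loc_max"
  then obtain c d where *: "a = c / d" "c \<in> P" "d \<in> R - P"
    by (auto simp: loc_max_def)
  then have "a * d \<in> P"
    using nonzero by auto
  then show "a \<in> P" using prime_P a * by blast
qed (rule P_loc_max)

lemma one_loc_max: "1 \<notin> loc_max"
  using loc_max_iff[OF one_mem] one_P by blast

lemma loc_unit: "\<phi> \<in> loc \<Longrightarrow> \<phi> \<notin> loc_max \<Longrightarrow> inverse \<phi> \<in> loc"
proof -
  assume "\<phi> \<in> loc" "\<phi> \<notin> loc_max"
  then obtain a b where *: "\<phi> = a / b" "a \<in> R - P" "b \<in> R - P"
    by (auto simp: loc_def loc_max_def)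
  then have "inverse \<phi> = b / a" by simp
  then show ?thesis unfolding loc_def using * by blast
qed

end

text \<open>A discrete valuation ring is presented by factorization into a unit and a power of
  \<open>\<pi>\<close>, because the curve provides exactly this: norms (or, at infinity, parity of
  orders) reduce it to polynomials in one variable.\<close>

locale valuation_subring = field_subring V
  for V :: "'k::field set" +
  fixes M :: "'k set" and \<pi> :: 'k
  assumes M_eq: "M = {\<pi> * a | a. a \<in> V}"
    and unif_V: "\<pi> \<in> V"
    and unit: "e \<in> V \<Longrightarrow> e \<notin> M \<Longrightarrow> inverse e \<in> V"
    and one_M: "1 \<notin> M"
    and unif_nz: "\<pi> \<noteq> 0"
    and unit_times_power: "\<phi> \<noteq> 0 \<Longrightarrow> \<exists>e n. e \<in> V - M \<and> \<phi> = e * \<pi> powi n"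
begin

lemma unif_M: "\<pi> \<in> M"
  unfolding M_eq using one_mem by force

lemma zero_M: "0 \<in> M"
  unfolding M_eq using zero_mem by force

lemma M_sub: "M \<subseteq> V"
  unfolding M_eq using mult_mem unif_V by blast

lemma mult_M: "a \<in> V \<Longrightarrow> b \<in> M \<Longrightarrow> a * b \<in> M"
  unfolding M_eq using mult_mem by (auto simp: mult.left_commute)

lemma add_M: "a \<in> M \<Longrightarrow> b \<in> M \<Longrightarrow> a + b \<in> M"
  unfolding M_eq using add_mem by (auto simp flip: distrib_left)

lemma uminus_M: "a \<in> M \<Longrightarrow> - a \<in> M"
  using mult_M[of "- 1" a] uminus_mem[OF one_mem] by simp

lemma diff_M: "a \<in> M \<Longrightarrow> b \<in> M \<Longrightarrow> a - b \<in> M"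
  using add_M[of a "- b"] uminus_M by simp

lemma unit_nz: "e \<in> V - M \<Longrightarrow> e \<noteq> 0"
  using zero_M by blast

lemma prime_M: "a \<in> V \<Longrightarrow> b \<in> V \<Longrightarrow> a * b \<in> M \<Longrightarrow> a \<in> M \<or> b \<in> M"
proof (rule ccontr)
  assume *: "a \<in> V" "b \<in> V" "a * b \<in> M" "\<not> (a \<in> M \<or> b \<in> M)"
  then have "inverse a \<in> V" "inverse b \<in> V" "a \<noteq> 0" "b \<noteq> 0"
    using unit unit_nz by auto
  then have "(inverse a * inverse b) * (a * b) \<in> M"
    using * by (auto intro: mult_M[OF mult_mem])
  moreover have "(inverse a * inverse b) * (a * b) = 1"
    using \<open>a \<noteq> 0\<close> \<open>b \<noteq> 0\<close> by (simp add: field_simps)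
  ultimately show False using one_M by simp
qed

lemma unit_mult: "a \<in> V - M \<Longrightarrow> b \<in> V - M \<Longrightarrow> a * b \<in> V - M"
  using prime_M mult_mem by blast

lemma unit_one: "1 \<in> V - M"
  using one_mem one_M by blast

lemma unit_inverse: "a \<in> V - M \<Longrightarrow> inverse a \<in> V - M"
proof -
  assume a: "a \<in> V - M"
  moreover have "inverse a \<notin> M"
    using mult_M[of a "inverse a"] a one_M unit_nz[OF a] by auto
  ultimately show ?thesis using unit by blast
qed

lemma unit_divide: "a \<in> V - M \<Longrightarrow> b \<in> V - M \<Longrightarrow> a / b \<in> V - M"
  using unit_mult unit_inverse by (simp add: divide_inverse)

lemma divide_V: "a \<in> V \<Longrightarrow> b \<in> V - M \<Longrightarrow> a / b \<in> V"
  using mult_mem unit by (simp add: divide_inverse)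

lemma unit_power: "a \<in> V - M \<Longrightarrow> a ^ n \<in> V - M"
  by (induction n) (use unit_one unit_mult in auto)

lemma unit_uminus: "a \<in> V - M \<Longrightarrow> - a \<in> V - M"
  using uminus_M[of "- a"] uminus_mem[of a] by auto

lemma unit_powi: "a \<in> V - M \<Longrightarrow> a powi n \<in> V - M"
  by (cases n rule: int_cases4) (use unit_power unit_inverse in \<open>auto simp: power_int_minus\<close>)

lemma unif_power_M: "0 < n \<Longrightarrow> \<pi> powi n \<in> M"
proof -
  assume "0 < n"
  then obtain m where m: "n = int (Suc m)"
    by (metis gr0_implies_Suc zero_less_imp_eq_int)
  have "\<pi> powi n = \<pi> ^ m * \<pi>"
    unfolding m by (simp add: power_int_of_nat del: of_nat_Suc)
  then show ?thesis
    using mult_M[OF power_mem[OF unif_V] unif_M] by simp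
qed

lemma unit_not_power:
  assumes "e \<in> V - M" and "e * \<pi> powi n \<in> V - M"
  shows "n = 0"
proof (rule ccontr)
  assume "n \<noteq> 0"
  have powi: "\<pi> powi n \<in> V - M"
    using unit_divide[OF assms(2,1)] unit_nz[OF assms(1)] by simp
  show False
  proof (cases "0 < n")
    case False
    then have "inverse (\<pi> powi n) \<in> M"
      using unif_power_M[of "- n"] \<open>n \<noteq> 0\<close> by (simp add: power_int_minus)
    then show False using unit_inverse[OF powi] by blast
  qed (use unif_power_M powi in blast)
qed

text \<open>Quantifies over all generators of \<open>M\<close>, not only \<open>\<pi>\<close>, so
  that it agrees literally with \<open>ord_at\<close>.\<close>

definition ord :: "'k \<Rightarrow> int" where
  "ord \<phi> = (THE n. \<exists>\<pi> e. M = {\<pi> * a | a. a \<in> V} \<and> e \<in> V - M \<and> \<phi> = e * \<pi> powi n)"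

lemma ord_eq:
  assumes "e \<in> V - M"
  shows "ord (e * \<pi> powi n) = n"
  unfolding ord_def
proof (rule the_equality)
  show "\<exists>\<rho> e'. M = {\<rho> * a | a. a \<in> V} \<and> e' \<in> V - M \<and> e * \<pi> powi n = e' * \<rho> powi n"
    using M_eq assms by blast
next
  fix m assume "\<exists>\<rho> e'. M = {\<rho> * a | a. a \<in> V} \<and> e' \<in> V - M \<and> e * \<pi> powi n = e' * \<rho> powi m"
  then obtain \<rho> e' where *: "M = {\<rho> * a | a. a \<in> V}" "e' \<in> V - M" "e * \<pi> powi n = e' * \<rho> powi m"
    by blast
  obtain a where a: "a \<in> V" "\<pi> = \<rho> * a"
    using unif_M *(1) by blast
  have "\<rho> \<in> M"
    using *(1) one_mem by force
  then obtain b where b: "b \<in> V" "\<rho> = \<pi> * b"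
    using M_eq by blast
  \<comment> \<open>Two generators of \<open>M\<close> divide each other, so they differ by the unit
    \<open>b\<close>.\<close>
  have "\<pi> * (a * b) = \<pi> * 1"
    using a b by (metis mult.assoc mult.commute mult_1_right)
  then have "a * b = 1" using unif_nz by simp
  then have bu: "b \<in> V - M"
    using mult_M[OF a(1), of b] one_M b(1) by auto
  have "e * \<pi> powi n = (e' * b powi m) * \<pi> powi m"
    using * b(2) by (simp add: power_int_mult_distrib algebra_simps)
  then have "e * \<pi> powi (n - m) = e' * b powi m"
    using unif_nz by (simp add: power_int_diff field_simps)
  then show "m = n"
    using unit_not_power[OF assms, of "n - m"] unit_mult[OF *(2) unit_powi[OF bu]] by auto
qed

lemma ord_decomp:
  assumes "\<phi> \<noteq> 0"
  obtains e where "e \<in> V - M" and "\<phi> = e * \<pi> powi (ord \<phi>)"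
  using unit_times_power[OF assms] ord_eq by metis

lemma ord_mult: "\<phi> \<noteq> 0 \<Longrightarrow> \<psi> \<noteq> 0 \<Longrightarrow> ord (\<phi> * \<psi>) = ord \<phi> + ord \<psi>"
proof -
  assume "\<phi> \<noteq> 0" "\<psi> \<noteq> 0"
  then obtain e e' where *: "e \<in> V - M" "\<phi> = e * \<pi> powi (ord \<phi>)" "e' \<in> V - M" "\<psi> = e' * \<pi> powi (ord \<psi>)"
    by (metis ord_decomp)
  have "\<phi> * \<psi> = (e * e') * \<pi> powi (ord \<phi> + ord \<psi>)"
    using unif_nz by (subst *(2), subst *(4)) (simp add: power_int_add)
  then show ?thesis
    using ord_eq[OF unit_mult[OF *(1,3)]] by simp
qed

lemma ord_unit: "e \<in> V - M \<Longrightarrow> ord e = 0"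
  using ord_eq[of e 0] by simp

lemma ord_unif: "ord \<pi> = 1"
  using ord_eq[OF unit_one, of 1] by simp

lemma ord_power: "\<phi> \<noteq> 0 \<Longrightarrow> ord (\<phi> ^ n) = int n * ord \<phi>"
  by (induction n) (auto simp: ord_unit[OF unit_one] ord_mult algebra_simps)

lemma ord_inverse: "\<phi> \<noteq> 0 \<Longrightarrow> ord (inverse \<phi>) = - ord \<phi>"
  using ord_mult[of \<phi> "inverse \<phi>"] ord_unit[OF unit_one] by simp

lemma
  assumes nz: "\<phi> \<noteq> 0"
  shows mem_iff_ord: "\<phi> \<in> V \<longleftrightarrow> 0 \<le> ord \<phi>"
    and M_iff_ord: "\<phi> \<in> M \<longleftrightarrow> 0 < ord \<phi>"
proof -
  obtain e where e: "e \<in> V - M" "\<phi> = e * \<pi> powi (ord \<phi>)"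
    using ord_decomp[OF nz] .
  consider "0 < ord \<phi>" | "ord \<phi> = 0" | "ord \<phi> < 0" by linarith
  then have "(\<phi> \<in> V \<longleftrightarrow> 0 \<le> ord \<phi>) \<and> (\<phi> \<in> M \<longleftrightarrow> 0 < ord \<phi>)"
  proof cases
    case 1
    then have "\<phi> \<in> M"
      using e mult_M[OF _ unif_power_M[OF 1]] by (metis DiffE)
    then show ?thesis using 1 M_sub by auto
  next
    case 2
    then show ?thesis using e by auto
  next
    case 3
    have "\<phi> \<notin> V"
    proof
      assume \<phi>: "\<phi> \<in> V"
      then have "inverse \<phi> \<notin> M" using mult_M[OF \<phi>, of "inverse \<phi>"] nz one_M by auto
      moreover have "inverse \<phi> = inverse e * \<pi> powi (- ord \<phi>)"
        by (subst e(2)) (simp add: power_int_minus)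
      then have "inverse \<phi> \<in> M"
        using mult_M[OF _ unif_power_M[of "- ord \<phi>"]] 3 unit_inverse[OF e(1)] by simp
      ultimately show False by simp
    qed
    then show ?thesis using 3 M_sub by auto
  qed
  then show "\<phi> \<in> V \<longleftrightarrow> 0 \<le> ord \<phi>" "\<phi> \<in> M \<longleftrightarrow> 0 < ord \<phi>"
    by blast+
qed

lemma not_mem_inverse: "\<phi> \<notin> V \<Longrightarrow> inverse \<phi> \<in> M"
  using zero_mem by (cases "\<phi> = 0") (auto simp: mem_iff_ord M_iff_ord ord_inverse)

lemma ord_add:
  assumes "\<phi> \<noteq> 0" and "\<psi> \<noteq> 0" and "ord \<phi> < ord \<psi>"
  shows "\<phi> + \<psi> \<noteq> 0" and "ord (\<phi> + \<psi>) = ord \<phi>"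
proof -
  have "ord (inverse \<phi> * \<psi>) = ord \<psi> - ord \<phi>"
    using assms by (simp add: ord_mult ord_inverse)
  then have M: "inverse \<phi> * \<psi> \<in> M"
    using assms by (simp add: M_iff_ord)
  have "1 + inverse \<phi> * \<psi> \<notin> M"
    using diff_M[OF _ M, of "1 + inverse \<phi> * \<psi>"] one_M by auto
  then have unit: "1 + inverse \<phi> * \<psi> \<in> V - M"
    using M M_sub add_mem one_mem by blast
  have eq: "\<phi> + \<psi> = \<phi> * (1 + inverse \<phi> * \<psi>)"
    using assms by (simp add: field_simps)
  show "\<phi> + \<psi> \<noteq> 0"
    unfolding eq using assms unit_nz[OF unit] by simp
  show "ord (\<phi> + \<psi>) = ord \<phi>"
    unfolding eq using assms unit_nz[OF unit] by (subst ord_mult) (auto simp: ord_unit[OF unit])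
qed

text \<open>Dividing the relation by \<open>z^(m-1)\<close> expresses \<open>c m * z\<close> through
  powers of \<open>inverse z\<close>, which lies in \<open>V\<close> whenever \<open>z\<close> does
  not. This is the form of integral closedness used later.\<close>

lemma leading_coeff_root_mem:
  assumes "(\<Sum>i\<le>m. c i * z ^ i) = 0" and "\<And>i. i \<le> m \<Longrightarrow> c i \<in> V" and "0 < m"
  shows "c m * z \<in> V"
proof (cases "z \<in> V")
  case False
  then have z: "inverse z \<in> V" "z \<noteq> 0"
    using not_mem_inverse M_sub zero_mem by auto
  obtain k where k: "m = Suc k"
    using assms(3) gr0_implies_Suc by blast
  have "c m * z ^ m = - (\<Sum>i\<le>k. c i * z ^ i)"
    using assms(1) k by (simp add: eq_neg_iff_add_eq_0 add.commute)
  then have "c m * z * z ^ k = - (\<Sum>i\<le>k. c i * z ^ i)"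
    using k by (simp add: mult_ac)
  then have "c m * z = - (\<Sum>i\<le>k. c i * z ^ i) * inverse (z ^ k)"
    using z by (simp add: field_simps)
  also have "\<dots> = - (\<Sum>i\<le>k. c i * inverse z ^ (k - i))"
  proof -
    have "z ^ i * inverse (z ^ k) = inverse z ^ (k - i)" if "i \<le> k" for i
      using that z by (simp add: power_diff field_simps)
    then show ?thesis
      by (simp add: sum_distrib_right mult.assoc)
  qed
  also have "\<dots> \<in> V"
    using assms(2) k by (intro uminus_mem sum_mem mult_mem power_mem z) auto
  finally show ?thesis .
qed (use assms in \<open>auto intro: mult_mem\<close>)

end

section \<open>The function field\<close>

locale hyperelliptic =
  fixes X :: "('a::field, 'k::field) hyp_curve"
  assumes hyp: "hyperelliptic_curve X"
begin

abbreviation "x \<equiv> xfun X"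
abbreviation "y \<equiv> yfun X"
abbreviation "f \<equiv> defpol X"
abbreviation "pv \<equiv> polyval X"
abbreviation "A \<equiv> affine_ring X"

sublocale emb: field_hom "emb X"
  using hyp by (simp add: hyperelliptic_curve_def)

sublocale emb_poly: map_poly_idom_hom "emb X" ..

lemma
  shows two_nz: "(2::'a) \<noteq> 0"
    and degree_f: "degree f = 2 * genus X + 1"
    and coprime_f: "coprime f (pderiv f)"
    and x_transcendental: "pv q x = 0 \<Longrightarrow> q = 0"
    and y_square: "y\<^sup>2 = pv f x"
    and fraction: "\<exists>a\<in>A. \<exists>b\<in>A. b \<noteq> 0 \<and> \<phi> = a / b"
  using hyp by (auto simp: hyperelliptic_curve_def)

lemma two_nz_K: "(2::'k) \<noteq> 0"
proof -
  have "emb X 2 = 2"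
    by (metis emb.hom_add emb.hom_one one_add_one)
  then show ?thesis using two_nz by (metis emb.hom_0_iff)
qed

lemma pv_0 [simp]: "pv 0 z = 0"
  by (simp add: polyval_def)

lemma pv_pCons [simp]: "pv (pCons a q) z = emb X a + z * pv q z"
  by (simp add: polyval_def Polynomial.map_poly_pCons)

lemma pv_1 [simp]: "pv 1 z = 1"
  by (simp add: polyval_def)

lemma pv_add: "pv (p + q) z = pv p z + pv q z"
  by (simp add: polyval_def emb_poly.hom_add)

lemma pv_mult: "pv (p * q) z = pv p z * pv q z"
  by (simp add: polyval_def emb_poly.hom_mult)

lemma pv_diff: "pv (p - q) z = pv p z - pv q z"
  by (simp add: polyval_def emb_poly.hom_minus)

lemma pv_uminus: "pv (- p) z = - pv p z"
  by (simp add: polyval_def emb_poly.hom_uminus)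

lemma pv_smult: "pv (smult c p) z = emb X c * pv p z"
  using pv_mult[of "[:c:]" p] by simp

lemma pv_power: "pv (p ^ n) z = pv p z ^ n"
  by (simp add: polyval_def emb_poly.hom_power)

lemma pv_monom: "pv (monom c n) z = emb X c * z ^ n"
  by (simp add: polyval_def map_poly_monom poly_monom)

lemma pv_sum: "pv (sum h I) z = (\<Sum>i\<in>I. pv (h i) z)"
  by (induction I rule: infinite_finite_induct) (auto simp: pv_add)

text \<open>Otherwise \<open>q^2 = r^2 f\<close> with both sides nonzero, and the degrees have
  opposite parity because \<open>f\<close> has odd degree.\<close>

lemma repr_zero:
  assumes "pv q x + pv r x * y = 0"
  shows "q = 0" and "r = 0"
proof -
  have "pv (q\<^sup>2) x = (pv r x * y)\<^sup>2"
    using assms by (simp add: pv_power eq_neg_iff_add_eq_0[symmetric])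
  also have "\<dots> = pv (r\<^sup>2 * f) x"
    by (simp add: pv_power pv_mult power_mult_distrib y_square)
  finally have eq: "q\<^sup>2 = r\<^sup>2 * f"
    using x_transcendental[of "q\<^sup>2 - r\<^sup>2 * f"] by (simp add: pv_diff)
  have "f \<noteq> 0"
    using degree_f by auto
  have "r = 0"
  proof (rule ccontr)
    assume r: "r \<noteq> 0"
    then have q: "q \<noteq> 0"
      using eq \<open>f \<noteq> 0\<close> by auto
    have "2 * degree q = 2 * degree r + (2 * genus X + 1)"
      using arg_cong[OF eq, of degree] r q \<open>f \<noteq> 0\<close>
      by (simp add: degree_mult_eq degree_power_eq degree_f)
    then show False by presburger
  qed
  with eq show "q = 0" "r = 0" by auto
qed

lemma x_nz: "x \<noteq> 0"
  using x_transcendental[of "[:0, 1:]"] by auto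

lemma y_nz: "y \<noteq> 0"
  using repr_zero(2)[of 0 1] by auto

lemma f_nz: "f \<noteq> 0"
  using degree_f by auto

lemma pderiv_f_nz: "pderiv f \<noteq> 0"
proof
  assume "pderiv f = 0"
  then have "is_unit f" using coprime_f by simp
  then show False using degree_f using f_nz by (simp add: is_unit_iff_degree)
qed

lemma pv_x_nz: "q \<noteq> 0 \<Longrightarrow> pv q x \<noteq> 0"
  using x_transcendental by blast

lemma double_cover_const: "emb X c \<in> double_cover_ring X z w"
  unfolding double_cover_ring_def by (intro CollectI exI[of _ "[:c:]"] exI[of _ 0]) simp

lemma double_cover_poly: "pv q z \<in> double_cover_ring X z w"
  unfolding double_cover_ring_def by (intro CollectI exI[of _ "q"] exI[of _ 0]) simp

lemma double_cover_z: "z \<in> double_cover_ring X z w"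
  using double_cover_poly[of "[:0, 1:]" z w] by simp

lemma double_cover_w: "w \<in> double_cover_ring X z w"
  unfolding double_cover_ring_def by (intro CollectI exI[of _ 0] exI[of _ 1]) simp

lemma double_cover_subring:
  assumes "w\<^sup>2 = pv h z"
  shows "field_subring (double_cover_ring X z w)"
proof
  show "1 \<in> double_cover_ring X z w"
    using double_cover_const[of 1] by simp
  fix a b assume "a \<in> double_cover_ring X z w" "b \<in> double_cover_ring X z w"
  then obtain q r q' r' where *: "a = pv q z + pv r z * w" "b = pv q' z + pv r' z * w"
    by (auto simp: double_cover_ring_def)
  have "a - b = pv (q - q') z + pv (r - r') z * w"
    by (simp add: * pv_diff algebra_simps)
  then show "a - b \<in> double_cover_ring X z w"
    unfolding double_cover_ring_def by blast
  have "a * b = pv q z * pv q' z + pv r z * pv r' z * w\<^sup>2 + (pv q z * pv r' z + pv r z * pv q' z) * w"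
    by (simp add: * algebra_simps power2_eq_square)
  also have "\<dots> = pv (q * q' + r * r' * h) z + pv (q * r' + r * q') z * w"
    by (simp add: assms pv_add pv_mult)
  finally show "a * b \<in> double_cover_ring X z w"
    unfolding double_cover_ring_def by blast
qed

sublocale A: field_subring A
  unfolding affine_ring_def by (rule double_cover_subring[OF y_square])

lemma A_elim:
  assumes "a \<in> A"
  obtains q r where "a = pv q x + pv r x * y"
  using assms by (auto simp: affine_ring_def double_cover_ring_def)

lemma A_intro: "pv q x + pv r x * y \<in> A"
  by (auto simp: affine_ring_def double_cover_ring_def)

lemma A_const: "emb X c \<in> A" and A_poly: "pv q x \<in> A" and A_x: "x \<in> A" and A_y: "y \<in> A"
  unfolding affine_ring_def
  by (rule double_cover_const double_cover_poly double_cover_z double_cover_w)+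

text \<open>The norm from \<open>K\<close> to \<open>F(x)\<close>: the second factor is the image of
  the first under \<open>y \<mapsto> - y\<close>.\<close>

lemma norm_eq:
  "(pv q x + pv r x * y) * (pv q x - pv r x * y) = pv (q\<^sup>2 - r\<^sup>2 * f) x"
  by (simp add: pv_diff pv_mult pv_power y_square[symmetric] power2_eq_square algebra_simps)

lemma norm_nz:
  assumes "pv q x + pv r x * y \<noteq> 0"
  shows "q\<^sup>2 - r\<^sup>2 * f \<noteq> 0"
proof
  assume "q\<^sup>2 - r\<^sup>2 * f = 0"
  then have "pv q x + pv (- r) x * y = 0"
    using norm_eq[of q r] assms by (simp add: pv_uminus)
  then have "q = 0" "r = 0"
    using repr_zero[of q "- r"] by auto
  then show False using assms by simp
qed

section \<open>Taylor homomorphisms\<close>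

text \<open>Multiplicativity is the Leibniz rule of all orders at once, the condition on constants
  supplies \<open>F\<close>-linearity, and the last conjunct is \<open>D^0 = id\<close>. No
  coordinate is fixed yet.\<close>

definition taylor_hom :: "('k \<Rightarrow> 'k fps) \<Rightarrow> bool" where
  "taylor_hom \<theta> \<longleftrightarrow>
     (\<forall>\<phi> \<psi>. \<theta> (\<phi> + \<psi>) = \<theta> \<phi> + \<theta> \<psi>) \<and>
     (\<forall>\<phi> \<psi>. \<theta> (\<phi> * \<psi>) = \<theta> \<phi> * \<theta> \<psi>) \<and>
     (\<forall>c. \<theta> (emb X c) = fps_const (emb X c)) \<and>
     (\<forall>\<phi>. \<theta> \<phi> $ 0 = \<phi>)"

context
  fixes \<theta> assumes th: "taylor_hom \<theta>"
begin

lemma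
  shows taylor_add: "\<theta> (\<phi> + \<psi>) = \<theta> \<phi> + \<theta> \<psi>"
    and taylor_mult: "\<theta> (\<phi> * \<psi>) = \<theta> \<phi> * \<theta> \<psi>"
    and taylor_const: "\<theta> (emb X c) = fps_const (emb X c)"
    and taylor_nth_0: "\<theta> \<phi> $ 0 = \<phi>"
  using th by (auto simp: taylor_hom_def)

lemma taylor_0: "\<theta> 0 = 0"
  using taylor_const[of 0] by simp

lemma taylor_1: "\<theta> 1 = 1"
  using taylor_const[of 1] by simp

lemma taylor_power: "\<theta> (\<phi> ^ n) = \<theta> \<phi> ^ n"
  by (induction n) (auto simp: taylor_1 taylor_mult)

lemma taylor_inverse: "\<phi> \<noteq> 0 \<Longrightarrow> \<theta> (inverse \<phi>) = inverse (\<theta> \<phi>)"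
proof -
  assume "\<phi> \<noteq> 0"
  then have "\<theta> \<phi> * \<theta> (inverse \<phi>) = 1"
    by (simp add: taylor_mult[symmetric] taylor_1)
  then show ?thesis using fps_inverse_unique by metis
qed

lemma taylor_divide: "\<psi> \<noteq> 0 \<Longrightarrow> \<theta> (\<phi> / \<psi>) = \<theta> \<phi> * inverse (\<theta> \<psi>)"
  by (simp add: divide_inverse taylor_mult taylor_inverse)

lemma taylor_pv: "\<theta> (pv q z) = fps_eval (map_poly (emb X) q) (\<theta> z)"
  by (induction q) (auto simp: taylor_0 taylor_add taylor_mult taylor_const Polynomial.map_poly_pCons)

lemma taylor_nth_1_mult: "\<theta> (\<phi> * \<psi>) $ 1 = \<phi> * \<theta> \<psi> $ 1 + \<psi> * \<theta> \<phi> $ 1"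
  by (simp add: taylor_mult taylor_nth_0 fps_mult_nth_1)

lemma taylor_nth_1_pv: "\<theta> (pv q z) $ 1 = pv (pderiv q) z * \<theta> z $ 1"
proof -
  have "map_poly (emb X) (pderiv q) = pderiv (map_poly (emb X) q)"
    by (rule emb.map_poly_pderiv)
  then show ?thesis
    unfolding taylor_pv by (subst fps_eval_nth_1) (simp add: taylor_nth_0 polyval_def)
qed

lemma taylor_nth_1_inverse: "\<phi> \<noteq> 0 \<Longrightarrow> \<theta> (inverse \<phi>) $ 1 = - (\<theta> \<phi> $ 1) / \<phi>\<^sup>2"
  using taylor_nth_1_mult[of \<phi> "inverse \<phi>"]
  by (simp add: taylor_1 field_simps power2_eq_square eq_neg_iff_add_eq_0)

lemma taylor_compose:
  assumes "S $ 0 = 0"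
  shows "taylor_hom (\<lambda>\<phi>. \<theta> \<phi> oo S)"
  using assms by (auto simp: taylor_hom_def taylor_add taylor_mult taylor_const taylor_nth_0
      fps_compose_add_distrib fps_compose_mult_distrib)

end

text \<open>The value at \<open>x\<close> gives the value at \<open>f(x) = y^2\<close>, hence at
  \<open>y\<close>, since square roots with constant coefficient \<open>y\<close> are unique; sums,
  products and quotients do the rest.\<close>

lemma taylor_eqI:
  assumes th: "taylor_hom \<theta>" "taylor_hom \<theta>'" and eq: "\<theta> x = \<theta>' x"
  shows "\<theta> = \<theta>'"
proof
  fix \<phi>
  have pv: "\<theta> (pv q x) = \<theta>' (pv q x)" for q
    by (simp add: taylor_pv[OF th(1)] taylor_pv[OF th(2)] eq)
  have "(\<theta> y)\<^sup>2 = (\<theta>' y)\<^sup>2"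
    using pv[of f] by (simp add: y_square[symmetric] taylor_power[OF th(1)] taylor_power[OF th(2)])
  then have y: "\<theta> y = \<theta>' y"
    using fps_sqrt_unique y_nz two_nz_K by (metis taylor_nth_0 th)
  have A: "\<theta> a = \<theta>' a" if "a \<in> A" for a
    using A_elim[OF that]
    by (metis pv y taylor_add taylor_mult th)
  obtain a b where "a \<in> A" "b \<in> A" "b \<noteq> 0" "\<phi> = a / b"
    using fraction by blast
  then show "\<theta> \<phi> = \<theta>' \<phi>"
    by (simp add: taylor_divide[OF th(1)] taylor_divide[OF th(2)] A)
qed

text \<open>For \<open>b \<noteq> 0\<close> the series \<open>D b\<close> is invertible, its
  constant coefficient being \<open>b\<close>, so \<open>D\<close> passes to fractions. With
  \<open>R = A\<close> this constructs a homomorphism; with \<open>R\<close> the regular functions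
  it serves the uniqueness of Hasse derivatives.\<close>

lemma taylor_extend:
  assumes R: "field_subring R" and const: "\<And>c. emb X c \<in> R"
    and frac: "\<And>\<phi>. \<exists>a\<in>R. \<exists>b\<in>R. b \<noteq> 0 \<and> \<phi> = a / b"
    and add: "\<And>a b. a \<in> R \<Longrightarrow> b \<in> R \<Longrightarrow> D (a + b) = D a + D b"
    and mult: "\<And>a b. a \<in> R \<Longrightarrow> b \<in> R \<Longrightarrow> D (a * b) = D a * D b"
    and D_const: "\<And>c. D (emb X c) = fps_const (emb X c)"
    and nth_0: "\<And>a. a \<in> R \<Longrightarrow> D a $ 0 = a"
  shows "\<exists>\<theta>. taylor_hom \<theta> \<and> (\<forall>a\<in>R. \<theta> a = D a)"
proof -
  interpret R: field_subring R by fact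
  obtain num den where nd: "\<And>\<phi>. num \<phi> \<in> R" "\<And>\<phi>. den \<phi> \<in> R" "\<And>\<phi>. den \<phi> \<noteq> 0"
      "\<And>\<phi>. \<phi> = num \<phi> / den \<phi>"
    using frac by metis
  define \<theta> where "\<theta> \<phi> = D (num \<phi>) * inverse (D (den \<phi>))" for \<phi>
  have inv: "D b * inverse (D b) = 1" if "b \<in> R" "b \<noteq> 0" for b
    using inverse_mult_eq_1[of "D b"] nth_0[OF that(1)] that(2) by (simp add: mult.commute)
  \<comment> \<open>The result does not depend on the chosen numerator and denominator.\<close>
  have eq: "\<theta> (a / b) = D a * inverse (D b)" if ab: "a \<in> R" "b \<in> R" "b \<noteq> 0" for a b
  proof -
    let ?n = "num (a / b)" and ?d = "den (a / b)"
    have "?n * b = a * ?d"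
      using nd(3,4)[of "a / b"] ab(3) by (simp add: field_simps)
    then have *: "D ?n * D b = D a * D ?d"
      using mult[OF nd(1) ab(2), of "a / b"] mult[OF ab(1) nd(2), of "a / b"] by simp
    have "D ?n * inverse (D ?d) = (D ?n * D b) * inverse (D b) * inverse (D ?d)"
      using inv[OF ab(2,3)] by (simp add: mult.assoc)
    also have "\<dots> = D a * inverse (D b) * (D ?d * inverse (D ?d))"
      unfolding * by (simp add: mult_ac)
    also have "\<dots> = D a * inverse (D b)"
      using inv[OF nd(2,3)] by simp
    finally show ?thesis by (simp add: \<theta>_def)
  qed
  have D1: "D 1 = 1"
    using D_const[of 1] by simp
  have ext: "\<theta> a = D a" if "a \<in> R" for a
    using eq[OF that R.one_mem] D1 by simp
  have "taylor_hom \<theta>"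
    unfolding taylor_hom_def
  proof (intro conjI allI)
    fix \<phi> \<psi>
    let ?a = "num \<phi>" and ?b = "den \<phi>" and ?c = "num \<psi>" and ?d = "den \<psi>"
    note [intro] = R.add_mem R.mult_mem nd(1,2)
    have "\<phi> * \<psi> = (?a * ?c) / (?b * ?d)"
      by (subst nd(4)[of \<phi>], subst nd(4)[of \<psi>]) simp
    then have "\<theta> (\<phi> * \<psi>) = D (?a * ?c) * inverse (D (?b * ?d))"
      using nd(3) by (auto intro!: eq)
    also have "\<dots> = \<theta> \<phi> * \<theta> \<psi>"
      unfolding \<theta>_def by (simp add: mult nd(1,2) fps_inverse_mult mult_ac)
    finally show "\<theta> (\<phi> * \<psi>) = \<theta> \<phi> * \<theta> \<psi>" .
    have "\<phi> + \<psi> = (?a * ?d + ?c * ?b) / (?b * ?d)"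
      using nd(3) by (subst nd(4)[of \<phi>], subst nd(4)[of \<psi>]) (simp add: add_frac_eq)
    then have "\<theta> (\<phi> + \<psi>) = D (?a * ?d + ?c * ?b) * inverse (D (?b * ?d))"
      using nd(3) by (auto intro!: eq)
    also have "D (?a * ?d + ?c * ?b) = D ?a * D ?d + D ?c * D ?b"
      by (subst add) (auto simp: mult nd(1,2))
    also have "(D ?a * D ?d + D ?c * D ?b) * inverse (D (?b * ?d)) =
        D ?a * inverse (D ?b) * (D ?d * inverse (D ?d)) + D ?c * inverse (D ?d) * (D ?b * inverse (D ?b))"
      by (simp add: mult nd(1,2) fps_inverse_mult algebra_simps)
    also have "\<dots> = \<theta> \<phi> + \<theta> \<psi>"
      using inv[OF nd(2,3)] by (simp add: \<theta>_def)
    finally show "\<theta> (\<phi> + \<psi>) = \<theta> \<phi> + \<theta> \<psi>" .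
    show "\<theta> \<phi> $ 0 = \<phi>"
      using nd(4)[of \<phi>] by (simp add: \<theta>_def nth_0 nd(1,2) divide_inverse)
  qed (simp add: ext const D_const)
  then show ?thesis using ext by blast
qed

text \<open>Replacing \<open>x\<close> by \<open>x + T\<close> requires a square root of
  \<open>f(x + T)\<close>. It exists over \<open>K\<close>: the constant coefficient is the square
  of the nonzero \<open>y\<close>, and 2 is invertible.\<close>

lemma taylor_x_exists: "\<exists>\<theta>. taylor_hom \<theta> \<and> \<theta> x = fps_const x + fps_X"
proof -
  define ev where "ev q = fps_eval (map_poly (emb X) q) (fps_const x + fps_X)" for q
  have ev_0: "ev q $ 0 = pv q x" for q
    by (simp add: ev_def polyval_def)
  have ev_add: "ev (p + q) = ev p + ev q" for p q
    by (simp add: ev_def emb_poly.hom_add fps_eval_add)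
  have ev_mult: "ev (p * q) = ev p * ev q" for p q
  proof -
    \<comment> \<open>The coefficient maps \<open>F \<rightarrow> K \<rightarrow> K[[T]]\<close> are
      merged into one ring homomorphism, from which multiplicativity of \<open>ev\<close>
      follows.\<close>
    interpret c: comm_ring_hom "\<lambda>c. fps_const (emb X c)"
      by unfold_locales (auto simp: emb.hom_add emb.hom_mult)
    interpret cp: map_poly_comm_ring_hom "\<lambda>c. fps_const (emb X c)" ..
    have *: "ev r = poly (map_poly (\<lambda>c. fps_const (emb X c)) r) (fps_const x + fps_X)" for r
      by (simp add: ev_def fps_eval_def Polynomial.map_poly_map_poly o_def)
    show ?thesis
      unfolding * by (simp add: cp.hom_mult)
  qed
  obtain Y where Y: "Y $ 0 = y" "Y\<^sup>2 = ev f"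
    using fps_sqrt_exists[of y "ev f"] y_square y_nz two_nz_K by (auto simp: ev_0)
  have "\<forall>a. \<exists>q r. a \<in> A \<longrightarrow> a = pv q x + pv r x * y"
    using A_elim by metis
  then obtain Q R where QR: "\<And>a. a \<in> A \<Longrightarrow> a = pv (Q a) x + pv (R a) x * y"
    by metis
  define D where "D a = ev (Q a) + ev (R a) * Y" for a
  \<comment> \<open>Well defined, since coordinates with respect to \<open>1, y\<close> are
    unique.\<close>
  have D: "D (pv q x + pv r x * y) = ev q + ev r * Y" for q r
  proof -
    define a where "a = pv q x + pv r x * y"
    have "pv (Q a - q) x + pv (R a - r) x * y = 0"
      using QR[of a] A_intro[of q r] by (simp add: pv_diff algebra_simps a_def[symmetric])
        (simp add: a_def algebra_simps)
    then have "Q a = q" "R a = r"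
      using repr_zero by fastforce+
    then show ?thesis by (simp add: D_def a_def)
  qed
  have ev_const: "ev [:c:] = fps_const (emb X c)" for c
    by (simp add: ev_def Polynomial.map_poly_pCons)
  have Dp: "D (pv q x) = ev q" for q
    using D[of q 0] by (simp add: ev_def)
  have "\<exists>\<theta>. taylor_hom \<theta> \<and> (\<forall>a\<in>A. \<theta> a = D a)"
  proof (rule taylor_extend[OF A.field_subring_axioms A_const fraction])
    fix a b assume "a \<in> A" "b \<in> A"
    then obtain q r q' r' where *: "a = pv q x + pv r x * y" "b = pv q' x + pv r' x * y"
      by (metis A_elim)
    have "a + b = pv (q + q') x + pv (r + r') x * y"
      by (simp add: * pv_add algebra_simps)
    then show "D (a + b) = D a + D b"
      by (simp only: D *) (simp add: ev_add algebra_simps)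
    have "a * b = pv (q * q' + r * r' * f) x + pv (q * r' + r * q') x * y"
      by (simp add: * pv_add pv_mult algebra_simps power2_eq_square y_square[symmetric])
    then show "D (a * b) = D a * D b"
      by (simp only: D *) (simp add: ev_add ev_mult Y(2)[symmetric] algebra_simps power2_eq_square)
    show "D a $ 0 = a"
      by (simp add: *(1) D ev_0 Y)
  next
    fix c show "D (emb X c) = fps_const (emb X c)"
      using Dp[of "[:c:]"] by (simp add: ev_const)
  qed
  then obtain \<theta> where \<theta>: "taylor_hom \<theta>" "\<And>a. a \<in> A \<Longrightarrow> \<theta> a = D a"
    by blast
  have "\<theta> x = ev [:0, 1:]"
    using \<theta>(2)[OF A_x] Dp[of "[:0, 1:]"] by simp
  also have "\<dots> = fps_const x + fps_X"
    by (simp add: ev_def Polynomial.map_poly_pCons)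
  finally show ?thesis using \<theta>(1) by blast
qed

text \<open>The coefficients are the Hasse derivatives with respect to \<open>t\<close>. Existence
  and uniqueness are established for \<open>dx t \<noteq> 0\<close>.\<close>

definition taylor_at :: "'k \<Rightarrow> 'k \<Rightarrow> 'k fps" where
  "taylor_at t = (THE \<theta>. taylor_hom \<theta> \<and> \<theta> t = fps_const t + fps_X)"

lemma taylor_x: "taylor_hom (taylor_at x)" "taylor_at x x = fps_const x + fps_X"
proof -
  have "\<exists>!\<theta>. taylor_hom \<theta> \<and> \<theta> x = fps_const x + fps_X"
    using taylor_x_exists taylor_eqI by auto
  from theI'[OF this] show "taylor_hom (taylor_at x)" "taylor_at x x = fps_const x + fps_X"
    by (simp_all add: taylor_at_def)
qed

text \<open>The derivation \<open>d/dx\<close> of \<open>K\<close>. All differentials are measured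
  against \<open>x\<close>, so that \<open>d\<phi>/dt\<close> becomes
  \<open>dx \<phi> / dx t\<close>.\<close>

definition dx :: "'k \<Rightarrow> 'k" where
  "dx \<phi> = taylor_at x \<phi> $ 1"

lemma dx_x: "dx x = 1"
  by (simp add: dx_def taylor_x)

text \<open>Both sides agree at \<open>x\<close>, which determines them: every higher derivation is
  a reparametrization of the one attached to \<open>x\<close>.\<close>

lemma taylor_factor:
  assumes "taylor_hom \<theta>"
  shows "\<theta> \<phi> = taylor_at x \<phi> oo (\<theta> x - fps_const x)"
proof -
  have "(\<theta> x - fps_const x) $ 0 = 0"
    by (simp add: taylor_nth_0[OF assms])
  then have "\<theta> = (\<lambda>\<phi>. taylor_at x \<phi> oo (\<theta> x - fps_const x))"
    by (intro taylor_eqI assms taylor_compose[OF taylor_x(1)])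
      (simp_all add: taylor_x(2) fps_compose_add_distrib)
  then show ?thesis by metis
qed

lemma compose_nth_1: "(B oo S) $ 1 = B $ 1 * S $ 1" if "S $ 0 = 0" for B S :: "'k fps"
  using that by (simp add: fps_compose_nth)

lemma taylor_nth_1: "taylor_hom \<theta> \<Longrightarrow> \<theta> \<phi> $ 1 = dx \<phi> * \<theta> x $ 1"
  unfolding dx_def
  by (subst taylor_factor, assumption, subst compose_nth_1) (auto simp: taylor_nth_0)

text \<open>If \<open>E\<close> is the expansion of \<open>t\<close> along \<open>x\<close> without
  its constant term, then \<open>\<theta> t = t + T\<close> says that \<open>\<theta> x - x\<close>
  is a compositional inverse of \<open>E\<close>. It exists because \<open>E $ 1 = dx t\<close> is
  nonzero.\<close>

lemma
  assumes "dx t \<noteq> 0"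
  shows taylor_at_hom: "taylor_hom (taylor_at t)"
    and taylor_at_self: "taylor_at t t = fps_const t + fps_X"
    and taylor_at_unique: "taylor_hom \<theta> \<Longrightarrow> \<theta> t = fps_const t + fps_X \<Longrightarrow> \<theta> = taylor_at t"
proof -
  define E where "E = taylor_at x t - fps_const t"
  have E: "E $ 0 = 0" "E $ 1 \<noteq> 0"
    using assms by (simp_all add: dx_def E_def taylor_nth_0[OF taylor_x(1)])
  define S where "S = fps_inv E"
  have S: "S $ 0 = 0"
    by (simp add: S_def fps_inv_def)
  have "taylor_at x t oo S = (E oo S) + fps_const t"
    unfolding E_def fps_compose_sub_distrib fps_const_compose by simp
  also have "E oo S = fps_X"
    unfolding S_def using E by (rule fps_inv_right)
  finally have ex: "taylor_hom (\<lambda>\<phi>. taylor_at x \<phi> oo S) \<and> taylor_at x t oo S = fps_const t + fps_X"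
    using taylor_compose[OF taylor_x(1) S] by (simp add: add.commute)
  have uniq: "\<theta> = (\<lambda>\<phi>. taylor_at x \<phi> oo S)" if th: "taylor_hom \<theta>" "\<theta> t = fps_const t + fps_X" for \<theta>
  proof -
    define B where "B = \<theta> x - fps_const x"
    have B: "B $ 0 = 0"
      by (simp add: B_def taylor_nth_0[OF th(1)])
    have "E oo B = fps_X"
      using th(2) by (simp add: taylor_factor[OF th(1), of t] E_def B_def fps_compose_sub_distrib)
    then have "S = (S oo E) oo B"
      using fps_compose_assoc[OF B E(1), of S] by simp
    also have "S oo E = fps_X"
      unfolding S_def using E by (rule fps_inv)
    also have "fps_X oo B = B"
      using B by simp
    finally have "S = B" .
    then show ?thesis
      using taylor_factor[OF th(1)] unfolding B_def by blast
  qed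
  have ex1: "\<exists>!\<theta>. taylor_hom \<theta> \<and> \<theta> t = fps_const t + fps_X"
    using ex uniq by (intro ex1I[of _ "\<lambda>\<phi>. taylor_at x \<phi> oo S"]) auto
  from theI'[OF this] show *: "taylor_hom (taylor_at t)" "taylor_at t t = fps_const t + fps_X"
    by (simp_all add: taylor_at_def)
  show "\<theta> = taylor_at t" if "taylor_hom \<theta>" "\<theta> t = fps_const t + fps_X" for \<theta>
    using uniq[OF that] uniq[OF *] by simp
qed

lemma taylor_at_nth_1:
  assumes "dx t \<noteq> 0"
  shows "taylor_at t \<phi> $ 1 = dx \<phi> / dx t"
proof -
  note th = taylor_at_hom[OF assms]
  have "1 = dx t * taylor_at t x $ 1"
    using taylor_nth_1[OF th, of t] taylor_at_self[OF assms] by simp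
  then show ?thesis
    using taylor_nth_1[OF th, of \<phi>] assms by (simp add: field_simps)
qed

lemma dx_mult: "dx (\<phi> * \<psi>) = \<phi> * dx \<psi> + \<psi> * dx \<phi>"
  unfolding dx_def by (rule taylor_nth_1_mult[OF taylor_x(1)])

lemma dx_add: "dx (\<phi> + \<psi>) = dx \<phi> + dx \<psi>"
  by (simp add: dx_def taylor_add[OF taylor_x(1)])

lemma dx_const: "dx (emb X c) = 0"
  by (simp add: dx_def taylor_const[OF taylor_x(1)])

lemma dx_inverse: "\<phi> \<noteq> 0 \<Longrightarrow> dx (inverse \<phi>) = - dx \<phi> / \<phi>\<^sup>2"
  unfolding dx_def by (rule taylor_nth_1_inverse[OF taylor_x(1)])

lemma dx_pv: "dx (pv q z) = pv (pderiv q) z * dx z"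
  unfolding dx_def by (rule taylor_nth_1_pv[OF taylor_x(1)])

lemma dx_square_root: "w\<^sup>2 = pv h z \<Longrightarrow> 2 * w * dx w = pv (pderiv h) z * dx z"
  using dx_mult[of w w] dx_pv[of h z] by (simp add: power2_eq_square mult.assoc)

lemma dx_y: "2 * y * dx y = pv (pderiv f) x"
  using dx_square_root[OF y_square] dx_x by simp

lemma dx_y_nz: "dx y \<noteq> 0"
  using dx_y pv_x_nz[OF pderiv_f_nz] by auto

end

section \<open>Closed points\<close>

lemma subring_record_simps [simp]:
  "carrier (subring_record R) = R"
  "a \<otimes>\<^bsub>subring_record R\<^esub> b = a * b"
  "a \<oplus>\<^bsub>subring_record R\<^esub> b = a + b"
  "\<one>\<^bsub>subring_record R\<^esub> = 1"
  "\<zero>\<^bsub>subring_record R\<^esub> = 0"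
  by (simp_all add: subring_record_def)

context field_subring
begin

lemma cring_record: "cring (subring_record R)"
proof (intro cringI abelian_groupI comm_monoidI)
  fix a assume "a \<in> carrier (subring_record R)"
  then show "\<exists>b\<in>carrier (subring_record R). b \<oplus>\<^bsub>subring_record R\<^esub> a = \<zero>\<^bsub>subring_record R\<^esub>"
    using uminus_mem by (intro bexI[of _ "- a"]) auto
qed (auto simp: algebra_simps intro: add_mem mult_mem zero_mem one_mem)

text \<open>Confines the record-based algebra to this place: from here on ideals can be handled as
  plain subsets of \<open>K\<close>.\<close>

lemma ideal_record_iff:
  "ideal I (subring_record R) \<longleftrightarrow>
     I \<subseteq> R \<and> 0 \<in> I \<and> (\<forall>a\<in>I. \<forall>b\<in>I. a + b \<in> I) \<and> (\<forall>c\<in>R. \<forall>a\<in>I. c * a \<in> I)"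
proof
  interpret cring "subring_record R" by (rule cring_record)
  assume "ideal I (subring_record R)"
  then interpret ideal I "subring_record R" .
  show "I \<subseteq> R \<and> 0 \<in> I \<and> (\<forall>a\<in>I. \<forall>b\<in>I. a + b \<in> I) \<and> (\<forall>c\<in>R. \<forall>a\<in>I. c * a \<in> I)"
    using Icarr zero_closed a_closed I_l_closed by force
next
  interpret cring "subring_record R" by (rule cring_record)
  assume I: "I \<subseteq> R \<and> 0 \<in> I \<and> (\<forall>a\<in>I. \<forall>b\<in>I. a + b \<in> I) \<and> (\<forall>c\<in>R. \<forall>a\<in>I. c * a \<in> I)"
  have neg: "\<ominus>\<^bsub>subring_record R\<^esub> a = - a" if "a \<in> I" for a
    using that I by (intro minus_equality) (auto intro: uminus_mem)
  have neg_I: "- a \<in> I" if "a \<in> I" for a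
    using that I uminus_mem[OF one_mem] by (metis mult_minus1)
  show "ideal I (subring_record R)"
  proof (rule idealI)
    show "subgroup I (add_monoid (subring_record R))"
    proof (rule group.subgroupI[OF a_group])
      fix a assume "a \<in> I"
      then show "inv\<^bsub>add_monoid (subring_record R)\<^esub> a \<in> I"
        using neg neg_I by (simp add: a_inv_def)
    qed (use I in auto)
    fix a c assume ac: "a \<in> I" "c \<in> carrier (subring_record R)"
    then have "c * a \<in> I" using I by simp
    then show "c \<otimes>\<^bsub>subring_record R\<^esub> a \<in> I" "a \<otimes>\<^bsub>subring_record R\<^esub> c \<in> I"
      by (simp_all add: mult.commute)
  qed (rule ring_axioms)
qed

lemma maximal_prime_localization:
  assumes "maximalideal P (subring_record R)"
  shows "prime_localization R P"
proof -
  interpret m: maximalideal P "subring_record R" by fact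
  have prime: "primeideal P (subring_record R)"
    by (rule cring.maximalideal_prime[OF cring_record assms])
  have I: "P \<subseteq> R \<and> 0 \<in> P \<and> (\<forall>a\<in>P. \<forall>b\<in>P. a + b \<in> P) \<and> (\<forall>c\<in>R. \<forall>a\<in>P. c * a \<in> P)"
    using m.is_ideal unfolding ideal_record_iff .
  show ?thesis
  proof
    show "1 \<notin> P"
    proof
      assume "1 \<in> P"
      then have "c * 1 \<in> P" if "c \<in> R" for c using I that by blast
      then have "R = P" using I by auto
      then show False using m.I_notcarr by simp
    qed
    show "P \<subseteq> R" "0 \<in> P" using I by blast+
    show "a + b \<in> P" if "a \<in> P" "b \<in> P" for a b using I that by blast
    show "a * b \<in> P" if "a \<in> R" "b \<in> P" for a b using I that by blast
    show "a \<in> P \<or> b \<in> P" if "a \<in> R" "b \<in> R" "a * b \<in> P" for a b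
      using primeideal.I_prime[OF prime, of a b] that by simp
  qed
qed

lemma maximal_record_max:
  assumes "maximalideal P (subring_record R)"
    and "I \<subseteq> R" "0 \<in> I" "\<And>a b. a \<in> I \<Longrightarrow> b \<in> I \<Longrightarrow> a + b \<in> I"
    and "\<And>c a. c \<in> R \<Longrightarrow> a \<in> I \<Longrightarrow> c * a \<in> I" and "P \<subseteq> I"
  shows "I = P \<or> I = R"
proof -
  interpret m: maximalideal P "subring_record R" by fact
  have "ideal I (subring_record R)"
    unfolding ideal_record_iff using assms by blast
  then show ?thesis using m.I_maximal[of I] assms by simp
qed

end

section \<open>Localizations that are discrete valuation rings\<close>

context prime_localization
begin

lemma loc_unit_mult: "a \<in> loc - loc_max \<Longrightarrow> b \<in> loc - loc_max \<Longrightarrow> a * b \<in> loc - loc_max"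
proof -
  assume ab: "a \<in> loc - loc_max" "b \<in> loc - loc_max"
  then have inv: "inverse a \<in> loc" "a \<noteq> 0"
    using loc_unit P_loc_max[OF zero_P] by auto
  have "a * b \<notin> loc_max"
  proof
    assume "a * b \<in> loc_max"
    then have "inverse a * (a * b) \<in> loc_max"
      using loc_max_mult inv by blast
    then show False using ab inv by (simp add: field_simps)
  qed
  then show ?thesis
    using ab field_subring.mult_mem[OF loc_subring] by blast
qed

lemma loc_unit_inverse: "a \<in> loc - loc_max \<Longrightarrow> inverse a \<in> loc - loc_max"
  using loc_unit[of a] loc_max_mult[of a "inverse a"] P_loc_max[OF zero_P] one_loc_max
  by (cases "a = 0") auto

lemma loc_unit_I: "a \<in> R \<Longrightarrow> a \<notin> P \<Longrightarrow> a \<in> loc - loc_max"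
  using R_loc loc_max_iff by blast

text \<open>While \<open>a\<close> is not a unit, a factor \<open>\<pi>\<close> can be cancelled on
  both sides, at most \<open>j\<close> times. The later use has \<open>b\<close> the conjugate of
  \<open>a\<close> and the norm on the right.\<close>

lemma factor_unit_times_power:
  assumes M: "loc_max = {\<pi> * a | a. a \<in> loc}" and nz: "\<pi> \<noteq> 0"
  shows "a \<in> loc \<Longrightarrow> b \<in> loc \<Longrightarrow> e \<in> loc - loc_max \<Longrightarrow> a * b = e * \<pi> ^ j \<Longrightarrow>
    \<exists>e' i. e' \<in> loc - loc_max \<and> a = e' * \<pi> ^ i"
proof (induction j arbitrary: a)
  case 0
  then have "a \<notin> loc_max"
    using loc_max_mult[of b a] by (auto simp: mult.commute)
  then show ?case using 0 by (intro exI[of _ a] exI[of _ 0]) auto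
next
  case (Suc j)
  show ?case
  proof (cases "a \<in> loc_max")
    case False
    then show ?thesis using Suc.prems by (intro exI[of _ a] exI[of _ 0]) auto
  next
    case True
    then obtain a' where a': "a' \<in> loc" "a = \<pi> * a'"
      using M by blast
    then have "a' * b = e * \<pi> ^ j"
      using Suc.prems(4) nz by (simp add: mult_ac)
    then obtain e' i where "e' \<in> loc - loc_max" "a' = e' * \<pi> ^ i"
      using Suc.IH a'(1) Suc.prems(2,3) by blast
    then show ?thesis
      using a'(2) by (intro exI[of _ e'] exI[of _ "Suc i"]) auto
  qed
qed

lemma valuation_subringI:
  assumes M: "loc_max \<subseteq> {\<pi> * a | a. a \<in> loc}" and unif: "\<pi> \<in> loc_max" "\<pi> \<noteq> 0"
    and R_power: "\<And>a. a \<in> R \<Longrightarrow> a \<noteq> 0 \<Longrightarrow> \<exists>e i. e \<in> loc - loc_max \<and> a = e * \<pi> ^ i"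
    and frac: "\<And>\<phi>. \<exists>a\<in>R. \<exists>b\<in>R. b \<noteq> 0 \<and> \<phi> = a / b"
  shows "valuation_subring loc loc_max \<pi>"
proof -
  interpret loc: field_subring loc by (rule loc_subring)
  show ?thesis
  proof
    show "loc_max = {\<pi> * a | a. a \<in> loc}"
      using M loc_max_mult unif by (auto simp: mult.commute)
    show "\<pi> \<in> loc" using unif loc_max_sub by blast
    fix \<phi> :: 'k assume "\<phi> \<noteq> 0"
    moreover obtain a b where ab: "a \<in> R" "b \<in> R" "b \<noteq> 0" "\<phi> = a / b"
      using frac by blast
    ultimately obtain e i e' j where *: "e \<in> loc - loc_max" "a = e * \<pi> ^ i"
        "e' \<in> loc - loc_max" "b = e' * \<pi> ^ j"
      using R_power[of a] R_power[of b] by auto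
    have "\<phi> = e * inverse e' * \<pi> powi (int i - int j)"
      using * ab(4) unif(2) by (simp add: power_int_diff divide_inverse mult_ac)
    then show "\<exists>e n. e \<in> loc - loc_max \<and> \<phi> = e * \<pi> powi n"
      using loc_unit_mult[OF *(1) loc_unit_inverse[OF *(3)]] by blast
  qed (use loc_unit one_loc_max unif in auto)
qed

end

section \<open>The chart at infinity\<close>

context hyperelliptic
begin

abbreviation "u \<equiv> u_fun X"
abbreviation "v \<equiv> v_fun X"
abbreviation "B \<equiv> infinity_ring X"
abbreviation "LR \<equiv> local_ring X"
abbreviation "LM \<equiv> max_ideal X"

text \<open>As \<open>f\<close> has degree \<open>2 g + 1\<close>, this is
  \<open>u^(2 g + 2) f(1/u)\<close>. The reversed polynomial has the leading coefficient of
  \<open>f\<close> as constant term, so the zero at \<open>u = 0\<close> is simple.\<close>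

definition hinf :: "'a poly" where "hinf = pCons 0 (reflect_poly f)"

lemma u_nz: "u \<noteq> 0"
  using x_nz by (simp add: u_fun_def)

lemma v_nz: "v \<noteq> 0"
  using x_nz y_nz by (simp add: v_fun_def)

lemma x_inverse_u: "x = inverse u"
  by (simp add: u_fun_def)

lemma pv_reflect:
  assumes "z \<noteq> 0"
  shows "pv (reflect_poly q) z = z ^ degree q * pv q (inverse z)"
proof -
  have deg: "degree (map_poly (emb X) q) = degree q"
    by (rule degree_map_poly) simp
  have "map_poly (emb X) (reflect_poly q) = reflect_poly (map_poly (emb X) q)"
    by (rule poly_eqI) (simp add: coeff_map_poly coeff_reflect_poly deg)
  then show ?thesis
    using poly_reflect_poly_nz[OF assms, of "map_poly (emb X) q"] by (simp add: polyval_def deg)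
qed

lemma pv_x_reflect: "pv q x = x ^ degree q * pv (reflect_poly q) u"
  using pv_reflect[OF u_nz, of q] u_nz by (simp add: x_inverse_u field_simps)

lemma v_square: "v\<^sup>2 = pv hinf u"
proof -
  have "pv hinf u = u * (u ^ degree f * pv f x)"
    by (simp add: hinf_def pv_reflect[OF u_nz] x_inverse_u)
  also have "\<dots> = u ^ (2 * genus X + 2) * y\<^sup>2"
    by (simp add: degree_f y_square[symmetric] power_add power2_eq_square)
  also have "\<dots> = v\<^sup>2"
    by (simp add: v_fun_def u_fun_def field_simps power_mult_distrib power_add power2_eq_square
        mult_2_right mult_2)
  finally show ?thesis ..
qed

lemma y_v: "y = v * x ^ (genus X + 1)"
  using x_nz by (simp add: v_fun_def)

sublocale B: field_subring B
  unfolding infinity_ring_def by (rule double_cover_subring[OF v_square])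

text \<open>A high power of \<open>x\<close> turns a relation in \<open>u, v\<close> into one in
  \<open>x, y\<close>.\<close>

lemma repr_zero_inf:
  assumes "pv q u + pv r u * v = 0"
  shows "q = 0" and "r = 0"
proof -
  let ?m = "degree q" and ?n = "degree r" and ?g = "genus X + 1"
  have rq: "x ^ ?m * pv q u = pv (reflect_poly q) x"
    using pv_reflect[OF x_nz, of q] by (simp add: x_inverse_u)
  have rr: "x ^ ?n * pv r u = pv (reflect_poly r) x"
    using pv_reflect[OF x_nz, of r] by (simp add: x_inverse_u)
  have "0 = x ^ (?m + ?n + ?g) * (pv q u + pv r u * v)"
    by (simp add: assms)
  also have "\<dots> = x ^ (?n + ?g) * (x ^ ?m * pv q u) + x ^ ?m * (x ^ ?n * pv r u) * (v * x ^ ?g)"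
    by (simp add: algebra_simps power_add)
  also have "\<dots> = pv (monom 1 (?n + ?g) * reflect_poly q) x + pv (monom 1 ?m * reflect_poly r) x * y"
    unfolding rq rr y_v[symmetric] by (simp add: pv_mult pv_monom)
  finally have "monom 1 (?n + ?g) * reflect_poly q = 0" "monom 1 ?m * reflect_poly r = 0"
    using repr_zero by metis+
  then show "q = 0" "r = 0" by (auto simp: monom_eq_0_iff)
qed

abbreviation "Pinf \<equiv> point_ideal X Infinity"

text \<open>The value at infinity is \<open>q(0)\<close>: the only other possible source of
  constants, \<open>v^2\<close>, equals \<open>hinf\<close> at \<open>u\<close>, which has zero
  constant term.\<close>

lemma Pinf_iff: "pv q u + pv r u * v \<in> Pinf \<longleftrightarrow> coeff q 0 = 0"
proof
  assume "pv q u + pv r u * v \<in> Pinf"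
  then obtain a b where ab: "a \<in> B" "b \<in> B" "pv q u + pv r u * v = u * a + v * b"
    by auto
  then obtain q1 r1 q2 r2 where *: "a = pv q1 u + pv r1 u * v" "b = pv q2 u + pv r2 u * v"
    by (auto simp: infinity_ring_def double_cover_ring_def)
  have "u * a + v * b = u * pv q1 u + (u * pv r1 u) * v + pv q2 u * v + pv r2 u * v\<^sup>2"
    by (simp add: * algebra_simps power2_eq_square)
  also have "\<dots> = pv (pCons 0 q1 + r2 * hinf) u + pv (pCons 0 r1 + q2) u * v"
    by (simp add: v_square pv_add pv_mult algebra_simps)
  finally have "pv (q - (pCons 0 q1 + r2 * hinf)) u + pv (r - (pCons 0 r1 + q2)) u * v = 0"
    using ab(3) by (simp add: pv_diff algebra_simps)
  then have "q = pCons 0 q1 + r2 * hinf"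
    using repr_zero_inf(1) by fastforce
  then show "coeff q 0 = 0"
    by (simp add: hinf_def coeff_mult)
next
  assume "coeff q 0 = 0"
  then obtain q' where "q = pCons 0 q'"
    by (metis coeff_pCons_0 pCons_cases)
  then have eq: "pv q u + pv r u * v = u * pv q' u + v * pv r u"
    by simp
  have "pv q' u \<in> B" "pv r u \<in> B"
    unfolding infinity_ring_def by (rule double_cover_poly)+
  then show "pv q u + pv r u * v \<in> Pinf"
    unfolding eq point_ideal.simps by blast
qed

lemma B_elim:
  assumes "a \<in> B"
  obtains q r where "a = pv q u + pv r u * v"
  using assms by (auto simp: infinity_ring_def double_cover_ring_def)

lemma Pinf_localization: "prime_localization B Pinf"
proof
  have uv: "u \<in> B" "v \<in> B"
    unfolding infinity_ring_def by (rule double_cover_z double_cover_w)+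
  show "Pinf \<subseteq> B"
    using uv by (auto intro: B.add_mem B.mult_mem)
  show "0 \<in> Pinf"
    using Pinf_iff[of 0 0] by simp
  show "1 \<notin> Pinf"
    using Pinf_iff[of 1 0] by simp
  show "a + b \<in> Pinf" if ab: "a \<in> Pinf" "b \<in> Pinf" for a b
  proof -
    obtain a1 a2 b1 b2 where *: "a1 \<in> B" "a2 \<in> B" "b1 \<in> B" "b2 \<in> B"
      "a = u * a1 + v * a2" "b = u * b1 + v * b2"
      using ab by auto
    have "a + b = u * (a1 + b1) + v * (a2 + b2)"
      by (simp add: * algebra_simps)
    then show ?thesis using * B.add_mem by auto
  qed
  show "c * a \<in> Pinf" if ca: "c \<in> B" "a \<in> Pinf" for c a
  proof -
    obtain a1 a2 where *: "a1 \<in> B" "a2 \<in> B" "a = u * a1 + v * a2"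
      using ca by auto
    have "c * a = u * (c * a1) + v * (c * a2)"
      by (simp add: * algebra_simps)
    then show ?thesis using * ca B.mult_mem by auto
  qed
  show "a \<in> Pinf \<or> b \<in> Pinf" if ab: "a \<in> B" "b \<in> B" "a * b \<in> Pinf" for a b
  proof -
    obtain q r where a: "a = pv q u + pv r u * v" using B_elim[OF ab(1)] .
    obtain q' r' where b: "b = pv q' u + pv r' u * v" using B_elim[OF ab(2)] .
    have "a * b = pv q u * pv q' u + pv r u * pv r' u * v\<^sup>2 + (pv q u * pv r' u + pv r u * pv q' u) * v"
      by (simp add: a b algebra_simps power2_eq_square)
    also have "\<dots> = pv (q * q' + r * r' * hinf) u + pv (q * r' + r * q') u * v"
      by (simp add: v_square pv_add pv_mult)
    \<comment> \<open>The constant coefficient of this polynomial is the product of those of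
      \<open>q\<close> and \<open>q'\<close>, so primality comes from \<open>F\<close> being a
      field.\<close>
    finally have "coeff (q * q' + r * r' * hinf) 0 = 0"
      using ab(3) Pinf_iff by simp
    then show ?thesis
      by (simp only: a b Pinf_iff) (simp add: hinf_def coeff_mult)
  qed
qed

end

section \<open>Taylor expansions and tangent vectors at a smooth point of a double cover\<close>

locale chart_point = hyperelliptic X
  for X :: "('a::field, 'k::field) hyp_curve" +
  fixes p :: "'k closed_point" and z w :: 'k and h :: "'a poly"
  assumes chart: "chart_ring X p = double_cover_ring X z w"
    and pl: "prime_localization (chart_ring X p) (point_ideal X p)"
    and w_square: "w\<^sup>2 = pv h z"
    and smooth: "w \<notin> point_ideal X p \<or> pv (pderiv h) z \<notin> point_ideal X p"
    and dx_z: "dx z \<noteq> 0"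
begin

abbreviation "R0 \<equiv> chart_ring X p"
abbreviation "P \<equiv> point_ideal X p"
abbreviation "V \<equiv> local_ring X p"
abbreviation "M \<equiv> max_ideal X p"

text \<open>An etale coordinate at the point. If \<open>w\<close> vanishes, \<open>h'(z)\<close> is
  a unit and \<open>2 w dw = h'(z) dz\<close> makes \<open>dz\<close> a multiple of
  \<open>dw\<close>; otherwise \<open>2 w\<close> is a unit and \<open>z\<close> will do. It need
  not lie in the maximal ideal.\<close>

definition \<tau> :: 'k where "\<tau> = (if w \<in> P then w else z)"

sublocale pl: prime_localization R0 P
  by (rule pl)

lemma V_loc: "V = pl.loc" and M_loc: "M = pl.loc_max"
  by (simp_all add: local_ring_def max_ideal_def pl.loc_def pl.loc_max_def)

sublocale V: field_subring V
  unfolding V_loc by (rule pl.loc_subring)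

lemma R0_V: "a \<in> R0 \<Longrightarrow> a \<in> V"
  using pl.R_loc V_loc by simp

lemma const_V: "emb X c \<in> V" and pv_z_V: "pv q z \<in> V" and z_V: "z \<in> V" and w_V: "w \<in> V"
  by (rule R0_V, subst chart, rule double_cover_const double_cover_poly double_cover_z double_cover_w)+

lemma unit_V: "a \<in> V \<Longrightarrow> a \<notin> M \<Longrightarrow> inverse a \<in> V"
  using pl.loc_unit V_loc M_loc by simp

lemma two_unit: "inverse (2::'k) \<in> V"
proof -
  have eq: "inverse (2::'k) = emb X (inverse 2)"
    by (metis emb.hom_add emb.hom_inverse emb.hom_one one_add_one)
  show ?thesis unfolding eq by (rule const_V)
qed

lemma zero_P: "0 \<in> P" by (rule pl.zero_P)

lemma \<tau>_V: "\<tau> \<in> V"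
  by (simp add: \<tau>_def w_V z_V)

lemma dx_\<tau>: "dx \<tau> \<noteq> 0"
proof (cases "w \<in> P")
  case True
  then have "pv (pderiv h) z \<noteq> 0"
    using smooth zero_P by auto
  then have "2 * w * dx w \<noteq> 0"
    using dx_square_root[OF w_square] dx_z by simp
  then show ?thesis using True by (auto simp: \<tau>_def)
qed (simp add: \<tau>_def dx_z)

abbreviation "\<theta> \<equiv> taylor_at \<tau>"

lemmas th = taylor_at_hom[OF dx_\<tau>] and th_self = taylor_at_self[OF dx_\<tau>]

lemma unit_R0: "a \<in> R0 \<Longrightarrow> a \<notin> P \<Longrightarrow> a \<noteq> 0 \<and> inverse a \<in> V"
  using pl.loc_unit_I[of a] unit_V zero_P unfolding V_loc M_loc by auto

lemma coeff_map_V: "coeff (map_poly (emb X) q) i \<in> V"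
  by (simp add: coeff_map_poly const_V)

text \<open>One of the two series is the coordinate plus \<open>T\<close>. The other is a root of
  \<open>h(Z) = (w + T)^2\<close> or of \<open>W^2 = h(z + T)\<close>, and the derivative at its
  constant term, \<open>h'(z)\<close> or \<open>2 w\<close>, is a unit.\<close>

lemma taylor_zw: "\<theta> z \<in> fps_over V \<and> \<theta> w \<in> fps_over V"
proof (cases "w \<in> P")
  case True
  then have tw: "\<tau> = w" by (simp add: \<tau>_def)
  have w: "\<theta> w \<in> fps_over V"
    using th_self unfolding tw by (auto intro: V.fps_over_add V.fps_over_const V.fps_over_X w_V)
  have "pv (pderiv h) z \<in> R0 - P"
    using True smooth chart double_cover_poly by auto
  then have unit: "pv (pderiv h) z \<noteq> 0" "inverse (pv (pderiv h) z) \<in> V"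
    using unit_R0 by auto
  have "fps_eval (map_poly (emb X) h) (\<theta> z) = \<theta> w ^ 2"
    by (simp add: taylor_pv[OF th, symmetric] w_square[symmetric] taylor_power[OF th])
  then have int: "fps_eval (map_poly (emb X) h) (\<theta> z) \<in> fps_over V"
    using V.fps_over_power[OF w] by simp
  have d: "poly (pderiv (map_poly (emb X) h)) (\<theta> z $ 0) = pv (pderiv h) z"
    unfolding polyval_def emb.map_poly_pderiv taylor_nth_0[OF th] ..
  have "\<theta> z \<in> fps_over V"
    by (rule V.hensel_integral[OF coeff_map_V _ _ _ int])
      (unfold d, simp_all only: taylor_nth_0[OF th] z_V unit simp_thms)
  with w show ?thesis by blast
next
  case False
  then have tz: "\<tau> = z" by (simp add: \<tau>_def)
  have z: "\<theta> z \<in> fps_over V"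
    using th_self unfolding tz by (auto intro: V.fps_over_add V.fps_over_const V.fps_over_X z_V)
  have unit: "w \<noteq> 0" "inverse w \<in> V"
    using False unit_R0[of w] chart double_cover_w by auto
  let ?q = "monom 1 2 :: 'k poly"
  have "fps_eval ?q (\<theta> w) = fps_eval (map_poly (emb X) h) (\<theta> z)"
    by (simp add: fps_eval_monom taylor_pv[OF th, symmetric] w_square[symmetric] taylor_power[OF th])
  then have int: "fps_eval ?q (\<theta> w) \<in> fps_over V"
    using V.fps_over_eval[OF coeff_map_V z] by simp
  have d: "poly (pderiv ?q) (\<theta> w $ 0) = 2 * w"
    unfolding taylor_nth_0[OF th] by (simp add: pderiv_monom poly_monom)
  have coeffs: "coeff ?q i \<in> V" for i
    by (simp add: V.one_mem V.zero_mem)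
  have "inverse (2 * w) \<in> V"
    using V.mult_mem[OF two_unit unit(2)] by simp
  moreover have "2 * w \<noteq> 0"
    using unit(1) two_nz_K by simp
  ultimately have "\<theta> w \<in> fps_over V"
    by (intro V.hensel_integral[OF coeffs _ _ _ int])
      (unfold d, simp_all only: taylor_nth_0[OF th] w_V simp_thms)
  with z show ?thesis by blast
qed

lemma taylor_integral:
  assumes "\<phi> \<in> V"
  shows "\<theta> \<phi> \<in> fps_over V"
proof -
  have R0: "\<theta> a \<in> fps_over V" if a_R0: "a \<in> R0" for a
  proof -
    obtain q r where a: "a = pv q z + pv r z * w"
      using a_R0 chart by (auto simp: double_cover_ring_def)
    have "\<theta> a = fps_eval (map_poly (emb X) q) (\<theta> z) + fps_eval (map_poly (emb X) r) (\<theta> z) * \<theta> w"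
      by (simp add: a taylor_add[OF th] taylor_mult[OF th] taylor_pv[OF th])
    then show ?thesis
      using taylor_zw by (auto intro!: V.fps_over_add V.fps_over_mult V.fps_over_eval coeff_map_V)
  qed
  obtain a b where ab: "\<phi> = a / b" "a \<in> R0" "b \<in> R0 - P"
    using assms by (auto simp: local_ring_def)
  then have b: "b \<noteq> 0" "inverse b \<in> V"
    using unit_R0 by auto
  have "inverse (\<theta> b) \<in> fps_over V"
    using ab b by (intro V.fps_over_inverse R0) (auto simp: taylor_nth_0[OF th])
  then show ?thesis
    using ab R0[of a] b by (simp add: taylor_divide[OF th] V.fps_over_mult)
qed

lemma
  shows M_add: "a \<in> M \<Longrightarrow> b \<in> M \<Longrightarrow> a + b \<in> M"
    and M_mult: "c \<in> V \<Longrightarrow> a \<in> M \<Longrightarrow> c * a \<in> M"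
    and M_diff: "a \<in> M \<Longrightarrow> b \<in> M \<Longrightarrow> a - b \<in> M"
proof -
  show add: "a \<in> M \<Longrightarrow> b \<in> M \<Longrightarrow> a + b \<in> M" for a b
    using pl.loc_max_add M_loc by simp
  show mult: "c \<in> V \<Longrightarrow> a \<in> M \<Longrightarrow> c * a \<in> M" for c a
    using pl.loc_max_mult M_loc V_loc by simp
  show "a \<in> M \<Longrightarrow> b \<in> M \<Longrightarrow> a - b \<in> M"
    using add[of a "- b"] mult[of "- 1" b] V.uminus_mem[OF V.one_mem] by simp
qed

lemma M_unit_cancel: "e \<in> R0 \<Longrightarrow> e \<notin> P \<Longrightarrow> e * a \<in> M \<Longrightarrow> a \<in> M"
  using M_mult[of "inverse e" "e * a"] unit_R0[of e] by (simp flip: mult.assoc)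

text \<open>The cotangent space is generated by \<open>d\<tau>\<close>. The derivation rules hold
  only modulo the maximal ideal, so each identity carries correction terms in
  \<open>M\<close>.\<close>

lemma tangent_vanishing:
  assumes maps: "\<And>\<phi>. \<phi> \<in> V \<Longrightarrow> \<delta> \<phi> \<in> V"
    and add: "\<And>\<phi> \<psi>. \<phi> \<in> V \<Longrightarrow> \<psi> \<in> V \<Longrightarrow> \<delta> (\<phi> + \<psi>) - (\<delta> \<phi> + \<delta> \<psi>) \<in> M"
    and mult: "\<And>\<phi> \<psi>. \<phi> \<in> V \<Longrightarrow> \<psi> \<in> V \<Longrightarrow> \<delta> (\<phi> * \<psi>) - (\<phi> * \<delta> \<psi> + \<psi> * \<delta> \<phi>) \<in> M"
    and const: "\<And>c. \<delta> (emb X c) \<in> M"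
    and zero: "\<delta> \<tau> \<in> M" and "\<phi> \<in> V"
  shows "\<delta> \<phi> \<in> M"
proof -
  have add': "\<delta> (\<phi> + \<psi>) \<in> M" if "\<phi> \<in> V" "\<psi> \<in> V" "\<delta> \<phi> \<in> M" "\<delta> \<psi> \<in> M" for \<phi> \<psi>
    using M_add[OF add[OF that(1,2)] M_add[OF that(3,4)]] by simp
  have mult': "\<delta> (\<phi> * \<psi>) \<in> M" if "\<phi> \<in> V" "\<psi> \<in> V" "\<delta> \<phi> \<in> M" "\<delta> \<psi> \<in> M" for \<phi> \<psi>
    using M_add[OF mult[OF that(1,2)] M_add[OF M_mult[OF that(1,4)] M_mult[OF that(2,3)]]] by simp
  have pv: "\<delta> (pv q z) - pv (pderiv q) z * \<delta> z \<in> M" for q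
  proof (induction q)
    case 0
    then show ?case using const[of 0] by simp
  next
    case (pCons a q)
    let ?q = "pv q z" and ?q' = "pv (pderiv q) z"
    have 1: "\<delta> (emb X a + z * ?q) - (\<delta> (emb X a) + \<delta> (z * ?q)) \<in> M"
      by (intro add const_V V.mult_mem z_V pv_z_V)
    have 2: "\<delta> (z * ?q) - (z * \<delta> ?q + ?q * \<delta> z) \<in> M"
      by (intro mult z_V pv_z_V)
    have 3: "z * (\<delta> ?q - ?q' * \<delta> z) \<in> M"
      by (intro M_mult z_V pCons.IH)
    have "\<delta> (emb X a + z * ?q) - (?q + z * ?q') * \<delta> z =
        (\<delta> (emb X a + z * ?q) - (\<delta> (emb X a) + \<delta> (z * ?q))) + \<delta> (emb X a) +
        (\<delta> (z * ?q) - (z * \<delta> ?q + ?q * \<delta> z)) + z * (\<delta> ?q - ?q' * \<delta> z)"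
      by (simp add: algebra_simps)
    also have "\<dots> \<in> M"
      by (intro M_add 1 2 3 const)
    finally show ?case by (simp add: pderiv_pCons pv_add)
  qed
  \<comment> \<open>Both sides of \<open>w^2 = h(z)\<close> are differentiated and compared.\<close>
  have sq: "2 * w * \<delta> w - pv (pderiv h) z * \<delta> z \<in> M"
  proof -
    have "2 * w * \<delta> w - pv (pderiv h) z * \<delta> z =
        (\<delta> (pv h z) - pv (pderiv h) z * \<delta> z) - (\<delta> (w * w) - (w * \<delta> w + w * \<delta> w))"
      by (simp add: w_square[symmetric] power2_eq_square algebra_simps)
    also have "\<dots> \<in> M"
      by (intro M_diff pv mult w_V)
    finally show ?thesis .
  qed
  have zw: "\<delta> z \<in> M \<and> \<delta> w \<in> M"
  proof (cases "w \<in> P")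
    case True
    then have w: "\<delta> w \<in> M" using zero by (simp add: \<tau>_def)
    have "pv (pderiv h) z * \<delta> z = 2 * w * \<delta> w - (2 * w * \<delta> w - pv (pderiv h) z * \<delta> z)"
      by simp
    also have "2 * w \<in> V"
      using V.mult_mem[OF V.of_nat_mem[of 2] w_V] by simp
    then have "2 * w * \<delta> w - (2 * w * \<delta> w - pv (pderiv h) z * \<delta> z) \<in> M"
      by (intro M_diff M_mult w sq)
    finally have "pv (pderiv h) z * \<delta> z \<in> M" .
    then have "\<delta> z \<in> M"
      by (rule M_unit_cancel[rotated 2]) (use True smooth chart double_cover_poly in auto)
    with w show ?thesis by blast
  next
    case False
    then have z: "\<delta> z \<in> M" using zero by (simp add: \<tau>_def)
    have "2 * (w * \<delta> w) = (2 * w * \<delta> w - pv (pderiv h) z * \<delta> z) + pv (pderiv h) z * \<delta> z"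
      by simp
    also have "\<dots> \<in> M"
      by (intro M_add M_mult pv_z_V z sq)
    finally have "inverse 2 * (2 * (w * \<delta> w)) \<in> M"
      by (rule M_mult[OF two_unit])
    then have "w * \<delta> w \<in> M"
      using two_nz_K by simp
    then have "\<delta> w \<in> M"
      by (rule M_unit_cancel[rotated 2]) (use False chart double_cover_w in auto)
    with z show ?thesis by blast
  qed
  have pv': "\<delta> (pv q z) \<in> M" for q
    using M_add[OF pv[of q] M_mult[OF pv_z_V[of "pderiv q"], of "\<delta> z"]] zw by simp
  have R0: "\<delta> a \<in> M" if a_R0: "a \<in> R0" for a
  proof -
    obtain q r where a: "a = pv q z + pv r z * w"
      using a_R0 chart by (auto simp: double_cover_ring_def)
    show ?thesis
      unfolding a using zw by (intro add' mult' V.mult_mem pv_z_V w_V pv') auto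
  qed
  obtain a b where ab: "\<phi> = a / b" "a \<in> R0" "b \<in> R0" "b \<notin> P"
    using assms(6) by (auto simp: local_ring_def)
  have bV: "b \<in> V" "b \<noteq> 0"
    using ab R0_V unit_R0 by auto
  have "b * \<phi> = a"
    using ab bV by simp
  then have m: "\<delta> a - (b * \<delta> \<phi> + \<phi> * \<delta> b) \<in> M"
    using mult[OF bV(1) assms(6)] by simp
  \<comment> \<open>The value on a fraction is recovered from the product rule for
    \<open>b * \<phi> = a\<close>, because \<open>b\<close> is a unit of the local ring.\<close>
  have "b * \<delta> \<phi> = \<delta> a - (\<delta> a - (b * \<delta> \<phi> + \<phi> * \<delta> b)) - \<phi> * \<delta> b"
    by simp
  also have "\<dots> \<in> M"
    by (rule M_diff[OF M_diff[OF R0[OF ab(2)] m] M_mult[OF assms(6) R0[OF ab(3)]]])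
  finally show ?thesis
    using M_unit_cancel ab by blast
qed

lemma taylor_nth_1_integral: "\<phi> \<in> V \<Longrightarrow> dx \<phi> / dx \<tau> \<in> V"
  using V.fps_over_nth[OF taylor_integral, of \<phi> 1] taylor_at_nth_1[OF dx_\<tau>] by simp

text \<open>\<open>d/d\<tau>\<close> is itself a tangent vector. Conversely, subtracting from a
  tangent vector its value at \<open>\<tau>\<close> times \<open>d/d\<tau>\<close> leaves one that
  kills \<open>\<tau>\<close>, hence everything.\<close>

lemma differential_vanishes_iff:
  assumes t: "t \<in> V"
  shows "differential_vanishes_at X t p \<longleftrightarrow> dx t / dx \<tau> \<in> M"
proof
  have zM: "0 \<in> M"
    using M_loc pl.P_loc_max[OF pl.zero_P] by simp
  define D where "D \<phi> = dx \<phi> / dx \<tau>" for \<phi>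
  have "tangent_vector X p D"
    unfolding tangent_vector_def
  proof (intro conjI ballI allI)
    fix \<phi> \<psi>
    show "D (\<phi> + \<psi>) - (D \<phi> + D \<psi>) \<in> M"
      using zM by (simp add: D_def dx_add add_divide_distrib)
    show "D (\<phi> * \<psi>) - (\<phi> * D \<psi> + \<psi> * D \<phi>) \<in> M"
      using zM by (simp add: D_def dx_mult add_divide_distrib)
  next
    fix c show "D (emb X c) \<in> M"
      using zM by (simp add: D_def dx_const)
  qed (simp add: D_def taylor_nth_1_integral)
  moreover assume "differential_vanishes_at X t p"
  ultimately have "D t \<in> M"
    by (simp add: differential_vanishes_at_def)
  then show "dx t / dx \<tau> \<in> M" by (simp add: D_def)
next
  assume Dt: "dx t / dx \<tau> \<in> M"
  define D where "D \<phi> = dx \<phi> / dx \<tau>" for \<phi>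
  have D_V: "D \<phi> \<in> V" if "\<phi> \<in> V" for \<phi>
    using taylor_nth_1_integral[OF that] by (simp add: D_def)
  have D_add: "D (\<phi> + \<psi>) = D \<phi> + D \<psi>" for \<phi> \<psi>
    by (simp add: D_def dx_add add_divide_distrib)
  have D_mult: "D (\<phi> * \<psi>) = \<phi> * D \<psi> + \<psi> * D \<phi>" for \<phi> \<psi>
    by (simp add: D_def dx_mult add_divide_distrib)
  have D_const: "D (emb X c) = 0" for c
    by (simp add: D_def dx_const)
  have D_\<tau>: "D \<tau> = 1"
    using dx_\<tau> by (simp add: D_def)
  show "differential_vanishes_at X t p"
    unfolding differential_vanishes_at_def
  proof (intro allI impI)
    fix v' assume v': "tangent_vector X p v'"
    have v'V: "v' \<phi> \<in> V" if "\<phi> \<in> V" for \<phi>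
      using v' that by (simp add: tangent_vector_def)
    define \<delta> where "\<delta> \<phi> = v' \<phi> - v' \<tau> * D \<phi>" for \<phi>
    have "\<delta> t \<in> M"
    proof (rule tangent_vanishing[OF _ _ _ _ _ t])
      show "\<delta> \<phi> \<in> V" if "\<phi> \<in> V" for \<phi>
        unfolding \<delta>_def using that by (intro V.diff_mem V.mult_mem v'V \<tau>_V D_V)
      show "\<delta> (\<phi> + \<psi>) - (\<delta> \<phi> + \<delta> \<psi>) \<in> M" if "\<phi> \<in> V" "\<psi> \<in> V" for \<phi> \<psi>
      proof -
        have "\<delta> (\<phi> + \<psi>) - (\<delta> \<phi> + \<delta> \<psi>) = v' (\<phi> + \<psi>) - (v' \<phi> + v' \<psi>)"
          by (simp add: \<delta>_def D_add algebra_simps)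
        then show ?thesis using v' that by (simp add: tangent_vector_def)
      qed
      show "\<delta> (\<phi> * \<psi>) - (\<phi> * \<delta> \<psi> + \<psi> * \<delta> \<phi>) \<in> M" if "\<phi> \<in> V" "\<psi> \<in> V" for \<phi> \<psi>
      proof -
        have "\<delta> (\<phi> * \<psi>) - (\<phi> * \<delta> \<psi> + \<psi> * \<delta> \<phi>) = v' (\<phi> * \<psi>) - (\<phi> * v' \<psi> + \<psi> * v' \<phi>)"
          by (simp add: \<delta>_def D_mult algebra_simps)
        then show ?thesis using v' that by (simp add: tangent_vector_def)
      qed
      show "\<delta> (emb X c) \<in> M" for c
        using v' by (simp add: \<delta>_def D_const tangent_vector_def)
      show "\<delta> \<tau> \<in> M"
        using M_diff[OF M_mult M_mult] M_loc pl.P_loc_max[OF pl.zero_P] by (simp add: \<delta>_def D_\<tau>)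
    qed
    moreover have "v' \<tau> * D t \<in> M"
      using M_mult[OF v'V[OF \<tau>_V] Dt] by (simp add: D_def)
    ultimately have "\<delta> t + v' \<tau> * D t \<in> M"
      by (rule M_add)
    then show "v' t \<in> M" by (simp add: \<delta>_def)
  qed
qed

end

declare point_ideal.simps(2) [simp del]

context prime_localization
begin

lemma loc_unit_add: "a \<in> loc - loc_max \<Longrightarrow> b \<in> loc_max \<Longrightarrow> a + b \<in> loc - loc_max"
proof -
  assume a: "a \<in> loc - loc_max" and b: "b \<in> loc_max"
  interpret loc: field_subring loc by (rule loc_subring)
  have "- b \<in> loc_max"
    using loc_max_mult[of "- 1" b] b loc.uminus_mem[OF loc.one_mem] by simp
  then have "a + b \<notin> loc_max"
    using loc_max_add[of "a + b" "- b"] a by auto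
  then show ?thesis
    using a b loc_max_sub loc.add_mem by blast
qed

end

context hyperelliptic
begin

subsection \<open>Points of the affine model\<close>

context
  fixes P assumes maxP: "maximalideal P (subring_record A)"
begin

lemma affine_localization: "prime_localization A P"
  by (rule A.maximal_prime_localization[OF maxP])

interpretation pl: prime_localization A P
  by (rule affine_localization)

text \<open>If zero were a maximal ideal, \<open>x\<close> would be invertible in \<open>A\<close>;
  constant terms in \<open>1 = x * a\<close> exclude this.\<close>

lemma affine_nonzero_mem: "\<exists>a\<in>P. a \<noteq> 0"
proof (rule ccontr)
  assume "\<not> (\<exists>a\<in>P. a \<noteq> 0)"
  then have P: "P = {0}" using pl.zero_P by auto
  let ?I = "{x * a | a. a \<in> A}"
  have "?I = P \<or> ?I = A"
  proof (rule A.maximal_record_max[OF maxP])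
    show "?I \<subseteq> A" using A.mult_mem[OF A_x] by auto
    show "0 \<in> ?I" using A.zero_mem by force
    fix a b assume "a \<in> ?I" "b \<in> ?I"
    then show "a + b \<in> ?I" using A.add_mem by (auto simp flip: distrib_left)
  next
    fix c a assume "c \<in> A" "a \<in> ?I"
    then show "c * a \<in> ?I" using A.mult_mem by (auto simp: mult.left_commute)
  next
    show "P \<subseteq> ?I" using P A.zero_mem by force
  qed
  moreover have "x \<in> ?I" using A.one_mem by force
  ultimately have "?I = A" using P x_nz by auto
  then have "1 \<in> ?I" using A.one_mem by (simp only:)
  then obtain a where a: "a \<in> A" "1 = x * a" by blast
  obtain q r where "a = pv q x + pv r x * y" using A_elim[OF a(1)] .
  then have "pv (1 - pCons 0 q) x + pv (- pCons 0 r) x * y = 0"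
    using a(2) by (simp add: pv_diff pv_uminus algebra_simps)
  then have "1 = pCons 0 q"
    using repr_zero(1) by fastforce
  then have "coeff (1 :: 'a poly) 0 = 0"
    by (metis coeff_pCons_0)
  then show False by simp
qed

text \<open>The contraction of \<open>P\<close> to \<open>F[x]\<close> is nonzero, since it contains
  the norm of any nonzero element of \<open>P\<close>; a nonzero polynomial of least degree
  generates it.\<close>

lemma affine_min_poly: "\<exists>\<pi>. 0 < degree \<pi> \<and> (\<forall>q. pv q x \<in> P \<longleftrightarrow> \<pi> dvd q)"
proof -
  let ?S = "\<lambda>q. q \<noteq> 0 \<and> pv q x \<in> P"
  obtain a where a: "a \<in> P" "a \<noteq> 0" using affine_nonzero_mem by blast
  then obtain q r where qr: "a = pv q x + pv r x * y"
    using A_elim pl.sub by blast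
  have "(pv q x + pv (- r) x * y) * a \<in> P"
    by (rule pl.mult_P[OF A_intro a(1)])
  then have "pv (q\<^sup>2 - r\<^sup>2 * f) x \<in> P"
    using norm_eq[of q r] by (simp add: qr pv_uminus mult.commute)
  then have "?S (q\<^sup>2 - r\<^sup>2 * f)"
    using norm_nz a(2) qr by blast
  then obtain \<pi> where \<pi>: "?S \<pi>" "\<And>q. ?S q \<Longrightarrow> degree \<pi> \<le> degree q"
    using ex_has_least_nat[of ?S _ degree] by blast
  have dvd: "\<pi> dvd q" if q: "pv q x \<in> P" for q
  proof (rule ccontr)
    assume "\<not> \<pi> dvd q"
    then have nz: "q mod \<pi> \<noteq> 0" by (simp add: mod_eq_0_iff_dvd)
    have "pv (q mod \<pi>) x = pv q x - pv (q div \<pi>) x * pv \<pi> x"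
      by (simp add: pv_mult[symmetric] pv_diff[symmetric] minus_div_mult_eq_mod)
    also have "\<dots> \<in> P"
      using \<pi>(1) by (intro pl.diff_P pl.mult_P q A_poly) auto
    finally have "degree \<pi> \<le> degree (q mod \<pi>)"
      using \<pi>(2) nz by blast
    then show False
      using degree_mod_less[of \<pi> q] \<pi>(1) nz by simp
  qed
  have mem: "pv q x \<in> P" if "\<pi> dvd q" for q
    using that \<pi>(1) by (auto simp: dvd_def pv_mult mult.commute intro: pl.mult_P[OF A_poly])
  have "degree \<pi> \<noteq> 0"
  proof
    assume "degree \<pi> = 0"
    then have "\<pi> dvd 1"
      using \<pi>(1) by (simp add: is_unit_iff_degree)
    then show False using mem[of 1] pl.one_P by simp
  qed
  then show ?thesis using dvd mem by blast
qed

text \<open>Otherwise \<open>f\<close> and \<open>f'\<close> would have the generator of the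
  contraction of \<open>P\<close> to \<open>F[x]\<close> as a common factor of positive
  degree.\<close>

lemma affine_smooth: "y \<in> P \<Longrightarrow> pv (pderiv f) x \<notin> P"
proof
  assume "y \<in> P" "pv (pderiv f) x \<in> P"
  moreover have "pv f x \<in> P"
    using pl.mult_P[OF A_y \<open>y \<in> P\<close>] y_square by (simp add: power2_eq_square)
  moreover obtain \<pi> where \<pi>: "0 < degree \<pi>" "\<And>q. pv q x \<in> P \<longleftrightarrow> \<pi> dvd q"
    using affine_min_poly by blast
  ultimately have "is_unit \<pi>"
    using coprime_common_divisor[OF coprime_f] by blast
  then show False using \<pi>(1) by (metis degree_0 is_unit_iff_degree not_less0)
qed

lemma affine_chart: "chart_point X (Affine P) x y f"
proof (intro chart_point.intro chart_point_axioms.intro hyperelliptic_axioms)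
  show "prime_localization (chart_ring X (Affine P)) (point_ideal X (Affine P))"
    using affine_localization by simp
qed (use affine_smooth y_square dx_x in \<open>auto simp: affine_ring_def\<close>)

text \<open>At zeros of \<open>y\<close> the uniformizer is prescribed, since the order computations
  start from \<open>y\<close> having order 1. Elsewhere the cover is unramified, and the generator
  of the contraction of \<open>P\<close> to \<open>F[x]\<close> remains a uniformizer.\<close>

lemma affine_valuation:
  "\<exists>\<rho>. valuation_subring (LR (Affine P)) (LM (Affine P)) \<rho> \<and> (y \<in> P \<longrightarrow> \<rho> = y)"
proof -
  obtain \<pi> where \<pi>: "0 < degree \<pi>" "\<And>q. pv q x \<in> P \<longleftrightarrow> \<pi> dvd q"
    using affine_min_poly by blast
  interpret loc: field_subring pl.loc by (rule pl.loc_subring)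
  define \<rho> where "\<rho> = (if y \<in> P then y else pv \<pi> x)"
  have \<pi>P: "pv \<pi> x \<in> P" using \<pi>(2) by simp
  have \<pi>_nz: "\<pi> \<noteq> 0" using \<pi>(1) by auto
  have \<rho>: "\<rho> \<in> P" "\<rho> \<noteq> 0"
    using \<pi>P y_nz pv_x_nz[OF \<pi>_nz] by (auto simp: \<rho>_def)
  \<comment> \<open>If \<open>y\<close> vanishes then \<open>f = \<pi> * k\<close>, and separability
    keeps \<open>k\<close> out of \<open>P\<close>; hence \<open>\<pi>(x)\<close> is a unit times
    \<open>y^2\<close>.\<close>
  have \<pi>_power: "\<exists>e j. e \<in> pl.loc - pl.loc_max \<and> pv \<pi> x = e * \<rho> ^ j"
  proof (cases "y \<in> P")
    case True
    have "pv f x \<in> P"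
      using pl.mult_P[OF A_y True] y_square by (simp add: power2_eq_square)
    then obtain k where k: "f = \<pi> * k"
      using \<pi>(2) by blast
    have kP: "pv k x \<notin> P"
    proof
      assume "pv k x \<in> P"
      moreover have "pv (pderiv f) x = pv (pderiv k) x * pv \<pi> x + pv (pderiv \<pi>) x * pv k x"
        by (simp add: k pderiv_mult pv_add pv_mult algebra_simps)
      ultimately have "pv (pderiv f) x \<in> P"
        using \<pi>P by (auto intro!: pl.add_P pl.mult_P[OF A_poly])
      then show False using affine_smooth True by blast
    qed
    then have "pv k x \<noteq> 0" using pl.zero_P by auto
    then have "pv \<pi> x = inverse (pv k x) * y ^ 2"
      by (simp add: y_square k pv_mult field_simps)
    then show ?thesis
      using True pl.loc_unit_inverse[OF pl.loc_unit_I[OF A_poly kP]] by (auto simp: \<rho>_def)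
  next
    case False
    then have "1 \<in> pl.loc - pl.loc_max \<and> pv \<pi> x = 1 * \<rho> ^ 1"
      using loc.one_mem pl.one_loc_max by (simp add: \<rho>_def)
    then show ?thesis by blast
  qed
  have poly_power: "\<exists>e j. e \<in> pl.loc - pl.loc_max \<and> pv q x = e * \<rho> ^ j" if "q \<noteq> 0" for q
    using that
  proof (induction "degree q" arbitrary: q rule: less_induct)
    case less
    show ?case
    proof (cases "pv q x \<in> P")
      case False
      then have "pv q x \<in> pl.loc - pl.loc_max \<and> pv q x = pv q x * \<rho> ^ 0"
        using pl.loc_unit_I[OF A_poly] by simp
      then show ?thesis by blast
    next
      case True
      then obtain k where k: "q = \<pi> * k" using \<pi>(2) by blast
      then have k_nz: "k \<noteq> 0" using less.prems by auto
      have "degree q = degree \<pi> + degree k"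
        unfolding k by (rule degree_mult_eq[OF \<pi>_nz k_nz])
      then obtain e j where ej: "e \<in> pl.loc - pl.loc_max" "pv k x = e * \<rho> ^ j"
        using less.hyps[of k] k_nz \<pi>(1) by auto
      obtain e' j' where ej': "e' \<in> pl.loc - pl.loc_max" "pv \<pi> x = e' * \<rho> ^ j'"
        using \<pi>_power by blast
      have "pv q x = (e' * e) * \<rho> ^ (j' + j)"
        by (simp add: k pv_mult ej ej' power_add mult_ac)
      then show ?thesis
        using pl.loc_unit_mult[OF ej'(1) ej(1)] by blast
    qed
  qed
  have P_unif: "\<exists>b\<in>pl.loc. a = \<rho> * b" if a: "a \<in> P" for a
  proof -
    obtain q r where qr: "a = pv q x + pv r x * y"
      using A_elim a pl.sub by blast
    show ?thesis
    proof (cases "y \<in> P")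
      case True
      have "pv q x = a - pv r x * y" by (simp add: qr)
      also have "\<dots> \<in> P"
        using True a by (intro pl.diff_P pl.mult_P A_poly)
      finally obtain k where k: "q = \<pi> * k" using \<pi>(2) by blast
      obtain e j where ej: "e \<in> pl.loc - pl.loc_max" "pv \<pi> x = e * \<rho> ^ j"
        using \<pi>_power by blast
      have "j \<noteq> 0"
        using ej pl.P_loc_max[OF \<pi>P] by (cases "j = 0") auto
      then obtain i where i: "j = Suc i" using not0_implies_Suc by blast
      have "a = \<rho> * (e * \<rho> ^ i * pv k x + pv r x)"
        using True by (simp add: qr k pv_mult ej(2) i \<rho>_def algebra_simps)
      moreover have "e * \<rho> ^ i * pv k x + pv r x \<in> pl.loc"
        using ej(1) pl.R_loc[of \<rho>] \<rho>(1) pl.sub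
        by (intro loc.add_mem loc.mult_mem loc.power_mem pl.R_loc[OF A_poly]) auto
      ultimately show ?thesis by blast
    next
      case False
      then have \<rho>\<pi>: "\<rho> = pv \<pi> x" by (simp add: \<rho>_def)
      \<comment> \<open>The conjugate of \<open>a\<close>. If it lies in \<open>P\<close> too, half
        the sum shows that \<open>\<pi>\<close> divides \<open>q\<close>, and then it divides
        \<open>r\<close>, as \<open>y\<close> is not in \<open>P\<close>. If not, it is a unit, and
        \<open>a\<close> is the norm divided by it.\<close>
      let ?a = "pv q x + pv (- r) x * y"
      show ?thesis
      proof (cases "?a \<in> P")
        case True
        have "emb X (inverse 2) * (a + ?a) \<in> P"
          by (intro pl.mult_P pl.add_P A_const a True)
        moreover have "emb X (inverse 2) * (a + ?a) = pv q x"
        proof -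
          have "emb X (inverse 2) * 2 = 1"
            by (metis emb.hom_add emb.hom_mult emb.hom_one left_inverse one_add_one two_nz)
          then show ?thesis
            by (simp add: qr pv_uminus mult.assoc[symmetric] flip: mult_2)
        qed
        ultimately have qP: "pv q x \<in> P" by simp
        have "pv r x * y = a - pv q x" by (simp add: qr)
        also have "\<dots> \<in> P" by (rule pl.diff_P[OF a qP])
        finally have rP: "pv r x \<in> P"
          using pl.prime_P[OF A_poly A_y] False by blast
        obtain k k' where "q = \<pi> * k" "r = \<pi> * k'"
          using qP rP \<pi>(2) by (meson dvdE)
        then have "a = \<rho> * (pv k x + pv k' x * y)"
          by (simp add: qr pv_mult \<rho>\<pi> algebra_simps)
        then show ?thesis using pl.R_loc[OF A_intro] by blast
      next
        case aP: False
        have na: "?a * a = pv (q\<^sup>2 - r\<^sup>2 * f) x"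
          using norm_eq[of q r] by (simp add: qr pv_uminus mult.commute)
        have "?a * a \<in> P" by (rule pl.mult_P[OF A_intro a])
        then obtain k where "q\<^sup>2 - r\<^sup>2 * f = \<pi> * k"
          unfolding na using \<pi>(2) by blast
        then have "?a * a = \<rho> * pv k x"
          using na by (simp add: pv_mult \<rho>\<pi>)
        moreover have u: "?a \<in> pl.loc - pl.loc_max"
          by (rule pl.loc_unit_I[OF A_intro aP])
        moreover have "?a \<noteq> 0" using aP pl.zero_P by auto
        ultimately have "a = \<rho> * (inverse ?a * pv k x)"
          by (simp add: field_simps)
        moreover have "inverse ?a * pv k x \<in> pl.loc"
          using pl.loc_unit_inverse[OF u] by (intro loc.mult_mem pl.R_loc[OF A_poly]) auto
        ultimately show ?thesis by blast
      qed
    qed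
  qed
  have "valuation_subring pl.loc pl.loc_max \<rho>"
  proof (rule pl.valuation_subringI)
    show "pl.loc_max \<subseteq> {\<rho> * a | a. a \<in> pl.loc}"
    proof
      fix \<phi> assume "\<phi> \<in> pl.loc_max"
      then obtain a b where ab: "\<phi> = a / b" "a \<in> P" "b \<in> A - P"
        by (auto simp: pl.loc_max_def)
      then obtain c where c: "c \<in> pl.loc" "a = \<rho> * c"
        using P_unif by blast
      have "inverse b \<in> pl.loc"
        using pl.loc_unit_inverse[OF pl.loc_unit_I[of b]] ab by blast
      then have "c * inverse b \<in> pl.loc"
        using c by (intro loc.mult_mem)
      moreover have "\<phi> = \<rho> * (c * inverse b)"
        by (simp add: ab c divide_inverse)
      ultimately show "\<phi> \<in> {\<rho> * a | a. a \<in> pl.loc}" by blast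
    qed
    show "\<rho> \<in> pl.loc_max" "\<rho> \<noteq> 0"
      using \<rho> pl.P_loc_max by auto
    fix a assume a: "a \<in> A" "a \<noteq> 0"
    obtain q r where qr: "a = pv q x + pv r x * y" using A_elim[OF a(1)] .
    obtain e j where ej: "e \<in> pl.loc - pl.loc_max" "pv (q\<^sup>2 - r\<^sup>2 * f) x = e * \<rho> ^ j"
      using poly_power norm_nz a(2) qr by blast
    show "\<exists>e i. e \<in> pl.loc - pl.loc_max \<and> a = e * \<rho> ^ i"
    \<comment> \<open>\<open>a\<close> divides its norm, a polynomial in \<open>x\<close>, for which
      the factorization is known.\<close>
    proof (rule pl.factor_unit_times_power)
      show "pl.loc_max = {\<rho> * a | a. a \<in> pl.loc}"
        using \<open>pl.loc_max \<subseteq> _\<close> pl.loc_max_mult \<open>\<rho> \<in> pl.loc_max\<close> by (auto simp: mult.commute)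
      show "a \<in> pl.loc" by (rule pl.R_loc[OF a(1)])
      show "pv q x + pv (- r) x * y \<in> pl.loc" by (rule pl.R_loc[OF A_intro])
      show "a * (pv q x + pv (- r) x * y) = e * \<rho> ^ j"
        using norm_eq[of q r] ej(2) by (simp add: qr pv_uminus)
    qed (use \<rho> ej in auto)
  qed (rule fraction)
  moreover have "LR (Affine P) = pl.loc" "LM (Affine P) = pl.loc_max"
    by (simp_all add: local_ring_def max_ideal_def pl.loc_def pl.loc_max_def)
  ultimately show ?thesis by (auto simp: \<rho>_def)
qed

end

subsection \<open>The point at infinity\<close>

interpretation pinf: prime_localization B Pinf
  by (rule Pinf_localization)

lemma pv_u_Pinf: "pv q u \<in> Pinf \<longleftrightarrow> coeff q 0 = 0"
  using Pinf_iff[of q 0] by simp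

lemma B_poly: "pv q u \<in> B" and B_u: "u \<in> B" and B_v: "v \<in> B"
  unfolding infinity_ring_def by (rule double_cover_poly double_cover_z double_cover_w)+

lemma v_Pinf: "v \<in> Pinf"
  using Pinf_iff[of 0 1] by simp

lemma dx_u: "dx u = - 1 / x\<^sup>2"
  using dx_inverse[OF x_nz] by (simp add: u_fun_def dx_x inverse_eq_divide)

lemma hinf_smooth: "pv (pderiv hinf) u \<notin> Pinf"
proof -
  have "coeff (pderiv hinf) 0 = lead_coeff f"
    by (simp add: coeff_pderiv hinf_def)
  then show ?thesis
    using f_nz by (simp add: pv_u_Pinf)
qed

lemma infinity_chart: "chart_point X Infinity u v hinf"
proof (intro chart_point.intro chart_point_axioms.intro hyperelliptic_axioms)
  show "prime_localization (chart_ring X Infinity) (point_ideal X Infinity)"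
    using Pinf_localization by simp
  show "v \<notin> Pinf \<or> pv (pderiv hinf) u \<notin> Pinf"
    using hinf_smooth by blast
  show "dx u \<noteq> 0"
    using x_nz by (simp add: dx_u)
qed (simp_all add: v_square infinity_ring_def)

text \<open>Powers of \<open>u\<close> cancel the poles of \<open>x\<close> and \<open>y\<close>
  along \<open>u = 0\<close>, so the second chart has the same fraction field.\<close>

lemma infinity_fraction: "\<exists>a\<in>B. \<exists>b\<in>B. b \<noteq> 0 \<and> \<phi> = a / b"
proof -
  have clear: "\<exists>N. a * u ^ N \<in> B" if a_A: "a \<in> A" for a
  proof -
    obtain q r where a: "a = pv q x + pv r x * y" using A_elim[OF a_A] .
    let ?m = "degree q" and ?n = "degree r + (genus X + 1)"
    have xu: "x ^ i * u ^ i = 1" for i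
      using x_nz by (simp add: u_fun_def flip: power_mult_distrib)
    have "a * u ^ (?m + ?n) = pv (reflect_poly q) u * (x ^ ?m * u ^ ?m) * u ^ ?n +
        pv (reflect_poly r) u * v * (x ^ ?n * u ^ ?n) * u ^ ?m"
      unfolding a pv_x_reflect[of q] pv_x_reflect[of r] y_v power_add by (simp add: algebra_simps)
    also have "\<dots> \<in> B"
      unfolding xu by (intro B.add_mem B.mult_mem B_poly B_v B.power_mem B_u B.one_mem)
    finally show ?thesis by blast
  qed
  obtain a b where ab: "a \<in> A" "b \<in> A" "b \<noteq> 0" "\<phi> = a / b"
    using fraction by blast
  obtain N N' where N: "a * u ^ N \<in> B" "b * u ^ N' \<in> B"
    using clear ab by metis
  have "(a * u ^ N) * u ^ N' \<in> B" "(b * u ^ N') * u ^ N \<in> B"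
    using N by (auto intro: B.mult_mem B.power_mem B_u)
  moreover have "\<phi> = ((a * u ^ N) * u ^ N') / ((b * u ^ N') * u ^ N)"
    using u_nz by (simp add: ab)
  ultimately show ?thesis
    using ab(3) u_nz by (metis mult_eq_0_iff power_not_zero)
qed

lemma infinity_u: "\<exists>e. e \<in> pinf.loc - pinf.loc_max \<and> u = e * v ^ 2"
proof -
  let ?R = "pv (reflect_poly f) u"
  have "?R \<notin> Pinf"
    using f_nz by (simp add: pv_u_Pinf)
  then have R: "?R \<in> pinf.loc - pinf.loc_max" "?R \<noteq> 0"
    using pinf.loc_unit_I[OF B_poly] pinf.zero_P by auto
  have "v ^ 2 = u * ?R"
    by (simp add: v_square hinf_def)
  then have "u = inverse ?R * v ^ 2"
    using R(2) by (simp add: field_simps)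
  then show ?thesis using pinf.loc_unit_inverse[OF R(1)] by blast
qed

text \<open>A nonzero polynomial in \<open>u\<close> is a unit times an even power of
  \<open>v\<close>, so in \<open>q(u) + r(u) v\<close> the two terms have different orders and
  cannot cancel.\<close>

lemma infinity_valuation: "valuation_subring (LR Infinity) (LM Infinity) v"
proof -
  interpret loc: field_subring pinf.loc by (rule pinf.loc_subring)
  obtain e0 where e0: "e0 \<in> pinf.loc - pinf.loc_max" "u = e0 * v ^ 2"
    using infinity_u by blast
  have v_max: "v \<in> pinf.loc_max" by (rule pinf.P_loc_max[OF v_Pinf])
  have v_loc: "v \<in> pinf.loc" using v_max pinf.loc_max_sub by blast
  have poly_power: "\<exists>e k. e \<in> pinf.loc - pinf.loc_max \<and> pv q u = e * v ^ (2 * k)" if "q \<noteq> 0" for q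
    using that
  proof (induction q)
    case (pCons c q)
    show ?case
    proof (cases "c = 0")
      case False
      then have "pv (pCons c q) u \<in> pinf.loc - pinf.loc_max"
        by (intro pinf.loc_unit_I B_poly) (simp add: pv_u_Pinf del: pv_pCons)
      then show ?thesis
        by (intro exI[of _ "pv (pCons c q) u"] exI[of _ 0]) simp
    next
      case True
      then obtain e k where ek: "e \<in> pinf.loc - pinf.loc_max" "pv q u = e * v ^ (2 * k)"
        using pCons by auto
      have "pv (pCons c q) u = u * pv q u"
        using True by simp
      also have "\<dots> = (e0 * e) * v ^ (2 * Suc k)"
        unfolding ek(2) by (subst e0(2)) (simp add: power2_eq_square)
      finally show ?thesis
        using pinf.loc_unit_mult[OF e0(1) ek(1)] by blast
    qed
  qed simp
  have mono: "\<exists>d. d \<in> pinf.loc - pinf.loc_max \<and> e * v ^ i + e' * v ^ j = d * v ^ i"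
    if "e \<in> pinf.loc - pinf.loc_max" "e' \<in> pinf.loc" and ij: "i < j" for e e' i j
  proof -
    obtain k where k: "j = i + Suc k"
      using less_imp_Suc_add[OF ij] by auto
    have "e' * v ^ k * v \<in> pinf.loc_max"
      using that by (intro pinf.loc_max_mult v_max loc.mult_mem loc.power_mem v_loc)
    then have "e + e' * v ^ k * v \<in> pinf.loc - pinf.loc_max"
      by (rule pinf.loc_unit_add[OF that(1)])
    moreover have "e * v ^ i + e' * v ^ j = (e + e' * v ^ k * v) * v ^ i"
      by (simp add: k power_add algebra_simps)
    ultimately show ?thesis by blast
  qed
  have "valuation_subring pinf.loc pinf.loc_max v"
  proof (rule pinf.valuation_subringI)
    show "pinf.loc_max \<subseteq> {v * a | a. a \<in> pinf.loc}"
    proof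
      fix \<phi> assume "\<phi> \<in> pinf.loc_max"
      then obtain a b where ab: "\<phi> = a / b" "a \<in> Pinf" "b \<in> B - Pinf"
        by (auto simp: pinf.loc_max_def)
      then obtain c d where cd: "c \<in> B" "d \<in> B" "a = u * c + v * d"
        by (auto simp: point_ideal.simps(2))
      have "inverse b \<in> pinf.loc"
        using pinf.loc_unit_inverse[OF pinf.loc_unit_I[of b]] ab by blast
      then have "(e0 * v * c + d) * inverse b \<in> pinf.loc"
        using e0 cd v_loc pinf.R_loc by (intro loc.mult_mem loc.add_mem) auto
      moreover have "\<phi> = v * ((e0 * v * c + d) * inverse b)"
        unfolding ab cd(3) by (subst e0(2)) (simp add: divide_inverse power2_eq_square algebra_simps)
      ultimately show "\<phi> \<in> {v * a | a. a \<in> pinf.loc}" by blast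
    qed
    fix a assume a: "a \<in> B" "a \<noteq> 0"
    obtain q r where qr: "a = pv q u + pv r u * v" using B_elim[OF a(1)] .
    show "\<exists>e i. e \<in> pinf.loc - pinf.loc_max \<and> a = e * v ^ i"
    proof (cases "q = 0")
      case True
      then have "r \<noteq> 0" using a qr by auto
      then obtain e k where "e \<in> pinf.loc - pinf.loc_max" "pv r u = e * v ^ (2 * k)"
        using poly_power by blast
      then show ?thesis
        using True qr by (intro exI[of _ e] exI[of _ "Suc (2 * k)"]) simp
    next
      case q: False
      obtain e k where ek: "e \<in> pinf.loc - pinf.loc_max" "pv q u = e * v ^ (2 * k)"
        using poly_power[OF q] by blast
      show ?thesis
      proof (cases "r = 0")
        case True
        then show ?thesis using ek qr by auto
      next
        case False
        then obtain e' k' where ek': "e' \<in> pinf.loc - pinf.loc_max" "pv r u = e' * v ^ (2 * k')"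
          using poly_power by blast
        have a: "a = e * v ^ (2 * k) + e' * v ^ Suc (2 * k')"
          by (simp add: qr ek ek')
        have "2 * k < Suc (2 * k') \<or> Suc (2 * k') < 2 * k" by presburger
        then show ?thesis
          using mono[OF ek(1), of e' "2 * k" "Suc (2 * k')"] mono[OF ek'(1), of e "Suc (2 * k')" "2 * k"]
            ek ek' a by (auto simp only: add.commute Diff_iff)
      qed
    qed
  qed (rule v_max v_nz infinity_fraction)+
  moreover have "LR Infinity = pinf.loc" "LM Infinity = pinf.loc_max"
    by (simp_all add: local_ring_def max_ideal_def pinf.loc_def pinf.loc_max_def)
  ultimately show ?thesis by simp
qed

subsection \<open>Uniform description of the closed points\<close>

text \<open>An etale coordinate at each point. Taking \<open>x\<close> wherever possible makes
  etaleness of another function there a condition on \<open>dx t\<close> alone.\<close>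

fun coord :: "'k closed_point \<Rightarrow> 'k" where
  "coord (Affine P) = (if y \<in> P then y else x)"
| "coord Infinity = v"

lemma point_chart:
  assumes "p \<in> closed_points X"
  obtains z w h where "chart_point X p z w h" and "chart_point.\<tau> X p z w = coord p"
proof (cases p)
  case (Affine P)
  then have "maximalideal P (subring_record A)"
    using assms by (auto simp: closed_points_def)
  then have "chart_point X p x y f"
    using affine_chart Affine by simp
  then show ?thesis
    using that Affine by (simp add: chart_point.\<tau>_def)
next
  case Infinity
  then have "chart_point X p u v hinf"
    using infinity_chart by simp
  then show ?thesis
    using that Infinity v_Pinf by (simp add: chart_point.\<tau>_def)
qed

end

locale curve_point = hyperelliptic X
  for X :: "('a::field, 'k::field) hyp_curve" +
  fixes p :: "'k closed_point"
  assumes closed: "p \<in> closed_points X"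
begin

text \<open>At zeros of \<open>y\<close> and at infinity the choice is pinned to \<open>y\<close>
  and \<open>v\<close>, whose orders enter the final count.\<close>

definition unif :: 'k where
  "unif = (SOME \<rho>. valuation_subring (LR p) (LM p) \<rho> \<and>
     (case p of Affine P \<Rightarrow> y \<in> P \<longrightarrow> \<rho> = y | Infinity \<Rightarrow> \<rho> = v))"

lemma unif_props:
  "valuation_subring (LR p) (LM p) unif \<and>
     (case p of Affine P \<Rightarrow> y \<in> P \<longrightarrow> unif = y | Infinity \<Rightarrow> unif = v)"
  unfolding unif_def
proof (rule someI_ex, cases p)
  case (Affine P)
  then have "maximalideal P (subring_record A)"
    using closed by (auto simp: closed_points_def)
  then show "\<exists>\<rho>. valuation_subring (LR p) (LM p) \<rho> \<and>
     (case p of Affine P \<Rightarrow> y \<in> P \<longrightarrow> \<rho> = y | Infinity \<Rightarrow> \<rho> = v)"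
    using affine_valuation Affine by simp
next
  case Infinity
  then show "\<exists>\<rho>. valuation_subring (LR p) (LM p) \<rho> \<and>
     (case p of Affine P \<Rightarrow> y \<in> P \<longrightarrow> \<rho> = y | Infinity \<Rightarrow> \<rho> = v)"
    using infinity_valuation by auto
qed

sublocale V: valuation_subring "LR p" "LM p" unif
  using unif_props by blast

lemma ord_at_eq: "ord_at X p = V.ord"
  by (rule ext) (simp add: ord_at_def V.ord_def)

lemma
  shows dx_coord: "dx (coord p) \<noteq> 0"
    and coord_mem: "coord p \<in> LR p"
    and const_mem: "emb X c \<in> LR p"
    and taylor_coord_integral: "\<phi> \<in> LR p \<Longrightarrow> taylor_at (coord p) \<phi> \<in> fps_over (LR p)"
    and deriv_coord_mem: "\<phi> \<in> LR p \<Longrightarrow> dx \<phi> / dx (coord p) \<in> LR p"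
    and differential_vanishes_iff:
      "t \<in> LR p \<Longrightarrow> differential_vanishes_at X t p \<longleftrightarrow> dx t / dx (coord p) \<in> LM p"
proof -
  obtain z w h where c: "chart_point X p z w h" "chart_point.\<tau> X p z w = coord p"
    using point_chart[OF closed] .
  interpret c: chart_point X p z w h by (rule c)
  note facts = c.dx_\<tau> c.\<tau>_V c.const_V c.taylor_integral c.taylor_nth_1_integral
    c.differential_vanishes_iff
  show "dx (coord p) \<noteq> 0" "coord p \<in> LR p" "emb X c \<in> LR p"
    "\<phi> \<in> LR p \<Longrightarrow> taylor_at (coord p) \<phi> \<in> fps_over (LR p)"
    "\<phi> \<in> LR p \<Longrightarrow> dx \<phi> / dx (coord p) \<in> LR p"
    "t \<in> LR p \<Longrightarrow> differential_vanishes_at X t p \<longleftrightarrow> dx t / dx (coord p) \<in> LM p"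
    using facts unfolding c(2) by blast+
qed

lemma pv_mem: "t \<in> LR p \<Longrightarrow> pv q t \<in> LR p"
  by (induction q) (simp_all add: V.zero_mem V.add_mem V.mult_mem const_mem)

lemma const_unit: "c \<noteq> 0 \<Longrightarrow> emb X c \<in> LR p - LM p"
proof -
  assume "c \<noteq> 0"
  then have "emb X c * emb X (inverse c) = 1"
    by (simp flip: emb.hom_mult)
  then show ?thesis
    using const_mem V.mult_M[OF const_mem[of "inverse c"], of "emb X c"] V.one_M
    by (auto simp: mult.commute)
qed

end

section \<open>Zeros of functions and global sections\<close>

text \<open>Zorn's lemma on the ideals above \<open>I\<close>, with properness expressed by the
  absence of 1.\<close>

lemma (in field_subring) exists_maximal_ideal:
  assumes "ideal I (subring_record R)" and "1 \<notin> I"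
  shows "\<exists>P. maximalideal P (subring_record R) \<and> I \<subseteq> P"
proof -
  let ?S = "{J. ideal J (subring_record R) \<and> I \<subseteq> J \<and> 1 \<notin> J}"
  have "\<exists>P\<in>?S. \<forall>J\<in>?S. P \<subseteq> J \<longrightarrow> J = P"
  proof (rule subset_Zorn_nonempty)
    show "?S \<noteq> {}" using assms by blast
    fix C assume C: "C \<noteq> {}" "subset.chain ?S C"
    have mem: "J \<subseteq> R \<and> 0 \<in> J \<and> (\<forall>a\<in>J. \<forall>b\<in>J. a + b \<in> J) \<and> (\<forall>c\<in>R. \<forall>a\<in>J. c * a \<in> J)"
      "I \<subseteq> J" "1 \<notin> J" if "J \<in> C" for J
      using C(2) that unfolding pred_on.chain_def ideal_record_iff[symmetric] by blast+
    have add: "a + b \<in> \<Union>C" if ab: "a \<in> \<Union>C" "b \<in> \<Union>C" for a b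
    proof -
      obtain J J' where J: "J \<in> C" "a \<in> J" "J' \<in> C" "b \<in> J'" using ab by blast
      have "J \<subseteq> J' \<or> J' \<subseteq> J"
        using C(2) J unfolding pred_on.chain_def by blast
      then show ?thesis using J mem(1) by blast
    qed
    have "ideal (\<Union>C) (subring_record R)"
      unfolding ideal_record_iff
    proof (intro conjI ballI)
      show "\<Union>C \<subseteq> R" "0 \<in> \<Union>C" using mem(1) C(1) by blast+
      show "c * a \<in> \<Union>C" if "c \<in> R" "a \<in> \<Union>C" for c a using mem(1) that by blast
    qed (rule add)
    then show "\<Union>C \<in> ?S" using mem C(1) by blast
  qed
  then obtain P where P: "P \<in> ?S" "\<forall>J\<in>?S. P \<subseteq> J \<longrightarrow> J = P"
    by (rule bexE)
  have "maximalideal P (subring_record R)"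
  proof (rule maximalidealI)
    show "ideal P (subring_record R)" using P(1) by blast
    show "carrier (subring_record R) \<noteq> P" using P(1) one_mem by auto
    fix J assume J: "ideal J (subring_record R)" "P \<subseteq> J" "J \<subseteq> carrier (subring_record R)"
    show "J = P \<or> J = carrier (subring_record R)"
    proof (cases "1 \<in> J")
      case True
      have "c \<in> J" if "c \<in> R" for c
        using J(1) True that unfolding ideal_record_iff by (metis mult.right_neutral)
      then show ?thesis using J(3) by auto
    next
      case False
      then show ?thesis using P J by blast
    qed
  qed
  then show ?thesis using P(1) by blast
qed

context hyperelliptic
begin

abbreviation "maxA P \<equiv> maximalideal P (subring_record A)"

text \<open>An element \<open>a\<close> of \<open>P\<close> outside \<open>P'\<close> has its norm
  in \<open>P'\<close>, hence its conjugate too. If the given element of \<open>P\<close> lies in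
  \<open>P'\<close>, the argument is applied to its sum with \<open>a\<close>, and the conjugate of
  \<open>a\<close> is subtracted.\<close>

lemma conjugate_mem:
  assumes P: "maxA P" and P': "maxA P'"
    and n: "\<And>q. pv q x \<in> P \<Longrightarrow> pv q x \<in> P'"
    and not_sub: "\<not> P \<subseteq> P'" and b: "pv q x + pv r x * y \<in> P"
  shows "pv q x - pv r x * y \<in> P'"
proof -
  interpret P: prime_localization A P by (rule affine_localization[OF P])
  interpret P': prime_localization A P' by (rule affine_localization[OF P'])
  have conj_A: "pv q x - pv r x * y \<in> A" for q r
    using A_intro[of q "- r"] by (simp add: pv_uminus)
  have split: "pv q x - pv r x * y \<in> P'"
    if "pv q x + pv r x * y \<in> P" "pv q x + pv r x * y \<notin> P'" for q r
  proof -
    have "(pv q x - pv r x * y) * (pv q x + pv r x * y) \<in> P"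
      by (rule P.mult_P[OF conj_A that(1)])
    then have "pv (q\<^sup>2 - r\<^sup>2 * f) x \<in> P'"
      using norm_eq[of q r] n by (simp add: mult.commute)
    then have "(pv q x + pv r x * y) * (pv q x - pv r x * y) \<in> P'"
      by (simp add: norm_eq)
    then show ?thesis
      using P'.prime_P[OF A_intro conj_A] that(2) by blast
  qed
  obtain a where a: "a \<in> P" "a \<notin> P'" using not_sub by blast
  obtain q0 r0 where a0: "a = pv q0 x + pv r0 x * y"
    using A_elim a(1) P.sub by blast
  have a': "pv q0 x - pv r0 x * y \<in> P'"
    using split a a0 by blast
  show ?thesis
  proof (cases "pv q x + pv r x * y \<in> P'")
    case False
    then show ?thesis using split b by blast
  next
    case True
    have sum: "pv (q0 + q) x + pv (r0 + r) x * y = a + (pv q x + pv r x * y)"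
      by (simp add: a0 pv_add algebra_simps)
    have "a + (pv q x + pv r x * y) \<notin> P'"
      using P'.diff_P[OF _ True, of "a + (pv q x + pv r x * y)"] a(2) by auto
    then have "pv (q0 + q) x - pv (r0 + r) x * y \<in> P'"
      using split[of "q0 + q" "r0 + r"] P.add_P[OF a(1) b] sum by simp
    then have "pv (q0 + q) x - pv (r0 + r) x * y - (pv q0 x - pv r0 x * y) \<in> P'"
      by (rule P'.diff_P[OF _ a'])
    then show ?thesis by (simp add: pv_add algebra_simps)
  qed
qed

text \<open>
  Over an irreducible polynomial there are at most two points, exchanged by \<open>y \<mapsto> - y\<close>.
\<close>

lemma finite_poly_zeros: "n \<noteq> 0 \<Longrightarrow> finite {P. maxA P \<and> pv n x \<in> P}"
proof (induction "degree n" arbitrary: n rule: less_induct)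
  case less
  let ?S = "\<lambda>n. {P. maxA P \<and> pv n x \<in> P}"
  show ?case
  proof (cases "\<exists>a b. n = a * b \<and> degree a < degree n \<and> degree b < degree n")
    case True
    then obtain a b where ab: "n = a * b" "degree a < degree n" "degree b < degree n" by blast
    then have "finite (?S a \<union> ?S b)"
      using less by auto
    moreover have "?S n \<subseteq> ?S a \<union> ?S b"
    proof
      fix P assume P: "P \<in> ?S n"
      then interpret P: prime_localization A P using affine_localization by blast
      show "P \<in> ?S a \<union> ?S b"
        using P P.prime_P[OF A_poly A_poly, of a b] by (auto simp: ab(1) pv_mult)
    qed
    ultimately show ?thesis by (rule finite_subset[rotated])
  next
    case irr: False
    \<comment> \<open>Without a factorization into smaller degrees, the generator of the contraction
      of \<open>P\<close> is an associate of \<open>n\<close>; so all points over \<open>n\<close>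
      have the same contraction to \<open>F[x]\<close>.\<close>
    have mem: "pv q x \<in> P \<longleftrightarrow> n dvd q" if P: "P \<in> ?S n" for P q
    proof -
      obtain \<pi> where \<pi>: "0 < degree \<pi>" "\<And>q. pv q x \<in> P \<longleftrightarrow> \<pi> dvd q"
        using affine_min_poly P by blast
      then obtain k where k: "n = \<pi> * k" using P by blast
      then have nz: "\<pi> \<noteq> 0" "k \<noteq> 0" using less.prems by auto
      then have deg: "degree n = degree \<pi> + degree k"
        unfolding k by (rule degree_mult_eq)
      then have "degree k = 0"
        using irr k \<pi>(1) by (metis add.right_neutral add_less_cancel_right add_0 nat_add_left_cancel_less neq0_conv)
      then have "is_unit k" using nz by (simp add: is_unit_iff_degree)
      then show ?thesis using \<pi>(2) by (simp add: k mult_unit_dvd_iff)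
    qed
    show ?thesis
    proof (cases "?S n = {}")
      case False
      then obtain P' where P': "P' \<in> ?S n" by blast
      \<comment> \<open>The image of \<open>P'\<close> under \<open>y \<mapsto> - y\<close>, the
        only candidate for a second point.\<close>
      let ?Q = "{pv q x - pv r x * y | q r. pv q x + pv r x * y \<in> P'}"
      have "P = P' \<or> P = ?Q" if P: "P \<in> ?S n" for P
      proof (cases "P = P'")
        case neq: False
        have maxs: "maxA P" "maxA P'" using P P' by auto
        interpret P: prime_localization A P by (rule affine_localization[OF maxs(1)])
        interpret P': prime_localization A P' by (rule affine_localization[OF maxs(2)])
        have sub1: "\<not> P \<subseteq> P'"
        proof
          assume "P \<subseteq> P'"
          then have "P' = P \<or> P' = A"
            using A.maximal_record_max[OF maxs(1), of P'] P'.sub P'.zero_P P'.add_P P'.mult_P by blast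
          then show False using neq P'.one_P A.one_mem by blast
        qed
        have sub2: "\<not> P' \<subseteq> P"
        proof
          assume "P' \<subseteq> P"
          then have "P = P' \<or> P = A"
            using A.maximal_record_max[OF maxs(2), of P] P.sub P.zero_P P.add_P P.mult_P by blast
          then show False using neq P.one_P A.one_mem by blast
        qed
        have "P \<subseteq> ?Q"
        proof
          fix b assume b: "b \<in> P"
          then obtain q r where qr: "b = pv q x + pv r x * y"
            using A_elim P.sub by blast
          have "pv q x - pv r x * y \<in> P'"
            using conjugate_mem[OF maxs _ sub1, of q r] mem[OF P] mem[OF P'] b qr by blast
          then show "b \<in> ?Q"
            unfolding qr by (intro CollectI exI[of _ q] exI[of _ "- r"]) (simp add: pv_uminus)
        qed
        moreover have "?Q \<subseteq> P"
          using conjugate_mem[OF maxs(2,1) _ sub2] mem[OF P] mem[OF P'] by blast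
        ultimately show ?thesis by blast
      qed simp
      then have "?S n \<subseteq> {P', ?Q}" by blast
      then show ?thesis by (rule finite_subset) simp
    next
      case True
      show ?thesis unfolding True by (rule finite.emptyI)
    qed
  qed
qed

text \<open>A zero of \<open>a\<close> is a zero of its norm, which reduces the claim to polynomials
  in \<open>x\<close>.\<close>

lemma finite_zeros:
  assumes "a \<in> A" and "a \<noteq> 0"
  shows "finite {P. maxA P \<and> a \<in> P}"
proof -
  obtain q r where qr: "a = pv q x + pv r x * y" using A_elim[OF assms(1)] .
  have "{P. maxA P \<and> a \<in> P} \<subseteq> {P. maxA P \<and> pv (q\<^sup>2 - r\<^sup>2 * f) x \<in> P}"
  proof
    fix P assume P: "P \<in> {P. maxA P \<and> a \<in> P}"
    then interpret P: prime_localization A P using affine_localization by blast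
    have "(pv q x + pv (- r) x * y) * a \<in> P"
      using P by (intro P.mult_P A_intro) auto
    then show "P \<in> {P. maxA P \<and> pv (q\<^sup>2 - r\<^sup>2 * f) x \<in> P}"
      using P norm_eq[of q r] by (simp add: qr pv_uminus mult.commute)
  qed
  then show ?thesis
    using finite_poly_zeros[OF norm_nz] assms(2) qr by (blast intro: finite_subset)
qed

lemma affine_closed: "Affine P \<in> closed_points X \<longleftrightarrow> maxA P"
  and infinity_closed: "Infinity \<in> closed_points X"
  by (auto simp: closed_points_def)

lemma affine_mem:
  assumes "maxA P" and "a \<in> A"
  shows "a \<in> LR (Affine P)" and "a \<in> LM (Affine P) \<longleftrightarrow> a \<in> P"
proof -
  interpret P: prime_localization A P by (rule affine_localization[OF assms(1)])
  have "LR (Affine P) = P.loc" "LM (Affine P) = P.loc_max"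
    by (simp_all add: local_ring_def max_ideal_def P.loc_def P.loc_max_def)
  then show "a \<in> LR (Affine P)" "a \<in> LM (Affine P) \<longleftrightarrow> a \<in> P"
    using P.R_loc P.loc_max_iff assms(2) by auto
qed

lemma curve_point_affine: "maxA P \<Longrightarrow> curve_point X (Affine P)"
  by unfold_locales (simp add: affine_closed)

lemma curve_point_infinity: "curve_point X Infinity"
  by unfold_locales (simp add: infinity_closed)

text \<open>Discarding the bad points of finitely many nonzero functions therefore leaves a cofinite
  set.\<close>

lemma finite_nonunits:
  assumes "\<phi> \<noteq> 0"
  shows "finite {P. maxA P \<and> \<phi> \<notin> LR (Affine P) - LM (Affine P)}"
proof -
  obtain a b where ab: "a \<in> A" "b \<in> A" "b \<noteq> 0" "\<phi> = a / b"
    using fraction by blast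
  have "{P. maxA P \<and> \<phi> \<notin> LR (Affine P) - LM (Affine P)} \<subseteq>
      {P. maxA P \<and> a \<in> P} \<union> {P. maxA P \<and> b \<in> P}"
  proof
    fix P assume P: "P \<in> {P. maxA P \<and> \<phi> \<notin> LR (Affine P) - LM (Affine P)}"
    then interpret p: curve_point X "Affine P" using curve_point_affine by blast
    show "P \<in> {P. maxA P \<and> a \<in> P} \<union> {P. maxA P \<and> b \<in> P}"
      using P p.V.unit_divide[of a b] affine_mem[of P] ab by auto
  qed
  then show ?thesis
    using finite_zeros[OF ab(1)] finite_zeros[OF ab(2,3)] assms ab(4)
    by (auto intro: finite_subset)
qed

text \<open>The denominators of \<open>\<phi>\<close> form an ideal of \<open>A\<close>. Were it
  proper, some maximal \<open>P\<close> would contain it, although \<open>\<phi>\<close> has a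
  denominator outside \<open>P\<close>.\<close>

lemma regular_affine:
  assumes "\<And>P. maxA P \<Longrightarrow> \<phi> \<in> LR (Affine P)"
  shows "\<phi> \<in> A"
proof -
  let ?I = "{a \<in> A. a * \<phi> \<in> A}"
  have "ideal ?I (subring_record A)"
    unfolding A.ideal_record_iff
    by (auto simp: distrib_right mult.assoc intro: A.zero_mem A.add_mem A.mult_mem)
  moreover have "1 \<in> ?I"
  proof (rule ccontr)
    assume "1 \<notin> ?I"
    then obtain P where P: "maxA P" "?I \<subseteq> P"
      using A.exists_maximal_ideal[OF calculation] by blast
    interpret P: prime_localization A P by (rule affine_localization[OF P(1)])
    obtain a b where ab: "\<phi> = a / b" "a \<in> A" "b \<in> A - P"
      using assms[OF P(1)] by (auto simp: local_ring_def)
    then have "b * \<phi> = a" using P.nonzero by auto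
    then show False using ab P(2) by auto
  qed
  ultimately show ?thesis by simp
qed

section \<open>Orders at infinity and the Riemann-Roch space\<close>

interpretation inf: curve_point X Infinity
  by (rule curve_point_infinity)

lemma unif_infinity: "inf.unif = v"
  using inf.unif_props by simp

lemma ord_u: "inf.V.ord u = 2"
proof -
  interpret pinf: prime_localization B Pinf
    by (rule Pinf_localization)
  obtain e where e: "e \<in> pinf.loc - pinf.loc_max" "u = e * v ^ 2"
    using infinity_u by blast
  have "LR Infinity = pinf.loc" "LM Infinity = pinf.loc_max"
    by (simp_all add: local_ring_def max_ideal_def pinf.loc_def pinf.loc_max_def)
  then have "e \<in> LR Infinity - LM Infinity" using e by simp
  from inf.V.ord_eq[OF this, of 2] show ?thesis
    by (simp add: e(2) unif_infinity)
qed

lemma ord_x: "inf.V.ord x = - 2"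
  unfolding x_inverse_u using inf.V.ord_inverse[OF u_nz] ord_u by simp

lemma ord_y: "inf.V.ord y = - (2 * int (genus X) + 1)"
proof -
  have "inf.V.ord y = inf.V.ord v + inf.V.ord (x ^ (genus X + 1))"
    unfolding y_v using inf.V.ord_mult v_nz x_nz by simp
  also have "inf.V.ord (x ^ (genus X + 1)) = int (genus X + 1) * - 2"
    unfolding inf.V.ord_power[OF x_nz] ord_x ..
  also have "inf.V.ord v = 1"
    using inf.V.ord_unif by (simp add: unif_infinity)
  finally show ?thesis by simp
qed

text \<open>The reversed polynomial is a unit at \<open>u = 0\<close>, so the whole order comes from
  \<open>x^(degree q)\<close>.\<close>

lemma ord_pv_x:
  assumes "q \<noteq> 0"
  shows "inf.V.ord (pv q x) = - 2 * int (degree q)"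
proof -
  interpret pinf: prime_localization B Pinf
    by (rule Pinf_localization)
  have "pv (reflect_poly q) u \<notin> Pinf"
    using assms by (simp add: pv_u_Pinf)
  then have unit: "pv (reflect_poly q) u \<in> LR Infinity - LM Infinity"
    using pinf.loc_unit_I[OF B_poly]
    by (simp add: local_ring_def max_ideal_def pinf.loc_def pinf.loc_max_def)
  have "inf.V.ord (pv q x) = inf.V.ord (x ^ degree q) + inf.V.ord (pv (reflect_poly q) u)"
    unfolding pv_x_reflect[of q] using inf.V.ord_mult x_nz inf.V.unit_nz[OF unit] by simp
  then show ?thesis
    using inf.V.ord_unit[OF unit] inf.V.ord_power[OF x_nz] ord_x by simp
qed

lemma infinity_divisor_affine:
  assumes "maxA P"
  shows "bundle_stalk X (infinity_divisor l) (Affine P) = LR (Affine P)"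
proof -
  interpret p: curve_point X "Affine P" by (rule curve_point_affine[OF assms])
  have "\<phi> \<in> bundle_stalk X (infinity_divisor l) (Affine P) \<longleftrightarrow> \<phi> \<in> LR (Affine P)" for \<phi>
    by (cases "\<phi> = 0") (simp_all add: bundle_stalk_def p.ord_at_eq p.V.mem_iff_ord p.V.zero_mem)
  then show ?thesis by blast
qed

text \<open>Regularity on the affine part gives \<open>q(x) + r(x) y\<close>. At infinity the two
  terms have orders of different parity, so a nonzero \<open>r\<close> would force a pole of order
  at least \<open>2 g + 1 > 2 l\<close>.\<close>

lemma global_sections_eq:
  assumes "l \<le> genus X"
  shows "global_sections X (infinity_divisor l) = {pv q x | q. degree q \<le> l}"
proof
  show "global_sections X (infinity_divisor l) \<subseteq> {pv q x | q. degree q \<le> l}"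
  proof
    fix \<phi> assume \<phi>: "\<phi> \<in> global_sections X (infinity_divisor l)"
    have "\<phi> \<in> LR (Affine P)" if "maxA P" for P
      using \<phi> infinity_divisor_affine[OF that, of l] affine_closed that
      unfolding global_sections_def by blast
    then have "\<phi> \<in> A" by (rule regular_affine)
    then obtain q r where qr: "\<phi> = pv q x + pv r x * y" by (rule A_elim)
    have ord: "\<phi> = 0 \<or> - 2 * int l \<le> inf.V.ord \<phi>"
      using \<phi> infinity_closed by (auto simp: global_sections_def bundle_stalk_def inf.ord_at_eq)
    have r: "r = 0"
    proof (rule ccontr)
      assume r: "r \<noteq> 0"
      then have ry: "pv r x * y \<noteq> 0" using pv_x_nz y_nz by simp
      have ord_ry: "inf.V.ord (pv r x * y) = - 2 * int (degree r) - (2 * int (genus X) + 1)"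
        using inf.V.ord_mult[OF pv_x_nz[OF r] y_nz] ord_pv_x[OF r] ord_y by simp
      have "\<phi> \<noteq> 0" using repr_zero(2)[of q r] qr r by auto
      then have low: "- 2 * int l \<le> inf.V.ord \<phi>" using ord by blast
      show False
      proof (cases "q = 0")
        case True
        then show False using low ord_ry assms by (simp add: qr)
      next
        case q: False
        note oq = ord_pv_x[OF q]
        have "inf.V.ord (pv q x) < inf.V.ord (pv r x * y) \<or> inf.V.ord (pv r x * y) < inf.V.ord (pv q x)"
          unfolding oq ord_ry by presburger
        then have "inf.V.ord \<phi> \<le> inf.V.ord (pv r x * y)"
          using inf.V.ord_add(2)[OF pv_x_nz[OF q] ry] inf.V.ord_add(2)[OF ry pv_x_nz[OF q]]
          by (auto simp: qr add.commute)
        then show False using low ord_ry assms by simp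
      qed
    qed
    have "degree q \<le> l"
    proof (cases "q = 0")
      case False
      then show ?thesis
        using ord ord_pv_x[OF False] pv_x_nz[OF False] by (simp add: qr r)
    qed simp
    then show "\<phi> \<in> {pv q x | q. degree q \<le> l}"
      using qr r by auto
  qed
  show "{pv q x | q. degree q \<le> l} \<subseteq> global_sections X (infinity_divisor l)"
  proof clarify
    fix q :: "'a poly" assume q: "degree q \<le> l"
    show "pv q x \<in> global_sections X (infinity_divisor l)"
      unfolding global_sections_def
    proof (intro CollectI ballI)
      fix p assume p: "p \<in> closed_points X"
      show "pv q x \<in> bundle_stalk X (infinity_divisor l) p"
      proof (cases p)
        case (Affine P)
        then have P: "maxA P" using p affine_closed by simp
        show ?thesis
          using affine_mem(1)[OF P A_poly] infinity_divisor_affine[OF P] Affine by simp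
      next
        case Infinity
        then show ?thesis
          using q ord_pv_x[of q] by (cases "q = 0") (auto simp: bundle_stalk_def inf.ord_at_eq)
      qed
    qed
  qed
qed

text \<open>An algebraic element is integral over \<open>F\<close>, hence regular everywhere, and
  the sections for \<open>l = 0\<close> are the constants.\<close>

lemma constant_if_algebraic:
  assumes "c \<noteq> 0" and "pv c t = 0"
  shows "\<exists>a. t = emb X a"
proof -
  have deg: "0 < degree c"
  proof (rule ccontr)
    assume "\<not> 0 < degree c"
    then obtain a where "c = [:a:]" by (metis degree_eq_zeroE neq0_conv)
    then show False using assms by simp
  qed
  have local: "t \<in> LR p" if "p \<in> closed_points X" for p
  proof -
    interpret p: curve_point X p by unfold_locales (rule that)
    have sum: "(\<Sum>i\<le>degree c. emb X (coeff c i) * t ^ i) = 0"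
      using assms(2) by (simp add: polyval_def poly_altdef degree_map_poly coeff_map_poly)
    have "emb X (lead_coeff c) * t \<in> LR p"
      by (rule p.V.leading_coeff_root_mem[OF sum p.const_mem deg])
    then have "emb X (inverse (lead_coeff c)) * (emb X (lead_coeff c) * t) \<in> LR p"
      by (rule p.V.mult_mem[OF p.const_mem])
    moreover have "emb X (inverse (lead_coeff c)) * emb X (lead_coeff c) = 1"
      using assms(1) by (simp flip: emb.hom_mult)
    ultimately show ?thesis by (metis mult.assoc mult_1)
  qed
  have "t \<in> bundle_stalk X (infinity_divisor 0) p" if p: "p \<in> closed_points X" for p
  proof -
    interpret p: curve_point X p by unfold_locales (rule p)
    have "infinity_divisor 0 p = 0" by (cases p) auto
    then show ?thesis
      using local[OF p] p.V.mem_iff_ord[of t] by (simp add: bundle_stalk_def p.ord_at_eq)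
  qed
  then have "t \<in> global_sections X (infinity_divisor 0)"
    by (simp add: global_sections_def)
  then obtain q where "t = pv q x" "degree q = 0"
    using global_sections_eq[of 0] by auto
  then show ?thesis
    by (metis degree_eq_zeroE pv_pCons pv_0 mult_zero_right add.right_neutral)
qed

section \<open>The monomial basis\<close>

interpretation vs: Vector_Spaces.vector_space "\<lambda>c \<phi>. emb X c * \<phi>"
  by unfold_locales (simp_all add: algebra_simps emb.hom_add emb.hom_mult)

lemma inj_x_power: "inj (\<lambda>j. x ^ j)"
proof
  fix i j :: nat assume "x ^ i = x ^ j"
  then have "pv (monom 1 i - monom 1 j) x = 0"
    by (simp add: pv_diff pv_monom)
  then have "monom (1::'a) i = monom 1 j"
    using x_transcendental by fastforce
  then show "i = j"
    by (metis degree_monom_eq one_neq_zero)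
qed

lemma set_monomial_basis: "set (monomial_basis X l) = (\<lambda>j. x ^ j) ` {..l}"
  unfolding monomial_basis_def set_map set_upt atLeast0LessThan lessThan_Suc_atMost ..

lemma monomial_basis_is_basis:
  assumes "l \<le> genus X"
  shows "is_basis_of X (monomial_basis X l) (global_sections X (infinity_divisor l))"
  unfolding is_basis_of_def
proof (intro conjI)
  show "distinct (monomial_basis X l)"
    unfolding monomial_basis_def distinct_map
    using inj_on_subset[OF inj_x_power subset_UNIV] by (intro conjI distinct_upt)
  show "\<not> vs.dependent (set (monomial_basis X l))"
  proof
    assume "vs.dependent (set (monomial_basis X l))"
    then obtain t d where t: "finite t" "t \<subseteq> (\<lambda>j. x ^ j) ` {..l}"
        "(\<Sum>b\<in>t. emb X (d b) * b) = 0" and nz: "\<exists>b\<in>t. d b \<noteq> 0"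
      unfolding vs.dependent_explicit set_monomial_basis by blast
    then obtain J where J: "t = (\<lambda>j. x ^ j) ` J" "J \<subseteq> {..l}"
      by (meson subset_imageE)
    have fin: "finite J" using J(2) finite_subset by blast
    define q where "q = (\<Sum>j\<in>J. monom (d (x ^ j)) j)"
    have "(\<Sum>b\<in>t. emb X (d b) * b) = (\<Sum>j\<in>J. emb X (d (x ^ j)) * x ^ j)"
      unfolding J(1) using inj_x_power by (subst sum.reindex) (auto simp: inj_on_def)
    then have "pv q x = 0"
      using t(3) by (simp add: q_def pv_sum pv_monom)
    then have "q = 0" by (rule x_transcendental)
    moreover have "coeff q j = d (x ^ j)" if "j \<in> J" for j
      using that fin by (simp add: q_def coeff_sum coeff_monom)
    ultimately show False using nz J(1) by auto
  qed
  show "vs.span (set (monomial_basis X l)) = global_sections X (infinity_divisor l)"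
  proof
    show "vs.span (set (monomial_basis X l)) \<subseteq> global_sections X (infinity_divisor l)"
      unfolding global_sections_eq[OF assms]
    proof (rule vs.span_minimal)
      show "set (monomial_basis X l) \<subseteq> {pv q x | q. degree q \<le> l}"
      proof
        fix b assume "b \<in> set (monomial_basis X l)"
        then obtain j where "j \<le> l" "b = x ^ j" by (auto simp: set_monomial_basis)
        then have "b = pv (monom 1 j) x" "degree (monom (1::'a) j) \<le> l"
          by (simp_all add: pv_monom degree_monom_eq)
        then show "b \<in> {pv q x | q. degree q \<le> l}" by blast
      qed
      show "vs.subspace {pv q x | q. degree q \<le> l}"
      proof (rule vs.subspaceI)
        show "0 \<in> {pv q x | q. degree q \<le> l}"
          by (intro CollectI exI[of _ 0]) simp
        fix a b assume "a \<in> {pv q x | q. degree q \<le> l}" "b \<in> {pv q x | q. degree q \<le> l}"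
        then obtain q r where "a = pv q x" "b = pv r x" "degree q \<le> l" "degree r \<le> l" by blast
        then have "a + b = pv (q + r) x" "degree (q + r) \<le> l"
          by (simp_all add: pv_add degree_add_le)
        then show "a + b \<in> {pv q x | q. degree q \<le> l}" by blast
      next
        fix c a assume "a \<in> {pv q x | q. degree q \<le> l}"
        then obtain q where "a = pv q x" "degree q \<le> l" by blast
        then have "emb X c * a = pv (smult c q) x" "degree (smult c q) \<le> l"
          using degree_smult_le[of c q] by (simp_all add: pv_smult)
        then show "emb X c * a \<in> {pv q x | q. degree q \<le> l}" by blast
      qed
    qed
    show "global_sections X (infinity_divisor l) \<subseteq> vs.span (set (monomial_basis X l))"
      unfolding global_sections_eq[OF assms]
    proof clarify
      fix q :: "'a poly" assume q: "degree q \<le> l"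
      have "pv q x = (\<Sum>i\<le>degree q. emb X (coeff q i) * x ^ i)"
        by (simp add: polyval_def poly_altdef degree_map_poly coeff_map_poly)
      also have "\<dots> \<in> vs.span (set (monomial_basis X l))"
        using q by (intro vs.span_sum vs.span_scale vs.span_base) (auto simp: set_monomial_basis)
      finally show "pv q x \<in> vs.span (set (monomial_basis X l))" .
    qed
  qed
qed

end

section \<open>Hasse derivatives\<close>

lemma (in valuation_subring) square_root_mem:
  assumes "a * a \<in> V"
  shows "a \<in> V"
proof (rule ccontr)
  assume "a \<notin> V"
  then have "inverse a \<in> V" "a \<noteq> 0"
    using not_mem_inverse M_sub zero_mem by auto
  then show False
    using mult_mem[OF assms, of "inverse a"] \<open>a \<notin> V\<close> by (simp add: mult.assoc)
qed

context hyperelliptic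
begin

abbreviation "OU \<equiv> regular_functions X"

lemma curve_pointI: "p \<in> closed_points X \<Longrightarrow> curve_point X p"
  by unfold_locales

lemma local_subring: "p \<in> closed_points X \<Longrightarrow> field_subring (LR p)"
proof -
  assume "p \<in> closed_points X"
  then interpret curve_point X p by (rule curve_pointI)
  show ?thesis by (rule V.field_subring_axioms)
qed

lemma regular_subring: "U \<subseteq> closed_points X \<Longrightarrow> field_subring (OU U)"
  by unfold_locales
    (auto simp: regular_functions_def
      intro: field_subring.one_mem field_subring.diff_mem field_subring.mult_mem local_subring)

lemma regular_const: "U \<subseteq> closed_points X \<Longrightarrow> emb X c \<in> OU U"
  using curve_point.const_mem[OF curve_pointI] by (auto simp: regular_functions_def)

text \<open>Carrying \<open>dx t \<noteq> 0\<close> explicitly makes the notion stable under passing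
  to any subset, even an empty one, so overlaps of frames need no separate discussion.\<close>

definition etale_on :: "'k closed_point set \<Rightarrow> 'k \<Rightarrow> bool" where
  "etale_on U t \<longleftrightarrow> U \<subseteq> closed_points X \<and> dx t \<noteq> 0 \<and>
     (\<forall>p\<in>U. t \<in> LR p \<and> dx t / dx (coord p) \<notin> LM p)"

lemma etale_coordinate_iff:
  assumes "U \<subseteq> closed_points X" and "U \<noteq> {}"
  shows "etale_coordinate X U t \<longleftrightarrow> etale_on U t"
proof -
  have "differential_vanishes_at X t p \<longleftrightarrow> dx t / dx (coord p) \<in> LM p" if "p \<in> U" "t \<in> LR p" for p
    using curve_point.differential_vanishes_iff[OF curve_pointI] that assms(1) by blast
  then have "etale_coordinate X U t \<longleftrightarrow> (\<forall>p\<in>U. t \<in> LR p \<and> dx t / dx (coord p) \<notin> LM p)"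
    unfolding etale_coordinate_def regular_functions_def by blast
  moreover have "dx t \<noteq> 0" if *: "\<forall>p\<in>U. t \<in> LR p \<and> dx t / dx (coord p) \<notin> LM p"
  proof
    assume zero: "dx t = 0"
    obtain p where p: "p \<in> U" using assms(2) by blast
    then interpret curve_point X p using assms(1) curve_pointI by blast
    show False using * p zero V.zero_M by auto
  qed
  ultimately show ?thesis using assms(1) unfolding etale_on_def by blast
qed

lemma etale_on_subset: "etale_on U t \<Longrightarrow> U' \<subseteq> U \<Longrightarrow> etale_on U' t"
  unfolding etale_on_def by blast

lemma pv_as_sum: "degree q \<le> m \<Longrightarrow> pv q z = (\<Sum>i\<le>m. emb X (coeff q i) * z ^ i)"
proof -
  assume m: "degree q \<le> m"
  have "pv q z = (\<Sum>i\<le>degree q. emb X (coeff q i) * z ^ i)"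
    by (simp add: polyval_def poly_altdef degree_map_poly coeff_map_poly)
  also have "\<dots> = (\<Sum>i\<le>m. emb X (coeff q i) * z ^ i)"
    using m by (intro sum.mono_neutral_left) (auto simp: coeff_eq_0)
  finally show ?thesis .
qed

context
  fixes U t assumes et: "etale_on U t"
begin

lemma
  shows U_closed: "U \<subseteq> closed_points X"
    and dx_t: "dx t \<noteq> 0"
    and t_mem: "p \<in> U \<Longrightarrow> t \<in> LR p"
    and dx_t_unit: "p \<in> U \<Longrightarrow> dx t / dx (coord p) \<notin> LM p"
  using et by (auto simp: etale_on_def)

lemma curve_point_U: "p \<in> U \<Longrightarrow> curve_point X p"
  using U_closed curve_pointI by blast

text \<open>The expansion along \<open>coord p\<close> is integral at \<open>p\<close>. Passing to
  \<open>t\<close> substitutes the compositional inverse of \<open>E\<close>, again integral because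
  \<open>E $ 1\<close>, the derivative of \<open>t\<close> by \<open>coord p\<close>, is a
  unit.\<close>

lemma taylor_integral_at:
  assumes p: "p \<in> U" and \<phi>: "\<phi> \<in> LR p"
  shows "taylor_at t \<phi> \<in> fps_over (LR p)"
proof -
  interpret p: curve_point X p by (rule curve_point_U[OF p])
  let ?\<theta> = "taylor_at (coord p)"
  note th = taylor_at_hom[OF p.dx_coord]
  define E where "E = ?\<theta> t - fps_const t"
  have E_mem: "E \<in> fps_over (LR p)"
    unfolding E_def by (intro p.V.fps_over_diff p.taylor_coord_integral p.V.fps_over_const t_mem[OF p])
  have E0: "E $ 0 = 0"
    by (simp add: E_def taylor_nth_0[OF th])
  have "E $ 1 = dx t / dx (coord p)"
    using taylor_at_nth_1[OF p.dx_coord, of t] by (simp add: E_def)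
  then have E1: "E $ 1 \<noteq> 0" "inverse (E $ 1) \<in> LR p"
    using dx_t p.dx_coord p.V.unit[OF p.deriv_coord_mem[OF t_mem[OF p]] dx_t_unit[OF p]] by auto
  define S where "S = fps_inv E"
  have S0: "S $ 0 = 0" by (simp add: S_def fps_inv_def)
  have ES: "E oo S = fps_X"
    unfolding S_def by (rule fps_inv_right[OF E0 E1(1)])
  have S_mem: "S \<in> fps_over (LR p)"
    by (rule p.V.compose_inverse_integral[OF E_mem E1 S0 ES])
  have "?\<theta> t oo S = (E oo S) + fps_const t"
    unfolding E_def fps_compose_sub_distrib fps_const_compose by simp
  then have "?\<theta> t oo S = fps_const t + fps_X"
    by (simp add: ES)
  then have "(\<lambda>\<phi>. ?\<theta> \<phi> oo S) = taylor_at t"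
    by (intro taylor_at_unique[OF dx_t] taylor_compose[OF th S0])
  then have "taylor_at t \<phi> = ?\<theta> \<phi> oo S" by metis
  also have "\<dots> \<in> fps_over (LR p)"
    by (intro p.V.fps_over_compose p.taylor_coord_integral \<phi> S_mem)
  finally show ?thesis .
qed

text \<open>
  The coordinate \<open>x\<close> is algebraic over \<open>F(t)\<close>; multiplied by a leading coefficient \<open>C \<in> F[t]\<close> it
  becomes integral over \<open>F[t]\<close>, hence regular on \<open>U\<close>.
\<close>

lemma clear_x: "\<exists>C. C \<noteq> 0 \<and> (\<forall>p\<in>U. C \<in> LR p \<and> C * x \<in> LR p)"
proof -
  obtain a b where ab: "a \<in> A" "b \<in> A" "b \<noteq> 0" "t = a / b"
    using fraction by blast
  obtain q r where a: "a = pv q x + pv r x * y" using A_elim[OF ab(1)] .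
  obtain q' r' where b: "b = pv q' x + pv r' x * y" using A_elim[OF ab(2)] .
  \<comment> \<open>\<open>N\<close> is the norm of the denominator of \<open>t\<close>, and
    \<open>Q + R y\<close> is the numerator times the conjugate denominator. Squaring
    \<open>N t - Q = R y\<close> eliminates \<open>y\<close>.\<close>
  define N where "N = q'\<^sup>2 - r'\<^sup>2 * f"
  define Q where "Q = q * q' - r * r' * f"
  define R where "R = r * q' - q * r'"
  have N: "N \<noteq> 0" "b * (pv q' x - pv r' x * y) = pv N x"
    using norm_nz[of q' r'] norm_eq[of q' r'] ab(3) by (simp_all add: b N_def)
  have "t * pv N x = t * b * (pv q' x - pv r' x * y)"
    by (simp add: N(2)[symmetric])
  also have "t * b = a" using ab by simp
  also have "a * (pv q' x - pv r' x * y) = pv Q x + pv R x * y"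
    by (simp add: a Q_def R_def pv_diff pv_mult y_square[symmetric] power2_eq_square algebra_simps)
  finally have sq: "(pv N x * t - pv Q x)\<^sup>2 = (pv R x)\<^sup>2 * y\<^sup>2"
    by (simp add: power_mult_distrib mult.commute)
  have pv_2: "pv (N * Q + N * Q) x = 2 * (pv N x * pv Q x)"
    unfolding pv_add pv_mult by simp
  have pv_n: "pv (Q\<^sup>2 - R\<^sup>2 * f) x = (pv Q x)\<^sup>2 - (pv R x)\<^sup>2 * y\<^sup>2"
    by (simp only: pv_diff pv_power pv_mult y_square)
  have rel: "pv (N\<^sup>2) x * t\<^sup>2 - pv (N * Q + N * Q) x * t + pv (Q\<^sup>2 - R\<^sup>2 * f) x = 0"
    unfolding pv_power pv_2 pv_n using sq by (simp add: power2_eq_square algebra_simps)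
  define d where "d = N\<^sup>2"
  define e where "e = N * Q + N * Q"
  define n where "n = Q\<^sup>2 - R\<^sup>2 * f"
  \<comment> \<open>The relation is regrouped by powers of \<open>x\<close>, with coefficients
    \<open>c i\<close> quadratic in \<open>t\<close>. With \<open>m\<close> the largest of the three
    degrees, \<open>c m\<close> is not the zero polynomial.\<close>
  define m where "m = max (degree d) (max (degree e) (degree n))"
  define c where "c i = [:coeff n i, - coeff e i, coeff d i:]" for i
  have pv_c: "pv (c i) t = emb X (coeff n i) - emb X (coeff e i) * t + emb X (coeff d i) * t\<^sup>2" for i
    by (simp add: c_def emb.hom_uminus power2_eq_square algebra_simps)
  have "(\<Sum>i\<le>m. pv (c i) t * x ^ i) = pv n x - pv e x * t + pv d x * t\<^sup>2"
    unfolding pv_c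
    by (simp add: pv_as_sum[of d m] pv_as_sum[of e m] pv_as_sum[of n m] m_def sum.distrib
        sum_subtractf sum_distrib_left sum_distrib_right algebra_simps)
  also have "\<dots> = 0"
    unfolding d_def e_def n_def using rel by (simp only: algebra_simps)
  finally have sum: "(\<Sum>i\<le>m. pv (c i) t * x ^ i) = 0" .
  have "coeff d m \<noteq> 0 \<or> coeff e m \<noteq> 0 \<or> coeff n m \<noteq> 0"
  proof -
    have "d \<noteq> 0" using N(1) by (simp add: d_def)
    consider "m = degree d" | "m = degree e" "0 < m" | "m = degree n" "0 < m"
      unfolding m_def by linarith
    then show ?thesis
      using \<open>d \<noteq> 0\<close> by cases (auto simp: leading_coeff_0_iff)
  qed
  then have "c m \<noteq> 0" by (auto simp: c_def)
  \<comment> \<open>\<open>t\<close> is transcendental over \<open>F\<close>, since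
    \<open>dx\<close> kills constants and \<open>dx t \<noteq> 0\<close>.\<close>
  then have C: "pv (c m) t \<noteq> 0"
    using constant_if_algebraic dx_t dx_const by metis
  have "0 < m"
  proof (rule ccontr)
    assume "\<not> 0 < m"
    then show False using sum C by simp
  qed
  have "pv (c m) t \<in> LR p \<and> pv (c m) t * x \<in> LR p" if p: "p \<in> U" for p
  proof -
    interpret p: curve_point X p by (rule curve_point_U[OF p])
    have mem: "pv (c i) t \<in> LR p" for i
      by (rule p.pv_mem[OF t_mem[OF p]])
    show ?thesis
      using mem p.V.leading_coeff_root_mem[OF sum mem \<open>0 < m\<close>] by blast
  qed
  then show ?thesis using C by blast
qed

text \<open>\<open>C\<close> clears \<open>x\<close> on all of \<open>U\<close>. For
  \<open>y\<close>, the square of \<open>C^(g+1) y\<close> is \<open>f(x)\<close> with its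
  denominators cleared, and a local ring contains every element of \<open>K\<close> whose square it
  contains.\<close>

lemma regular_fraction: "\<exists>a\<in>OU U. \<exists>b\<in>OU U. b \<noteq> 0 \<and> \<phi> = a / b"
proof -
  obtain C where C: "C \<noteq> 0" "\<And>p. p \<in> U \<Longrightarrow> C \<in> LR p" "\<And>p. p \<in> U \<Longrightarrow> C * x \<in> LR p"
    using clear_x by blast
  have poly: "C ^ k * pv q x \<in> LR p" if p: "p \<in> U" and k: "degree q \<le> k" for p q k
  proof -
    interpret p: curve_point X p by (rule curve_point_U[OF p])
    have "C ^ k * pv q x = (\<Sum>i\<le>k. emb X (coeff q i) * (C ^ (k - i) * (C * x) ^ i))"
      unfolding pv_as_sum[OF k] sum_distrib_left
    proof (rule sum.cong)
      fix i assume "i \<in> {..k}"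
      then have "C ^ k = C ^ (k - i) * C ^ i" by (simp flip: power_add)
      then show "C ^ k * (emb X (coeff q i) * x ^ i) =
          emb X (coeff q i) * (C ^ (k - i) * (C * x) ^ i)"
        by (simp add: power_mult_distrib)
    qed simp
    also have "\<dots> \<in> LR p"
      using C p by (intro p.V.sum_mem p.V.mult_mem[OF p.const_mem]
        p.V.mult_mem[OF p.V.power_mem p.V.power_mem]) auto
    finally show ?thesis .
  qed
  have y: "C ^ (genus X + 1) * y \<in> LR p" if p: "p \<in> U" for p
  proof -
    interpret p: curve_point X p by (rule curve_point_U[OF p])
    let ?Y = "C ^ (genus X + 1) * y"
    have Y: "?Y * ?Y = C ^ (2 * genus X + 2) * pv f x"
      by (simp add: y_square[symmetric] power2_eq_square power_add mult_2 mult_2_right algebra_simps)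
    have sq: "?Y * ?Y \<in> LR p"
      unfolding Y by (rule poly[OF p]) (simp add: degree_f)
    then show ?thesis by (rule p.V.square_root_mem)
  qed
  have A: "\<exists>k. C ^ k * a \<in> OU U" if a: "a \<in> A" for a
  proof -
    obtain q r where qr: "a = pv q x + pv r x * y" using A_elim[OF a] .
    let ?k = "degree q" and ?j = "degree r" and ?g = "genus X + 1"
    have "C ^ (?k + ?j + ?g) * a \<in> LR p" if p: "p \<in> U" for p
    proof -
      interpret p: curve_point X p by (rule curve_point_U[OF p])
      have "C ^ (?k + ?j + ?g) * a =
          C ^ (?j + ?g) * (C ^ ?k * pv q x) + C ^ ?k * ((C ^ ?j * pv r x) * (C ^ ?g * y))"
        by (simp add: qr power_add algebra_simps)
      also have "\<dots> \<in> LR p"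
        using p by (intro p.V.add_mem p.V.mult_mem[OF p.V.power_mem[OF C(2)]]
          p.V.mult_mem[OF poly y] poly) auto
      finally show ?thesis .
    qed
    then show ?thesis unfolding regular_functions_def by blast
  qed
  interpret O: field_subring "OU U" by (rule regular_subring[OF U_closed])
  have C_O: "C \<in> OU U" using C by (simp add: regular_functions_def)
  obtain a b where ab: "a \<in> A" "b \<in> A" "b \<noteq> 0" "\<phi> = a / b"
    using fraction by blast
  obtain j k where jk: "C ^ j * a \<in> OU U" "C ^ k * b \<in> OU U"
    using A ab by metis
  have "C ^ k * (C ^ j * a) \<in> OU U" "C ^ j * (C ^ k * b) \<in> OU U"
    by (rule O.mult_mem[OF O.power_mem[OF C_O] jk(1)] O.mult_mem[OF O.power_mem[OF C_O] jk(2)])+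
  moreover have "\<phi> = (C ^ k * (C ^ j * a)) / (C ^ j * (C ^ k * b))"
    using C(1) by (simp add: ab)
  moreover have "C ^ j * (C ^ k * b) \<noteq> 0"
    using C(1) ab(3) by simp
  ultimately show ?thesis by blast
qed

lemma taylor_regular: "\<phi> \<in> OU U \<Longrightarrow> taylor_at t \<phi> $ k \<in> OU U"
  using taylor_integral_at by (auto simp: regular_functions_def fps_over_def)

lemma X_plus_const_power_nth:
  "((fps_const t + fps_X) ^ n) $ k = of_nat (n choose k) * t ^ (n - k)"
proof -
  have "((fps_X + fps_const t) ^ n) $ k =
      (\<Sum>i\<le>n. if i = k then of_nat (n choose i) * t ^ (n - i) else 0)"
    unfolding binomial_ring fps_sum_nth
  proof (rule sum.cong)
    fix i
    have "of_nat (n choose i) * fps_X ^ i * fps_const t ^ (n - i) =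
        fps_const (of_nat (n choose i) * t ^ (n - i)) * fps_X ^ i"
      by (simp add: fps_of_nat[symmetric] fps_const_power mult_ac)
    then show "(of_nat (n choose i) * fps_X ^ i * fps_const t ^ (n - i)) $ k =
        (if i = k then of_nat (n choose i) * t ^ (n - i) else 0)"
      by simp
  qed simp
  also have "\<dots> = of_nat (n choose k) * t ^ (n - k)"
    by (simp add: sum.delta binomial_eq_0)
  finally show ?thesis by (simp add: add.commute)
qed

lemma taylor_hasse_family:
  "is_hasse_family X U t (\<lambda>k \<phi>. if \<phi> \<in> OU U then taylor_at t \<phi> $ k else 0)"
proof -
  interpret O: field_subring "OU U" by (rule regular_subring[OF U_closed])
  note th = taylor_at_hom[OF dx_t]
  have t: "t \<in> OU U" using t_mem by (simp add: regular_functions_def)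
  have "taylor_at t (t ^ n) $ k = of_nat (n choose k) * t ^ (n - k)" for n k
    unfolding taylor_power[OF th] taylor_at_self[OF dx_t] by (rule X_plus_const_power_nth)
  then show ?thesis
    unfolding is_hasse_family_def
    by (simp add: taylor_regular O.add_mem O.mult_mem O.power_mem[OF t] regular_const[OF U_closed]
        taylor_add[OF th] taylor_mult[OF th] taylor_const[OF th] taylor_nth_0[OF th]
        fps_mult_nth mult_delta_left)
qed

text \<open>The Leibniz rules assemble \<open>D\<close> into a ring homomorphism on the regular
  functions; it extends to \<open>K\<close>, where its value at \<open>t\<close> determines
  it.\<close>

lemma hasse_family_unique:
  assumes D: "is_hasse_family X U t D"
  shows "D = (\<lambda>k \<phi>. if \<phi> \<in> OU U then taylor_at t \<phi> $ k else 0)"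
proof -
  interpret O: field_subring "OU U" by (rule regular_subring[OF U_closed])
  have t: "t \<in> OU U" using t_mem by (simp add: regular_functions_def)
  have D_add: "D k (\<phi> + \<psi>) = D k \<phi> + D k \<psi>" if "\<phi> \<in> OU U" "\<psi> \<in> OU U" for k \<phi> \<psi>
    using D that unfolding is_hasse_family_def by blast
  have D_scale: "D k (emb X c * \<phi>) = emb X c * D k \<phi>" if "\<phi> \<in> OU U" for k c \<phi>
    using D that unfolding is_hasse_family_def by blast
  have D_0: "D 0 \<phi> = \<phi>" if "\<phi> \<in> OU U" for \<phi>
    using D that unfolding is_hasse_family_def by blast
  have D_mult: "D k (\<phi> * \<psi>) = (\<Sum>i=0..k. D i \<phi> * D (k - i) \<psi>)" if "\<phi> \<in> OU U" "\<psi> \<in> OU U" for k \<phi> \<psi>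
    using D that unfolding is_hasse_family_def by blast
  have D_t: "D k (t ^ n) = of_nat (n choose k) * t ^ (n - k)" for k n
    using D unfolding is_hasse_family_def by blast
  have D_out: "D k \<phi> = 0" if "\<phi> \<notin> OU U" for k \<phi>
    using D that unfolding is_hasse_family_def by blast
  define E where "E \<phi> = Abs_fps (\<lambda>k. D k \<phi>)" for \<phi>
  have "\<exists>\<theta>. taylor_hom \<theta> \<and> (\<forall>a\<in>OU U. \<theta> a = E a)"
  proof (rule taylor_extend[OF O.field_subring_axioms regular_const[OF U_closed] regular_fraction])
    show "E (a + b) = E a + E b" "E (a * b) = E a * E b" if "a \<in> OU U" "b \<in> OU U" for a b
      using that by (simp_all add: E_def fps_eq_iff D_add D_mult fps_mult_nth)
    show "E a $ 0 = a" if "a \<in> OU U" for a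
      using that by (simp add: E_def D_0)
    show "E (emb X c) = fps_const (emb X c)" for c
    proof (rule fps_ext)
      fix k
      \<comment> \<open>Linearity over \<open>F\<close> and the rule for \<open>t^0 = 1\<close> give
        the values on constants.\<close>
      have "D k (emb X c) = emb X c * D k (t ^ 0)"
        using D_scale[OF O.one_mem, of k c] by simp
      also have "\<dots> = fps_const (emb X c) $ k"
        unfolding D_t by (cases k) simp_all
      finally show "E (emb X c) $ k = fps_const (emb X c) $ k"
        by (simp add: E_def)
    qed
  qed
  then obtain \<theta> where \<theta>: "taylor_hom \<theta>" "\<And>a. a \<in> OU U \<Longrightarrow> \<theta> a = E a" by blast
  have "\<theta> t = fps_const t + fps_X"
  proof (rule fps_ext)
    fix k
    have "\<theta> t $ k = D k (t ^ 1)"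
      using \<theta>(2)[OF t] by (simp add: E_def)
    also have "\<dots> = (fps_const t + fps_X) $ k"
      unfolding D_t X_plus_const_power_nth[symmetric] by simp
    finally show "\<theta> t $ k = (fps_const t + fps_X) $ k" .
  qed
  then have eq: "\<theta> = taylor_at t"
    by (rule taylor_at_unique[OF dx_t \<theta>(1)])
  show ?thesis
  proof (intro ext)
    fix k \<phi>
    show "D k \<phi> = (if \<phi> \<in> OU U then taylor_at t \<phi> $ k else 0)"
      using \<theta>(2)[of \<phi>] by (simp add: eq E_def D_out)
  qed
qed

lemma hasse_eq:
  assumes "\<phi> \<in> OU U"
  shows "hasse X U t k \<phi> = taylor_at t \<phi> $ k"
proof -
  have "hasse X U t = (\<lambda>k \<phi>. if \<phi> \<in> OU U then taylor_at t \<phi> $ k else 0)"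
    unfolding hasse_def
    by (rule the_equality, rule taylor_hasse_family, rule hasse_family_unique)
  then show ?thesis using assms by simp
qed

lemma hasse_1_eq:
  assumes "\<phi> \<in> OU U"
  shows "hasse X U t 1 \<phi> = dx \<phi> / dx t"
  using hasse_eq[OF assms, of 1] taylor_at_nth_1[OF dx_t] by simp

end

end

section \<open>The Wronskian\<close>

text \<open>The exponents \<open>0 + 1 + ... + (n - 1)\<close> along the diagonal add up to
  \<open>n choose 2\<close>.\<close>

lemma prod_scaled_powers: "(\<Prod>m<n. a * b ^ m) = (a :: 'k::comm_ring_1) ^ n * b ^ (n choose 2)"
proof (induction n)
  case (Suc n)
  have "Suc n choose 2 = n + (n choose 2)"
    by (simp add: numeral_2_eq_2)
  then show ?case by (simp add: Suc power_add algebra_simps)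
qed (simp add: binomial_eq_0)

text \<open>
  With \<open>E\<close> of order one, the \<open>j\<close>-th column is expanded in the series \<open>S E\<^sup>m\<close>: the matrix is the
  product of a lower triangular matrix and a unipotent upper triangular one.
\<close>

lemma det_power_coefficients:
  fixes S E :: "'k::field fps"
  assumes "E $ 0 = 0"
  shows "det (mat n n (\<lambda>(i, j). (S * (fps_const c + E) ^ j) $ i)) =
    (S $ 0) ^ n * (E $ 1) ^ (n choose 2)"
proof -
  define L where "L = mat n n (\<lambda>(i, m). (S * E ^ m) $ i)"
  define T where "T = mat n n (\<lambda>(m, j). of_nat (j choose m) * c ^ (j - m))"
  have carrier: "L \<in> carrier_mat n n" "T \<in> carrier_mat n n"
    by (simp_all add: L_def T_def)
  have low: "(S * E ^ m) $ i = 0" if "i < m" for i m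
    using that startsby_zero_power_prefix[OF assms] by (auto simp: fps_mult_nth intro!: sum.neutral)
  have diag: "(S * E ^ m) $ m = S $ 0 * (E $ 1) ^ m" for m
  proof -
    have "(S * E ^ m) $ m = (\<Sum>i=0..m. if i = 0 then S $ 0 * (E ^ m) $ m else 0)"
      unfolding fps_mult_nth
      using startsby_zero_power_prefix[OF assms] by (intro sum.cong) auto
    then show ?thesis
      using startsby_zero_power_nth_same[OF assms] by simp
  qed
  have "mat n n (\<lambda>(i, j). (S * (fps_const c + E) ^ j) $ i) = L * T"
  proof (rule eq_matI)
    fix i j assume ij: "i < dim_row (L * T)" "j < dim_col (L * T)"
    then have ij': "i < n" "j < n" by (simp_all add: L_def T_def)
    have "S * (fps_const c + E) ^ j =
        (\<Sum>m\<le>j. fps_const (of_nat (j choose m) * c ^ (j - m)) * (S * E ^ m))"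
      unfolding add.commute[of "fps_const c"] binomial_ring sum_distrib_left
      by (intro sum.cong) (simp_all add: fps_of_nat[symmetric] fps_const_power mult_ac flip: fps_const_mult)
    then have "(S * (fps_const c + E) ^ j) $ i =
        (\<Sum>m\<le>j. of_nat (j choose m) * c ^ (j - m) * (S * E ^ m) $ i)"
      by (simp add: fps_sum_nth)
    \<comment> \<open>Terms with \<open>m > j\<close> vanish with the binomial coefficient, so the
      sum may run over the whole size of the matrix.\<close>
    also have "\<dots> = (\<Sum>m<n. of_nat (j choose m) * c ^ (j - m) * (S * E ^ m) $ i)"
      using ij' by (intro sum.mono_neutral_left) (auto simp: binomial_eq_0)
    also have "\<dots> = (L * T) $$ (i, j)"
      using ij' by (simp add: L_def T_def scalar_prod_def atLeast0LessThan mult_ac)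
    finally show "mat n n (\<lambda>(i, j). (S * (fps_const c + E) ^ j) $ i) $$ (i, j) = (L * T) $$ (i, j)"
      using ij' by simp
  qed (simp_all add: L_def T_def)
  then have "det (mat n n (\<lambda>(i, j). (S * (fps_const c + E) ^ j) $ i)) = det L * det T"
    by (simp add: det_mult[OF carrier])
  also have "det T = 1"
    by (subst det_upper_triangular[OF _ carrier(2)])
      (auto simp: T_def upper_triangular_def diag_mat_def binomial_eq_0 intro!: prod_list_neutral)
  also have "det L = (\<Prod>m<n. S $ 0 * (E $ 1) ^ m)"
    by (subst det_lower_triangular[OF _ carrier(1)])
      (auto simp: L_def low diag diag_mat_def prod.list_conv_set_nth atLeast0LessThan intro!: prod.cong)
  finally show ?thesis
    by (simp add: prod_scaled_powers)
qed

context hyperelliptic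
begin

text \<open>Here \<open>S\<close>, the expansion of \<open>1 / s\<close>, has constant term
  \<open>1 / s\<close>, and the expansion of \<open>x\<close> along \<open>t\<close> has linear
  coefficient \<open>dx x / dx t = 1 / dx t\<close>.\<close>

lemma taylor_wronskian:
  assumes "dx t \<noteq> 0" and "s \<noteq> 0"
  shows "det (mat n n (\<lambda>(i, j). taylor_at t (x ^ j / s) $ i)) =
    (1 / s) ^ n * (1 / dx t) ^ (n choose 2)"
proof -
  note th = taylor_at_hom[OF assms(1)]
  define E where "E = taylor_at t x - fps_const x"
  have "taylor_at t (x ^ j / s) = taylor_at t (1 / s) * (fps_const x + E) ^ j" for j
  proof -
    have "x ^ j / s = (1 / s) * x ^ j" by simp
    then show ?thesis
      by (simp only: taylor_mult[OF th] taylor_power[OF th]) (simp add: E_def)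
  qed
  moreover have "E $ 0 = 0" "E $ 1 = 1 / dx t"
    using taylor_nth_0[OF th] taylor_at_nth_1[OF assms(1), of x] dx_x by (simp_all add: E_def)
  ultimately show ?thesis
    using det_power_coefficients[of E n "taylor_at t (1 / s)" x] taylor_nth_0[OF th, of "1 / s"] by simp
qed

section \<open>The Wronskian in a frame\<close>

context
  fixes l U s t
  assumes l: "l \<le> genus X" and fr: "frame X (infinity_divisor l) U s t"
begin

lemma frame_etale: "etale_on U t"
  using fr etale_coordinate_iff by (auto simp: frame_def open_subset_def)

lemma frame_closed: "U \<subseteq> closed_points X"
  using fr by (simp add: frame_def open_subset_def)

lemma frame_stalk:
  "p \<in> U \<Longrightarrow> bundle_stalk X (infinity_divisor l) p = {s * a | a. a \<in> LR p}"
  using fr by (simp add: frame_def local_generator_def)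

lemma x_power_stalk:
  assumes "p \<in> closed_points X" and "j \<le> l"
  shows "x ^ j \<in> bundle_stalk X (infinity_divisor l) p"
proof -
  have "x ^ j = pv (monom 1 j) x" "degree (monom (1::'a) j) \<le> l"
    using assms(2) by (simp_all add: pv_monom degree_monom_eq)
  then have "x ^ j \<in> global_sections X (infinity_divisor l)"
    unfolding global_sections_eq[OF l] by blast
  then show ?thesis using assms(1) by (simp add: global_sections_def)
qed

text \<open>The constant 1 is a section, hence a multiple of \<open>s\<close> at any point of the
  nonempty \<open>U\<close>.\<close>

lemma s_nz: "s \<noteq> 0"
proof
  assume s: "s = 0"
  obtain p where p: "p \<in> U" using fr by (auto simp: frame_def open_subset_def)
  then have "1 \<in> {s * a | a. a \<in> LR p}"
    using x_power_stalk[of p 0] frame_closed frame_stalk[OF p] by auto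
  then show False using s by simp
qed

lemma section_quotient_regular: "j \<le> l \<Longrightarrow> x ^ j / s \<in> OU U"
  unfolding regular_functions_def
proof (intro CollectI ballI)
  fix p assume j: "j \<le> l" and p: "p \<in> U"
  then have "x ^ j \<in> {s * a | a. a \<in> LR p}"
    using x_power_stalk[of p j] frame_closed frame_stalk[OF p] by auto
  then show "x ^ j / s \<in> LR p" using s_nz by auto
qed

lemma wronskian_entry:
  assumes "i < Suc l" and "j < Suc l"
  shows "hasse X U t i (monomial_basis X l ! j / s) = taylor_at t (x ^ j / s) $ i"
proof -
  have "monomial_basis X l ! j = x ^ j"
    unfolding monomial_basis_def using assms(2) by (simp del: upt_Suc)
  then show ?thesis
    using hasse_eq[OF frame_etale section_quotient_regular] assms(2) by simp
qed

lemma length_basis: "length (monomial_basis X l) = Suc l"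
  by (simp add: monomial_basis_def)

lemma wronskian_det:
  "hasse_wronskian X (monomial_basis X l) U s t =
    det (mat (Suc l) (Suc l) (\<lambda>(i, j). taylor_at t (x ^ j / s) $ i))"
  unfolding hasse_wronskian_def length_basis
  by (intro arg_cong[of _ _ det] eq_matI) (simp_all add: wronskian_entry)

text \<open>The transition law, the divisor and the value at \<open>s = 1\<close> are all read off
  from this closed form.\<close>

lemma wronskian_eq:
  "hasse_wronskian X (monomial_basis X l) U s t =
    (1 / s) ^ (l + 1) * (1 / dx t) ^ ((l + 1) choose 2)"
  unfolding wronskian_det
  using taylor_wronskian[OF dx_t[OF frame_etale] s_nz, of "Suc l"] by simp

text \<open>Regularity is seen on the entries of the determinant; the closed form has denominators
  and does not display it.\<close>

lemma wronskian_regular: "hasse_wronskian X (monomial_basis X l) U s t \<in> OU U"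
  unfolding wronskian_det
  by (intro field_subring.det_mem[OF regular_subring[OF frame_closed]]
      taylor_regular[OF frame_etale] section_quotient_regular) simp

end

lemma wronskian_global_section:
  assumes l: "l \<le> genus X"
  shows "is_global_section X (infinity_divisor l) (l + 1) ((l + 1) choose 2)
    (hasse_wronskian X (monomial_basis X l))"
  unfolding is_global_section_def
proof (intro conjI allI impI)
  fix U s t assume "frame X (infinity_divisor l) U s t"
  then show "hasse_wronskian X (monomial_basis X l) U s t \<in> OU U"
    by (rule wronskian_regular[OF l])
next
  fix U s t U' s' t'
  assume "frame X (infinity_divisor l) U s t \<and> frame X (infinity_divisor l) U' s' t'"
  then have fr: "frame X (infinity_divisor l) U s t" "frame X (infinity_divisor l) U' s' t'"
    by auto
  note et = frame_etale[OF l fr(1)] frame_etale[OF l fr(2)]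
  have "t \<in> OU (U \<inter> U')"
    using t_mem[OF et(1)] by (simp add: regular_functions_def)
  then have "hasse X (U \<inter> U') t' 1 t = dx t / dx t'"
    using hasse_1_eq[OF etale_on_subset[OF et(2)], of "U \<inter> U'" t] by simp
  then show "hasse_wronskian X (monomial_basis X l) U' s' t' =
      hasse_wronskian X (monomial_basis X l) U s t * (s / s') ^ (l + 1) *
        hasse X (U \<inter> U') t' 1 t ^ ((l + 1) choose 2)"
    unfolding wronskian_eq[OF l fr(1)] wronskian_eq[OF l fr(2)]
    using s_nz[OF l fr(1)] s_nz[OF l fr(2)] dx_t[OF et(1)] dx_t[OF et(2)]
    by (simp add: power_divide)
qed

section \<open>Ramification\<close>

interpretation inf: curve_point X Infinity
  by (rule curve_point_infinity)

lemma two_unit_at: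
  assumes "curve_point X p"
  shows "2 \<in> LR p - LM p"
proof -
  have "emb X 2 = 2"
    by (metis emb.hom_add emb.hom_one one_add_one)
  then show ?thesis
    using curve_point.const_unit[OF assms two_nz] by simp
qed

lemma affine_unif:
  assumes P: "maxA P" and y: "y \<in> P"
  shows "curve_point.unif X (Affine P) = y"
  using curve_point.unif_props[OF curve_point_affine[OF P]] y by simp

text \<open>In \<open>2 y dy = f' dx\<close> the factors 2 and \<open>f'\<close> are units and
  \<open>y\<close> is a uniformizer, so \<open>dy/dx\<close> has a simple pole.\<close>

lemma ord_dx_y:
  assumes P: "maxA P" and y: "y \<in> P"
  shows "ord_at X (Affine P) (dx y) = - 1"
proof -
  interpret p: curve_point X "Affine P" by (rule curve_point_affine[OF P])
  have d: "pv (pderiv f) x \<in> LR (Affine P) - LM (Affine P)"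
    using affine_smooth[OF P y] affine_mem[OF P A_poly] by blast
  have "p.V.ord (2 * (y * dx y)) = p.V.ord 2 + (p.V.ord y + p.V.ord (dx y))"
    using two_nz_K y_nz dx_y_nz by (simp add: p.V.ord_mult)
  moreover have "2 * (y * dx y) = pv (pderiv f) x"
    using dx_y by (simp add: mult.assoc)
  moreover have "p.V.ord y = 1"
    using p.V.ord_unif affine_unif[OF P y] by simp
  ultimately show ?thesis
    using p.V.ord_unit[OF d] p.V.ord_unit[OF two_unit_at[OF p.curve_point_axioms]]
    by (simp add: p.ord_at_eq)
qed

lemma dx_u_nz: "dx u \<noteq> 0"
  using x_nz by (simp add: dx_u)

text \<open>\<open>du/dx = - u^2\<close>, and \<open>u\<close> has order 2.\<close>

lemma ord_dx_u: "ord_at X Infinity (dx u) = 4"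
proof -
  have "dx u = - 1 * u ^ 2"
    unfolding dx_u by (simp add: u_fun_def power_divide)
  then have "inf.V.ord (dx u) = inf.V.ord (- 1) + inf.V.ord (u ^ 2)"
    using u_nz inf.V.ord_mult[of "- 1" "u ^ 2"] by simp
  then show ?thesis
    using inf.V.ord_power[OF u_nz, of 2] ord_u
      inf.V.ord_unit[OF inf.V.unit_uminus[OF inf.V.unit_one]] by (simp add: inf.ord_at_eq)
qed

text \<open>In \<open>2 v dv = hinf'(u) du\<close> the right-hand side has order 4, of which
  \<open>v\<close> accounts for 1.\<close>

lemma ord_dx_v: "ord_at X Infinity (dx v) = 3"
proof -
  interpret pinf: prime_localization B Pinf
    by (rule Pinf_localization)
  have d: "pv (pderiv hinf) u \<in> LR Infinity - LM Infinity"
    using pinf.loc_unit_I[OF B_poly hinf_smooth]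
    by (simp add: local_ring_def max_ideal_def pinf.loc_def pinf.loc_max_def)
  have dv: "dx v \<noteq> 0" using inf.dx_coord by simp
  have "inf.V.ord (2 * (v * dx v)) = inf.V.ord 2 + (inf.V.ord v + inf.V.ord (dx v))"
    using two_nz_K v_nz dv by (simp add: inf.V.ord_mult)
  moreover have "2 * (v * dx v) = pv (pderiv hinf) u * dx u"
    using dx_square_root[OF v_square] by (simp add: mult.assoc)
  moreover have "inf.V.ord (pv (pderiv hinf) u * dx u) = inf.V.ord (pv (pderiv hinf) u) + inf.V.ord (dx u)"
    using inf.V.unit_nz[OF d] dx_u_nz by (rule inf.V.ord_mult)
  moreover have "inf.V.ord v = 1"
    using inf.V.ord_unif by (simp add: unif_infinity)
  ultimately show ?thesis
    using inf.V.ord_unit[OF d] inf.V.ord_unit[OF two_unit_at[OF inf.curve_point_axioms]] ord_dx_u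
    by (simp add: inf.ord_at_eq)
qed

text \<open>Where \<open>y\<close> vanishes, \<open>dx/dy\<close> has order 1; elsewhere
  \<open>x\<close> is itself the etale coordinate.\<close>

lemma ramified_iff: "Affine P \<in> ramification_points X \<longleftrightarrow> maxA P \<and> y \<in> P"
proof (cases "maxA P")
  case P: True
  interpret p: curve_point X "Affine P" by (rule curve_point_affine[OF P])
  have "Affine P \<in> ramification_points X \<longleftrightarrow> dx x / dx (coord (Affine P)) \<in> LM (Affine P)"
    using p.differential_vanishes_iff[OF affine_mem(1)[OF P A_x]] p.closed
    by (simp add: ramification_points_def)
  also have "\<dots> \<longleftrightarrow> y \<in> P"
  proof (cases "y \<in> P")
    case True
    have "p.V.ord (inverse (dx y)) = 1"
      using ord_dx_y[OF P True] p.V.ord_inverse[OF dx_y_nz] by (simp add: p.ord_at_eq)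
    then show ?thesis
      using True dx_y_nz p.V.M_iff_ord[of "inverse (dx y)"] by (simp add: dx_x inverse_eq_divide)
  next
    case False
    then show ?thesis using p.V.one_M dx_x by simp
  qed
  finally show ?thesis using P by simp
next
  case False
  then show ?thesis by (simp add: ramification_points_def affine_closed)
qed

text \<open>\<open>du/dv\<close> has order \<open>4 - 3 = 1\<close>, so \<open>1/x\<close> is not
  etale there.\<close>

lemma ramified_infinity: "Infinity \<in> ramification_points X"
proof -
  have u: "u \<in> LR Infinity" "u \<noteq> 0"
    using inf.V.mem_iff_ord[OF u_nz] ord_u u_nz by auto
  have dv: "dx v \<noteq> 0" using inf.dx_coord by simp
  have "inf.V.ord (dx u * inverse (dx v)) = 1"
    using dv dx_u_nz ord_dx_u ord_dx_v by (simp add: inf.V.ord_mult inf.V.ord_inverse inf.ord_at_eq)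
  then have "dx u / dx (coord Infinity) \<in> LM Infinity"
    using dv dx_u_nz inf.V.M_iff_ord[of "dx u * inverse (dx v)"] by (simp add: divide_inverse)
  then show ?thesis
    using inf.differential_vanishes_iff[OF u(1)] infinity_closed
    by (simp add: ramification_points_def u_fun_def)
qed

lemma ramification_points_eq:
  "ramification_points X = insert Infinity {Affine P | P. Affine P \<in> closed_points X \<and>
     y \<in> P \<and> pv f x \<in> P}"
proof -
  have "pv f x \<in> P" if "maxA P" "y \<in> P" for P
    using prime_localization.mult_P[OF affine_localization[OF that(1)] A_y that(2)] y_square
    by (simp add: power2_eq_square)
  then have "p \<in> ramification_points X \<longleftrightarrow> p \<in> insert Infinity {Affine P | P. Affine P \<in> closed_points X \<and>
     y \<in> P \<and> pv f x \<in> P}" for p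
    using ramified_iff ramified_infinity affine_closed by (cases p) auto
  then show ?thesis by blast
qed

text \<open>The differentials of \<open>t\<close> and \<open>coord p\<close> differ by a unit, so
  the order is \<open>-(l + 1) ord s - N ord (dx (coord p))\<close>. At affine points
  \<open>s\<close> is a unit and the last order is -1 or 0; at infinity the two orders are
  \<open>-2 l\<close> and 3.\<close>

lemma ord_wronskian:
  assumes l: "l \<le> genus X" and fr: "frame X (infinity_divisor l) U s t" and p: "p \<in> U"
  shows "ord_at X p (hasse_wronskian X (monomial_basis X l) U s t) =
    int ((l + 1) choose 2) * ramification_divisor X p"
proof -
  note et = frame_etale[OF l fr]
  interpret p: curve_point X p by (rule curve_point_U[OF et p])
  let ?N = "(l + 1) choose 2"
  have nz: "s \<noteq> 0" "dx t \<noteq> 0"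
    using s_nz[OF l fr] dx_t[OF et] by auto
  have "dx t / dx (coord p) \<in> LR p - LM p"
    using p.deriv_coord_mem[OF t_mem[OF et p]] dx_t_unit[OF et p] by blast
  then have "p.V.ord (dx t / dx (coord p)) = 0" by (rule p.V.ord_unit)
  moreover have "dx t = dx t / dx (coord p) * dx (coord p)"
    using p.dx_coord by simp
  then have "p.V.ord (dx t) = p.V.ord (dx t / dx (coord p)) + p.V.ord (dx (coord p))"
    using p.V.ord_mult[of "dx t / dx (coord p)" "dx (coord p)"] nz p.dx_coord by simp
  ultimately have ord_t: "p.V.ord (dx t) = p.V.ord (dx (coord p))" by simp
  have "hasse_wronskian X (monomial_basis X l) U s t = inverse s ^ (l + 1) * inverse (dx t) ^ ?N"
    unfolding wronskian_eq[OF l fr] by (simp only: inverse_eq_divide)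
  also have "p.V.ord \<dots> = p.V.ord (inverse s ^ (l + 1)) + p.V.ord (inverse (dx t) ^ ?N)"
    using nz by (intro p.V.ord_mult) simp_all
  also have "\<dots> = - int (l + 1) * p.V.ord s - int ?N * p.V.ord (dx (coord p))"
    using p.V.ord_power[of "inverse s" "l + 1"] p.V.ord_power[of "inverse (dx t)" ?N]
      p.V.ord_inverse nz ord_t by (simp del: power_Suc add: algebra_simps)
  finally have W: "ord_at X p (hasse_wronskian X (monomial_basis X l) U s t) =
      - int (l + 1) * p.V.ord s - int ?N * p.V.ord (dx (coord p))"
    by (simp add: p.ord_at_eq)
  note stalk = frame_stalk[OF l fr p]
  have s_stalk: "s \<in> bundle_stalk X (infinity_divisor l) p"
    unfolding stalk using p.V.one_mem by force
  have "x ^ l \<in> {s * a | a. a \<in> LR p}"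
    using x_power_stalk[OF l fr p.closed, of l] stalk by simp
  show ?thesis
  proof (cases p)
    case (Affine P)
    have P: "maxA P" using p.closed Affine affine_closed by simp
    have "1 \<in> {s * a | a. a \<in> LR p}"
      using x_power_stalk[OF l fr p.closed, of 0] stalk by simp
    then obtain a where a: "a \<in> LR p" "1 = s * a" by blast
    have "s \<in> LR p" using s_stalk infinity_divisor_affine[OF P] Affine by simp
    moreover have "s \<notin> LM p"
      using a p.V.mult_M[of a s] p.V.one_M by (auto simp: mult.commute)
    ultimately have s0: "p.V.ord s = 0" using p.V.ord_unit by blast
    show ?thesis
    proof (cases "y \<in> P")
      case True
      have "ord_at X p (dx (coord p)) = - 1"
        using ord_dx_y[OF P True] True Affine by simp
      then have "p.V.ord (dx (coord p)) = - 1"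
        by (simp only: p.ord_at_eq)
      moreover have "ramification_divisor X p = 1"
        using True Affine ramified_iff P by (simp add: ramification_divisor_def)
      ultimately show ?thesis by (simp add: W s0)
    next
      case False
      then have "p.V.ord (dx (coord p)) = 0" "ramification_divisor X p = 0"
        using Affine ramified_iff dx_x p.V.ord_unit[OF p.V.unit_one]
        by (simp_all add: ramification_divisor_def)
      then show ?thesis by (simp add: W s0)
    qed
  next
    case Infinity
    have xl: "p.V.ord (x ^ l) = - 2 * int l"
      using inf.V.ord_power[OF x_nz, of l] ord_x Infinity by simp
    \<comment> \<open>\<open>s\<close> divides \<open>x^l\<close>, which bounds its order from above
      by \<open>-2 l\<close>; membership of \<open>s\<close> in the stalk gives the opposite
      bound.\<close>
    obtain a where a: "a \<in> LR p" "x ^ l = s * a"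
      using \<open>x ^ l \<in> {s * a | a. a \<in> LR p}\<close> by blast
    then have "a \<noteq> 0" using x_nz by auto
    then have "- 2 * int l = p.V.ord s + p.V.ord a" "0 \<le> p.V.ord a"
      using xl a p.V.ord_mult[OF nz(1), of a] p.V.mem_iff_ord[of a] by auto
    moreover have "- 2 * int l \<le> p.V.ord s"
      using s_stalk nz(1) Infinity by (simp add: bundle_stalk_def inf.ord_at_eq)
    ultimately have s0: "p.V.ord s = - 2 * int l" by linarith
    have "ord_at X p (dx (coord p)) = 3"
      using ord_dx_v Infinity by simp
    then have d: "p.V.ord (dx (coord p)) = 3"
      by (simp only: p.ord_at_eq)
    have ram: "ramification_divisor X p = 1"
      using ramified_infinity Infinity by (simp add: ramification_divisor_def)
    have "(l + 1) * l = 2 * ?N"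
      by (simp add: choose_two)
    then have "int (l + 1) * int l = 2 * int ?N"
      by (metis of_nat_mult of_nat_numeral)
    then show ?thesis by (simp add: W s0 d ram algebra_simps)
  qed
qed

lemma frame_exists:
  assumes p: "p \<in> closed_points X"
  shows "\<exists>U s t. frame X (infinity_divisor l) U s t \<and> p \<in> U"
proof -
  interpret p: curve_point X p by (rule curve_pointI[OF p])
  define t where "t = coord p"
  define s where "s = (if p = Infinity then x ^ l else 1)"
  have nz: "t \<noteq> 0" "dx t \<noteq> 0" "s \<noteq> 0"
    using x_nz y_nz v_nz p.dx_coord by (cases p; auto simp: t_def s_def)+
  let ?bad = "\<lambda>\<phi>. {P. maxA P \<and> \<phi> \<notin> LR (Affine P) - LM (Affine P)}"
  \<comment> \<open>Discarding the zeros of \<open>y\<close> leaves \<open>x\<close> as etale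
    coordinate at the remaining affine points, so there \<open>t\<close> is etale once
    \<open>dx t\<close> is a unit.\<close>
  define Z where "Z = ?bad y \<union> ?bad t \<union> ?bad (dx t) \<union> ?bad s"
  have Z: "finite Z"
    unfolding Z_def by (intro finite_UnI finite_nonunits nz y_nz)
  \<comment> \<open>\<open>p\<close> may itself be among the discarded points; it is put back
    because \<open>t\<close> is the etale coordinate at \<open>p\<close>.\<close>
  define U where "U = insert p {Affine P | P. maxA P \<and> P \<notin> Z}"
  have U_closed: "U \<subseteq> closed_points X"
    using p affine_closed by (auto simp: U_def)
  have "q \<in> insert Infinity (Affine ` Z)" if "q \<in> closed_points X - U" for q
    using that affine_closed by (cases q) (auto simp: U_def)
  then have open_U: "open_subset X U"
    using U_closed Z finite_subset[of "closed_points X - U" "insert Infinity (Affine ` Z)"]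
    by (auto simp: open_subset_def U_def)
  have good: "y \<notin> P \<and> t \<in> LR (Affine P) \<and> dx t \<notin> LM (Affine P) \<and> s \<in> LR (Affine P) - LM (Affine P)"
    if "maxA P" "P \<notin> Z" for P
    using that affine_mem[OF that(1) A_y] by (auto simp: Z_def)
  have "etale_on U t"
    unfolding etale_on_def
  proof (intro conjI ballI U_closed nz)
    fix q assume "q \<in> U"
    then consider "q = p" | P where "q = Affine P" "maxA P" "P \<notin> Z"
      by (auto simp: U_def)
    then have "t \<in> LR q \<and> dx t / dx (coord q) \<notin> LM q"
    proof cases
      case 1
      then show ?thesis
        using p.coord_mem p.V.one_M p.dx_coord by (simp add: t_def)
    next
      case 2
      then show ?thesis
        using good[OF 2(2,3)] dx_x by simp
    qed
    then show "t \<in> LR q" "dx t / dx (coord q) \<notin> LM q"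
      by blast+
  qed
  then have "etale_coordinate X U t"
    using etale_coordinate_iff[OF U_closed] by (auto simp: U_def)
  moreover have "local_generator X (infinity_divisor l) U s"
    unfolding local_generator_def
  proof
    have unit_gen: "bundle_stalk X (infinity_divisor l) (Affine P) = {s * a | a. a \<in> LR (Affine P)}"
      if P: "maxA P" and su: "s \<in> LR (Affine P) - LM (Affine P)" for P
    proof -
      interpret P: curve_point X "Affine P" by (rule curve_point_affine[OF P])
      have "\<phi> = s * (\<phi> / s)" "\<phi> / s \<in> LR (Affine P)" if "\<phi> \<in> LR (Affine P)" for \<phi>
        using nz(3) P.V.divide_V[OF that su] by simp_all
      then show ?thesis
        unfolding infinity_divisor_affine[OF P] using su P.V.mult_mem by blast
    qed
    fix q assume "q \<in> U"
    then consider P where "q = p" "p = Affine P" | "q = p" "p = Infinity"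
        | P where "q = Affine P" "maxA P" "P \<notin> Z"
      by (cases p) (auto simp: U_def)
    then show "bundle_stalk X (infinity_divisor l) q = {s * a | a. a \<in> LR q}"
    proof cases
      case (1 P)
      then have "maxA P" using p affine_closed by simp
      then show ?thesis
        using 1 unit_gen[of P] p.V.unit_one by (simp add: s_def)
    next
      case 2
      have ord_s: "inf.V.ord s = - 2 * int l"
        using inf.V.ord_power[OF x_nz, of l] ord_x 2 by (simp add: s_def)
      have "\<phi> \<in> bundle_stalk X (infinity_divisor l) Infinity \<longleftrightarrow> \<phi> / s \<in> LR Infinity" for \<phi>
      proof (cases "\<phi> = 0")
        case False
        then show ?thesis
          using nz(3) ord_s inf.V.mem_iff_ord[of "\<phi> / s"] inf.V.ord_mult[of \<phi> "inverse s"]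
            inf.V.ord_inverse[of s]
          by (auto simp: bundle_stalk_def inf.ord_at_eq divide_inverse)
      qed (simp add: bundle_stalk_def inf.V.zero_mem)
      moreover have "\<phi> / s \<in> LR Infinity \<longleftrightarrow> \<phi> \<in> {s * a | a. a \<in> LR Infinity}" for \<phi>
      proof
        assume "\<phi> / s \<in> LR Infinity"
        moreover have "\<phi> = s * (\<phi> / s)" using nz(3) by simp
        ultimately show "\<phi> \<in> {s * a | a. a \<in> LR Infinity}" by blast
      qed (use nz(3) in auto)
      ultimately show ?thesis using 2 by blast
    next
      case (3 P)
      then show ?thesis using unit_gen good by simp
    qed
  qed
  ultimately show ?thesis
    using open_U unfolding frame_def U_def by blast
qed

text \<open>Removing infinity keeps \<open>U\<close> open and makes 1 a generator, as the divisor is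
  supported at infinity.\<close>

lemma nisnevich_frame:
  assumes t: "nisnevich_uniformizer X p t" and p: "p \<noteq> Infinity"
  shows "\<exists>U. p \<in> U \<and> frame X (infinity_divisor l) U 1 t"
proof -
  obtain U where U: "open_subset X U" "p \<in> U" "etale_coordinate X U t"
    using t unfolding nisnevich_uniformizer_def by blast
  let ?U = "U - {Infinity}"
  have "closed_points X - ?U \<subseteq> insert Infinity (closed_points X - U)" by blast
  then have "open_subset X ?U"
    using U p by (auto simp: open_subset_def intro: finite_subset)
  moreover have "etale_coordinate X ?U t"
    using U(3) by (auto simp: etale_coordinate_def regular_functions_def)
  moreover have "local_generator X (infinity_divisor l) ?U 1"
    unfolding local_generator_def
  proof
    fix q assume q: "q \<in> ?U"
    then obtain P where P: "q = Affine P" by (cases q) auto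
    then have "maxA P"
      using q U(1) affine_closed by (auto simp: open_subset_def)
    from infinity_divisor_affine[OF this]
    show "bundle_stalk X (infinity_divisor l) q = {1 * a | a. a \<in> LR q}"
      unfolding P by simp
  qed
  ultimately have "frame X (infinity_divisor l) ?U 1 t"
    unfolding frame_def by (intro conjI)
  moreover have "p \<in> ?U" using U(2) p by simp
  ultimately show ?thesis by (intro exI conjI)
qed

end

theorem theorem3p3:
  fixes X :: "('a::field, 'k::field) hyp_curve" and l :: nat
  assumes "hyperelliptic_curve X"
    and "1 \<le> l" and "l \<le> genus X"
  shows "is_basis_of X (monomial_basis X l) (global_sections X (infinity_divisor l)) \<and>
    is_global_section X (infinity_divisor l) (l + 1) ((l + 1) choose 2)
      (hasse_wronskian X (monomial_basis X l)) \<and>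
    ramification_points X =
      insert Infinity {Affine P | P. Affine P \<in> closed_points X \<and>
        yfun X \<in> P \<and> polyval X (defpol X) (xfun X) \<in> P} \<and>
    has_zero_divisor X (infinity_divisor l) (hasse_wronskian X (monomial_basis X l))
      (\<lambda>p. int ((l + 1) choose 2) * ramification_divisor X p) \<and>
    (\<forall>p t. p \<in> section_zeros X (infinity_divisor l) (hasse_wronskian X (monomial_basis X l)) \<and>
        p \<noteq> Infinity \<and> p \<in> ramification_points X \<and> nisnevich_uniformizer X p t \<longrightarrow>
      (\<exists>U. p \<in> U \<and> frame X (infinity_divisor l) U 1 t) \<and>
      (\<forall>U. p \<in> U \<and> frame X (infinity_divisor l) U 1 t \<longrightarrow>
        hasse_wronskian X (monomial_basis X l) U 1 t =
          hasse X U t 1 (xfun X) ^ ((l + 1) choose 2)))"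
proof -
  interpret hyperelliptic X by unfold_locales (rule assms(1))
  note l = assms(3)
  have "hasse_wronskian X (monomial_basis X l) U s t \<noteq> 0"
    if "frame X (infinity_divisor l) U s t" for U s t
    using wronskian_eq[OF l that] s_nz[OF l that] dx_t[OF frame_etale[OF l that]] by simp
  then have zeros: "has_zero_divisor X (infinity_divisor l) (hasse_wronskian X (monomial_basis X l))
      (\<lambda>p. int ((l + 1) choose 2) * ramification_divisor X p)"
    unfolding has_zero_divisor_def using frame_exists ord_wronskian[OF l] by blast
  have wronskian_value: "hasse_wronskian X (monomial_basis X l) U 1 t = hasse X U t 1 x ^ ((l + 1) choose 2)"
    if fr: "frame X (infinity_divisor l) U 1 t" for U t
  proof -
    \<comment> \<open>As \<open>1 \<le> l\<close>, the function \<open>x\<close> is one of the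
      sections and hence regular on \<open>U\<close>; outside the regular functions
      \<open>hasse\<close> has the default value 0.\<close>
    have "x \<in> OU U"
      using section_quotient_regular[OF l fr, of 1] assms(2) by simp
    then have "hasse X U t 1 x = 1 / dx t"
      using hasse_1_eq[OF frame_etale[OF l fr]] dx_x by simp
    then show ?thesis
      using wronskian_eq[OF l fr] by simp
  qed
  show ?thesis
  proof (intro conjI allI impI)
    fix p t
    assume "p \<in> section_zeros X (infinity_divisor l) (hasse_wronskian X (monomial_basis X l)) \<and>
      p \<noteq> Infinity \<and> p \<in> ramification_points X \<and> nisnevich_uniformizer X p t"
    then show "\<exists>U. p \<in> U \<and> frame X (infinity_divisor l) U 1 t"
      by (elim conjE) (rule nisnevich_frame)
    fix U assume "p \<in> U \<and> frame X (infinity_divisor l) U 1 t"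
    then show "hasse_wronskian X (monomial_basis X l) U 1 t = hasse X U t 1 x ^ ((l + 1) choose 2)"
      by (elim conjE wronskian_value)
  qed (rule monomial_basis_is_basis[OF l] wronskian_global_section[OF l] ramification_points_eq zeros)+
qed

end
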